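(* There is a $\Sigma^1_2$ second-order sentence $\psi$ in the language with one unary function symbol $f$ and one individual constant $c$ which is a categorical characterization of $\langle\mathbb{N},S,0\rangle$ provably in $\mathsf{RCA}^*_0+\neg\mathrm{WKL}$; that is, $\mathsf{RCA}^*_0+\neg\mathrm{WKL}$ proves both (i) $\langle\mathbb{N},S,0\rangle\models\psi$, and (ii) for every structure $\langle A,f,c\rangle$, if $\langle A,f,c\rangle\models\psi$, then there exists an isomorphism between $\langle\mathbb{N},S,0\rangle$ and $\langle A,f,c\rangle$.
   Context: Theories. $\mathsf{RCA}^*_0$ is the theory in the language of second-order arithmetic consisting of the usual basic arithmetical axioms, $\Delta^0_1$ comprehension, induction for $\Delta^0_0$ formulas (bounded formulas, set parameters allowed), and the axiom $\exp$ stating totality of exponentiation. WKL is the axiom "every infinite binary tree has an infinite branch". Structures and satisfaction inside the theory. $\mathbb{N}$ is the set of all numbers (defined by $x=x$), $S$ is successor. A structure $\langle A,f,c\rangle$ is given by a set $A\subseteq\mathbb{N}$, a function $f\colon A\to A$ (its graph, coded as a set of pairs) and $c\in A$; isomorphisms are functions coded by sets. Second-order logic allows quantification over relations of any arity and has the standard (full) semantics: in $\langle A,f,c\rangle\models\psi$, first-order quantifiers range over elements of $A$ and second-order quantifiers over $k$-ary relations range over all sets (of the theory) coding $k$-ary relations on $A$. A $\Sigma^1_2$ sentence is a block of existential second-order quantifiers followed by a block of universal second-order quantifiers followed by a first-order formula, up to logical equivalence. *)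

theory Defs
  imports Main
begin

section \<open>Second-order arithmetic as a two-sorted first-order theory\<close>

text \<open>
  Both number variables and set variables are de Bruijn indices, counted separately for
  the two sorts. The second argument of \<open>Mem\<close> is a set variable. The connectives and
  quantifiers that are not constructors are the usual classical abbreviations.
\<close>

datatype tm = NVar nat | NZero | NOne | Plus tm tm | Times tm tm

datatype fm =
    Eq tm tm
  | Less tm tm
  | Mem tm nat
  | Falsum
  | Imp fm fm
  | Forall fm
  | ForallS fm

abbreviation Neg :: "fm \<Rightarrow> fm" where "Neg \<phi> \<equiv> Imp \<phi> Falsum"
abbreviation And :: "fm \<Rightarrow> fm \<Rightarrow> fm" where "And \<phi> \<psi> \<equiv> Neg (Imp \<phi> (Neg \<psi>))"
abbreviation Or :: "fm \<Rightarrow> fm \<Rightarrow> fm" where "Or \<phi> \<psi> \<equiv> Imp (Neg \<phi>) \<psi>"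
abbreviation Iff :: "fm \<Rightarrow> fm \<Rightarrow> fm" where "Iff \<phi> \<psi> \<equiv> And (Imp \<phi> \<psi>) (Imp \<psi> \<phi>)"
abbreviation Exists :: "fm \<Rightarrow> fm" where "Exists \<phi> \<equiv> Neg (Forall (Neg \<phi>))"
abbreviation ExistsS :: "fm \<Rightarrow> fm" where "ExistsS \<phi> \<equiv> Neg (ForallS (Neg \<phi>))"

primrec tsub :: "(nat \<Rightarrow> tm) \<Rightarrow> tm \<Rightarrow> tm" where
  "tsub \<sigma> (NVar n) = \<sigma> n"
| "tsub \<sigma> NZero = NZero"
| "tsub \<sigma> NOne = NOne"
| "tsub \<sigma> (Plus s t) = Plus (tsub \<sigma> s) (tsub \<sigma> t)"
| "tsub \<sigma> (Times s t) = Times (tsub \<sigma> s) (tsub \<sigma> t)"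

abbreviation lift :: "tm \<Rightarrow> tm" where "lift \<equiv> tsub (\<lambda>n. NVar (Suc n))"

text \<open>Simultaneous capture-avoiding substitution of terms for number variables and of set
  variables for set variables.\<close>

primrec fsub :: "(nat \<Rightarrow> tm) \<Rightarrow> (nat \<Rightarrow> nat) \<Rightarrow> fm \<Rightarrow> fm" where
  "fsub \<sigma> \<rho> (Eq s t) = Eq (tsub \<sigma> s) (tsub \<sigma> t)"
| "fsub \<sigma> \<rho> (Less s t) = Less (tsub \<sigma> s) (tsub \<sigma> t)"
| "fsub \<sigma> \<rho> (Mem t X) = Mem (tsub \<sigma> t) (\<rho> X)"
| "fsub \<sigma> \<rho> Falsum = Falsum"
| "fsub \<sigma> \<rho> (Imp \<phi> \<psi>) = Imp (fsub \<sigma> \<rho> \<phi>) (fsub \<sigma> \<rho> \<psi>)"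
| "fsub \<sigma> \<rho> (Forall \<phi>) = Forall (fsub (case_nat (NVar 0) (\<lambda>n. lift (\<sigma> n))) \<rho> \<phi>)"
| "fsub \<sigma> \<rho> (ForallS \<phi>) = ForallS (fsub \<sigma> (case_nat 0 (\<lambda>n. Suc (\<rho> n))) \<phi>)"

definition inst :: "tm \<Rightarrow> fm \<Rightarrow> fm" where
  "inst t = fsub (case_nat t NVar) (\<lambda>X. X)"

definition instS :: "nat \<Rightarrow> fm \<Rightarrow> fm" where
  "instS Y = fsub NVar (case_nat Y (\<lambda>X. X))"

definition liftF :: "fm \<Rightarrow> fm" where
  "liftF = fsub (\<lambda>n. NVar (Suc n)) (\<lambda>X. X)"

definition liftFS :: "fm \<Rightarrow> fm" where
  "liftFS = fsub NVar Suc"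

text \<open>
  Classical two-sorted natural deduction with equality on numbers, from the non-logical
  axioms \<open>T\<close> and the local hypotheses \<open>\<Gamma>\<close>. Free variables of members of \<open>T\<close> are
  implicitly universally quantified: the eigenvariable conditions concern \<open>\<Gamma>\<close> only.
\<close>

inductive derives :: "fm set \<Rightarrow> fm list \<Rightarrow> fm \<Rightarrow> bool" for T :: "fm set" where
  Axm: "\<phi> \<in> T \<Longrightarrow> derives T \<Gamma> \<phi>"
| Hyp: "\<phi> \<in> set \<Gamma> \<Longrightarrow> derives T \<Gamma> \<phi>"
| ImpI: "derives T (\<phi> # \<Gamma>) \<psi> \<Longrightarrow> derives T \<Gamma> (Imp \<phi> \<psi>)"
| ImpE: "derives T \<Gamma> (Imp \<phi> \<psi>) \<Longrightarrow> derives T \<Gamma> \<phi> \<Longrightarrow> derives T \<Gamma> \<psi>"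
| Contr: "derives T (Neg \<phi> # \<Gamma>) Falsum \<Longrightarrow> derives T \<Gamma> \<phi>"
| AllI: "derives T (map liftF \<Gamma>) \<phi> \<Longrightarrow> derives T \<Gamma> (Forall \<phi>)"
| AllE: "derives T \<Gamma> (Forall \<phi>) \<Longrightarrow> derives T \<Gamma> (inst t \<phi>)"
| AllSI: "derives T (map liftFS \<Gamma>) \<phi> \<Longrightarrow> derives T \<Gamma> (ForallS \<phi>)"
| AllSE: "derives T \<Gamma> (ForallS \<phi>) \<Longrightarrow> derives T \<Gamma> (instS Y \<phi>)"
| EqRefl: "derives T \<Gamma> (Eq t t)"
| EqSubst: "derives T \<Gamma> (Eq s t) \<Longrightarrow> derives T \<Gamma> (inst s \<phi>) \<Longrightarrow> derives T \<Gamma> (inst t \<phi>)"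

definition proves :: "fm set \<Rightarrow> fm \<Rightarrow> bool" where
  "proves T \<phi> \<longleftrightarrow> derives T [] \<phi>"


section \<open>The axioms\<close>

abbreviation BForall :: "tm \<Rightarrow> fm \<Rightarrow> fm" where
  "BForall t \<phi> \<equiv> Forall (Imp (Less (NVar 0) (lift t)) \<phi>)"

abbreviation BExists :: "tm \<Rightarrow> fm \<Rightarrow> fm" where
  "BExists t \<phi> \<equiv> Exists (And (Less (NVar 0) (lift t)) \<phi>)"

inductive Delta00 :: "fm \<Rightarrow> bool" where
  "Delta00 (Eq s t)"
| "Delta00 (Less s t)"
| "Delta00 (Mem t X)"
| "Delta00 Falsum"
| "Delta00 \<phi> \<Longrightarrow> Delta00 \<psi> \<Longrightarrow> Delta00 (Imp \<phi> \<psi>)"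
| "Delta00 \<phi> \<Longrightarrow> Delta00 (BForall t \<phi>)"
| "Delta00 \<phi> \<Longrightarrow> Delta00 (BExists t \<phi>)"

definition basic_axioms :: "fm set" where
  "basic_axioms = (let m = NVar 0; n = NVar 1 in
    { Neg (Eq (Plus n NOne) NZero),
      Imp (Eq (Plus m NOne) (Plus n NOne)) (Eq m n),
      Eq (Plus m NZero) m,
      Eq (Plus m (Plus n NOne)) (Plus (Plus m n) NOne),
      Eq (Times m NZero) NZero,
      Eq (Times m (Plus n NOne)) (Plus (Times m n) m),
      Neg (Less m NZero),
      Iff (Less m (Plus n NOne)) (Or (Less m n) (Eq m n)) })"

definition induction_axiom :: "fm \<Rightarrow> fm" where
  "induction_axiom \<phi> =
    Imp (And (inst NZero \<phi>)
             (Forall (Imp \<phi> (fsub (case_nat (Plus (NVar 0) NOne) (\<lambda>n. NVar (Suc n))) (\<lambda>X. X) \<phi>))))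
        (Forall \<phi>)"

text \<open>Here \<open>\<phi>\<close> and \<open>\<psi>\<close> are the bounded matrices: number variable 1 is the element and
  number variable 0 the unbounded witness of the \<open>\<Sigma>\<close> and \<open>\<Pi>\<close> definition.\<close>

definition comprehension_axiom :: "fm \<Rightarrow> fm \<Rightarrow> fm" where
  "comprehension_axiom \<phi> \<psi> =
    Imp (Forall (Iff (Exists \<phi>) (Forall \<psi>)))
        (ExistsS (Forall (Iff (Mem (NVar 0) 0) (liftFS (Exists \<phi>)))))"

text \<open>\<open>beta_fm u v i z\<close>: Goedel's beta function, i.e. \<open>z\<close> is the remainder of \<open>u\<close> on
  division by \<open>1 + (i + 1) * v\<close>.\<close>

definition beta_fm :: "tm \<Rightarrow> tm \<Rightarrow> tm \<Rightarrow> tm \<Rightarrow> fm" where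
  "beta_fm u v i z = (let d = (\<lambda>i v. Plus NOne (Times (Plus i NOne) v)) in
    And (Less z (d i v))
        (BExists (Plus u NOne)
          (Eq (lift u) (Plus (Times (NVar 0) (d (lift i) (lift v))) (lift z)))))"

text \<open>\<open>exp_fm b n y\<close>: there is a beta code \<open>u, v\<close> of the sequence of powers
  \<open>b ^ 0, \<dots>, b ^ n\<close>, and its last entry is \<open>y\<close>. Within the two outer quantifiers
  \<open>u, v\<close> are \<open>NVar 1, NVar 0\<close>; inside the bounded ones \<open>z, i, v, u\<close> are
  \<open>NVar 0, \<dots>, NVar 3\<close>.\<close>

definition exp_fm :: "tm \<Rightarrow> tm \<Rightarrow> tm \<Rightarrow> fm" where
  "exp_fm b n y = (let up2 = (\<lambda>t. lift (lift t)) in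
    Exists (Exists
      (And (beta_fm (NVar 1) (NVar 0) NZero NOne)
      (And (BForall (up2 n)
             (BExists (Plus (NVar 2) NOne)
               (And (beta_fm (NVar 3) (NVar 2) (NVar 1) (NVar 0))
                    (beta_fm (NVar 3) (NVar 2) (Plus (NVar 1) NOne)
                             (Times (NVar 0) (up2 (up2 b)))))))
           (beta_fm (NVar 1) (NVar 0) (up2 n) (up2 y))))))"

definition exp_axiom :: fm where
  "exp_axiom = Forall (Forall (Exists (exp_fm (NVar 2) (NVar 1) (NVar 0))))"

definition RCA0_star :: "fm set" where
  "RCA0_star =
     basic_axioms
     \<union> {induction_axiom \<phi> | \<phi>. Delta00 \<phi>}
     \<union> {comprehension_axiom \<phi> \<psi> | \<phi> \<psi>. Delta00 \<phi> \<and> Delta00 \<psi>}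
     \<union> {exp_axiom}"

text \<open>
  Finite binary sequences are coded by bijective base-2 numeration: \<open>0\<close> codes the empty
  sequence, and if \<open>n\<close> codes \<open>\<sigma>\<close> then \<open>2 * n + 1\<close> and \<open>2 * n + 2\<close> code the extensions
  of \<open>\<sigma>\<close> by the digits 0 and 1. So every number is a code, a tree is a set closed under
  predecessors, and an infinite branch is given as the set of its initial segments.
\<close>

definition snoc0 :: "tm \<Rightarrow> tm" where "snoc0 t = Plus (Plus t t) NOne"
definition snoc1 :: "tm \<Rightarrow> tm" where "snoc1 t = Plus (snoc0 t) NOne"

definition tree_fm :: "nat \<Rightarrow> fm" where
  "tree_fm T = Forall (Imp (Or (Mem (snoc0 (NVar 0)) T) (Mem (snoc1 (NVar 0)) T)) (Mem (NVar 0) T))"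

definition infinite_fm :: "nat \<Rightarrow> fm" where
  "infinite_fm T = Forall (Exists (And (Less (NVar 1) (NVar 0)) (Mem (NVar 0) T)))"

definition branch_fm :: "nat \<Rightarrow> nat \<Rightarrow> fm" where
  "branch_fm B T =
    And (Forall (Imp (Mem (NVar 0) B) (Mem (NVar 0) T)))
   (And (tree_fm B)
   (And (Mem NZero B)
        (Forall (Imp (Mem (NVar 0) B)
                     (Iff (Mem (snoc0 (NVar 0)) B) (Neg (Mem (snoc1 (NVar 0)) B)))))))"

definition WKL :: fm where
  "WKL = ForallS (Imp (And (tree_fm 0) (infinite_fm 0)) (ExistsS (branch_fm 0 1)))"


section \<open>Structures coded inside the theory\<close>

definition pair :: "tm \<Rightarrow> tm \<Rightarrow> tm" where
  "pair s t = Plus (Times (Plus s t) (Plus s t)) s"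

definition function_fm :: "nat \<Rightarrow> nat \<Rightarrow> nat \<Rightarrow> fm" where
  "function_fm F A B =
    And (Forall (Imp (Mem (NVar 0) F)
          (Exists (Exists (And (Mem (NVar 1) A)
                          (And (Mem (NVar 0) B) (Eq (NVar 2) (pair (NVar 1) (NVar 0)))))))))
        (Forall (Imp (Mem (NVar 0) A)
          (Exists (Forall (Iff (Mem (pair (NVar 2) (NVar 0)) F) (Eq (NVar 0) (NVar 1)))))))"

definition structure_fm :: "nat \<Rightarrow> nat \<Rightarrow> tm \<Rightarrow> fm" where
  "structure_fm A F c = And (function_fm F A A) (Mem c A)"

text \<open>\<open>H\<close> is an isomorphism from \<open>(A, F, c)\<close> to \<open>(B, G, d)\<close>. In the last conjunct the
  bound variables are \<open>x, x', y, y'\<close>, from the outside in.\<close>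

definition iso_fm :: "nat \<Rightarrow> nat \<Rightarrow> nat \<Rightarrow> tm \<Rightarrow> nat \<Rightarrow> nat \<Rightarrow> tm \<Rightarrow> fm" where
  "iso_fm H A F c B G d =
    And (function_fm H A B)
   (And (Forall (Imp (Mem (NVar 0) B)
          (Exists (Forall (Iff (Mem (pair (NVar 0) (NVar 2)) H) (Eq (NVar 0) (NVar 1)))))))
   (And (Mem (pair c d) H)
        (Forall (Forall (Forall (Forall
          (Imp (And (Mem (pair (NVar 3) (NVar 2)) F)
               (And (Mem (pair (NVar 3) (NVar 1)) H) (Mem (pair (NVar 2) (NVar 0)) H)))
               (Mem (pair (NVar 1) (NVar 0)) G))))))))"

definition all_numbers_fm :: "nat \<Rightarrow> fm" where
  "all_numbers_fm N = Forall (Mem (NVar 0) N)"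

definition successor_fm :: "nat \<Rightarrow> fm" where
  "successor_fm S =
    Forall (Iff (Mem (NVar 0) S) (Exists (Eq (NVar 1) (pair (NVar 0) (Plus (NVar 0) NOne)))))"


section \<open>Second-order logic with one function symbol and one constant\<close>

text \<open>
  Element variables and relation variables are de Bruijn indices, counted separately. A
  second-order quantifier carries the arity of the relations it ranges over.
\<close>

datatype stm = SVar nat | SConst | SFun stm

datatype sfm =
    SEq stm stm
  | SRel nat "stm list"
  | SNeg sfm
  | SAnd sfm sfm
  | SOr sfm sfm
  | SImp sfm sfm
  | SForall sfm
  | SExists sfm
  | SForall2 nat sfm
  | SExists2 nat sfm

primrec stm_wf :: "nat \<Rightarrow> stm \<Rightarrow> bool" where
  "stm_wf n (SVar i) \<longleftrightarrow> i < n"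
| "stm_wf n SConst \<longleftrightarrow> True"
| "stm_wf n (SFun t) \<longleftrightarrow> stm_wf n t"

text \<open>\<open>sfm_wf n ks \<phi>\<close>: the free element variables of \<open>\<phi>\<close> are among the first \<open>n\<close>, its free
  relation variables have the arities \<open>ks\<close>, and all arities are respected.\<close>

primrec sfm_wf :: "nat \<Rightarrow> nat list \<Rightarrow> sfm \<Rightarrow> bool" where
  "sfm_wf n ks (SEq s t) \<longleftrightarrow> stm_wf n s \<and> stm_wf n t"
| "sfm_wf n ks (SRel i ts) \<longleftrightarrow> i < length ks \<and> length ts = ks ! i \<and> (\<forall>t\<in>set ts. stm_wf n t)"
| "sfm_wf n ks (SNeg \<phi>) \<longleftrightarrow> sfm_wf n ks \<phi>"
| "sfm_wf n ks (SAnd \<phi> \<psi>) \<longleftrightarrow> sfm_wf n ks \<phi> \<and> sfm_wf n ks \<psi>"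
| "sfm_wf n ks (SOr \<phi> \<psi>) \<longleftrightarrow> sfm_wf n ks \<phi> \<and> sfm_wf n ks \<psi>"
| "sfm_wf n ks (SImp \<phi> \<psi>) \<longleftrightarrow> sfm_wf n ks \<phi> \<and> sfm_wf n ks \<psi>"
| "sfm_wf n ks (SForall \<phi>) \<longleftrightarrow> sfm_wf (Suc n) ks \<phi>"
| "sfm_wf n ks (SExists \<phi>) \<longleftrightarrow> sfm_wf (Suc n) ks \<phi>"
| "sfm_wf n ks (SForall2 k \<phi>) \<longleftrightarrow> k \<ge> 1 \<and> sfm_wf n (k # ks) \<phi>"
| "sfm_wf n ks (SExists2 k \<phi>) \<longleftrightarrow> k \<ge> 1 \<and> sfm_wf n (k # ks) \<phi>"

definition sentence :: "sfm \<Rightarrow> bool" where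
  "sentence \<psi> \<longleftrightarrow> sfm_wf 0 [] \<psi>"

primrec first_order :: "sfm \<Rightarrow> bool" where
  "first_order (SEq s t) \<longleftrightarrow> True"
| "first_order (SRel i ts) \<longleftrightarrow> True"
| "first_order (SNeg \<phi>) \<longleftrightarrow> first_order \<phi>"
| "first_order (SAnd \<phi> \<psi>) \<longleftrightarrow> first_order \<phi> \<and> first_order \<psi>"
| "first_order (SOr \<phi> \<psi>) \<longleftrightarrow> first_order \<phi> \<and> first_order \<psi>"
| "first_order (SImp \<phi> \<psi>) \<longleftrightarrow> first_order \<phi> \<and> first_order \<psi>"
| "first_order (SForall \<phi>) \<longleftrightarrow> first_order \<phi>"
| "first_order (SExists \<phi>) \<longleftrightarrow> first_order \<phi>"
| "first_order (SForall2 k \<phi>) \<longleftrightarrow> False"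
| "first_order (SExists2 k \<phi>) \<longleftrightarrow> False"

definition Sigma12 :: "sfm \<Rightarrow> bool" where
  "Sigma12 \<psi> \<longleftrightarrow> (\<exists>ks ls \<theta>. first_order \<theta> \<and> \<psi> = foldr SExists2 ks (foldr SForall2 ls \<theta>))"


section \<open>Satisfaction as a formula of second-order arithmetic\<close>

text \<open>
  A structure is given by set variables \<open>A\<close>, \<open>F\<close> and a number term \<open>c\<close>; the environments
  \<open>e\<close> and \<open>r\<close> translate element variables into number terms and relation variables into
  set variables. A \<open>k\<close>-tuple is coded by iterated pairing to the right; the clauses for
  \<open>k = 0\<close> only make the functions total.
\<close>

abbreviation env_cons :: "(nat \<Rightarrow> tm) \<Rightarrow> nat \<Rightarrow> tm" where
  "env_cons e \<equiv> case_nat (NVar 0) (\<lambda>n. lift (e n))"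

text \<open>\<open>y\<close> is the value of \<open>t\<close>.\<close>

primrec value_fm :: "nat \<Rightarrow> tm \<Rightarrow> (nat \<Rightarrow> tm) \<Rightarrow> stm \<Rightarrow> tm \<Rightarrow> fm" where
  "value_fm F c e (SVar i) y = Eq y (e i)"
| "value_fm F c e SConst y = Eq y c"
| "value_fm F c e (SFun t) y =
     Exists (And (value_fm F (lift c) (\<lambda>n. lift (e n)) t (NVar 0)) (Mem (pair (NVar 0) (lift y)) F))"

text \<open>\<open>p\<close> codes the tuple of the values of \<open>ts\<close>.\<close>

fun values_fm :: "nat \<Rightarrow> tm \<Rightarrow> (nat \<Rightarrow> tm) \<Rightarrow> stm list \<Rightarrow> tm \<Rightarrow> fm" where
  "values_fm F c e [] p = Eq p NZero"
| "values_fm F c e [t] p = value_fm F c e t p"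
| "values_fm F c e (t # ts) p = (let c' = lift (lift c); e' = (\<lambda>n. lift (lift (e n))) in
     Exists (Exists
       (And (value_fm F c' e' t (NVar 1))
       (And (values_fm F c' e' ts (NVar 0))
            (Eq (lift (lift p)) (pair (NVar 1) (NVar 0)))))))"

text \<open>\<open>p\<close> codes a \<open>k\<close>-tuple of elements of \<open>A\<close>.\<close>

fun power_fm :: "nat \<Rightarrow> nat \<Rightarrow> tm \<Rightarrow> fm" where
  "power_fm A 0 p = Eq p NZero"
| "power_fm A (Suc 0) p = Mem p A"
| "power_fm A (Suc (Suc k)) p =
     Exists (Exists
       (And (Mem (NVar 1) A)
       (And (power_fm A (Suc k) (NVar 0))
            (Eq (lift (lift p)) (pair (NVar 1) (NVar 0))))))"

definition relation_fm :: "nat \<Rightarrow> nat \<Rightarrow> nat \<Rightarrow> fm" where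
  "relation_fm A k R = Forall (Imp (Mem (NVar 0) R) (power_fm A k (NVar 0)))"

primrec sat_fm :: "nat \<Rightarrow> nat \<Rightarrow> tm \<Rightarrow> (nat \<Rightarrow> tm) \<Rightarrow> (nat \<Rightarrow> nat) \<Rightarrow> sfm \<Rightarrow> fm" where
  "sat_fm A F c e r (SEq s t) =
     Exists (And (value_fm F (lift c) (\<lambda>n. lift (e n)) s (NVar 0))
                 (value_fm F (lift c) (\<lambda>n. lift (e n)) t (NVar 0)))"
| "sat_fm A F c e r (SRel i ts) =
     Exists (And (values_fm F (lift c) (\<lambda>n. lift (e n)) ts (NVar 0)) (Mem (NVar 0) (r i)))"
| "sat_fm A F c e r (SNeg \<phi>) = Neg (sat_fm A F c e r \<phi>)"
| "sat_fm A F c e r (SAnd \<phi> \<psi>) = And (sat_fm A F c e r \<phi>) (sat_fm A F c e r \<psi>)"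
| "sat_fm A F c e r (SOr \<phi> \<psi>) = Or (sat_fm A F c e r \<phi>) (sat_fm A F c e r \<psi>)"
| "sat_fm A F c e r (SImp \<phi> \<psi>) = Imp (sat_fm A F c e r \<phi>) (sat_fm A F c e r \<psi>)"
| "sat_fm A F c e r (SForall \<phi>) =
     Forall (Imp (Mem (NVar 0) A) (sat_fm A F (lift c) (env_cons e) r \<phi>))"
| "sat_fm A F c e r (SExists \<phi>) =
     Exists (And (Mem (NVar 0) A) (sat_fm A F (lift c) (env_cons e) r \<phi>))"
| "sat_fm A F c e r (SForall2 k \<phi>) =
     ForallS (Imp (relation_fm (Suc A) k 0)
                  (sat_fm (Suc A) (Suc F) c e (case_nat 0 (\<lambda>i. Suc (r i))) \<phi>))"
| "sat_fm A F c e r (SExists2 k \<phi>) =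
     ExistsS (And (relation_fm (Suc A) k 0)
                  (sat_fm (Suc A) (Suc F) c e (case_nat 0 (\<lambda>i. Suc (r i))) \<phi>))"

text \<open>For a sentence the environments are irrelevant.\<close>

definition models_fm :: "nat \<Rightarrow> nat \<Rightarrow> tm \<Rightarrow> sfm \<Rightarrow> fm" where
  "models_fm A F c \<psi> = sat_fm A F c NVar (\<lambda>i. i) \<psi>"

text \<open>In \<open>with_standard_fm \<chi>\<close> the set of all numbers and the graph of the successor function
  are the set variables 1 and 0 of \<open>\<chi>\<close>.\<close>

definition with_standard_fm :: "fm \<Rightarrow> fm" where
  "with_standard_fm \<chi> = ExistsS (ExistsS (And (And (all_numbers_fm 1) (successor_fm 0)) \<chi>))"

definition standard_models_fm :: "sfm \<Rightarrow> fm" where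
  "standard_models_fm \<psi> = with_standard_fm (models_fm 1 0 NZero \<psi>)"

text \<open>Under all quantifiers the set variables \<open>H, F, A\<close> are 0, 1, 2, and the successor graph
  and the set of all numbers are 3 and 4.\<close>

definition categorical_fm :: "sfm \<Rightarrow> fm" where
  "categorical_fm \<psi> = with_standard_fm
    (ForallS (ForallS (Forall
      (Imp (And (structure_fm 1 0 (NVar 0)) (models_fm 1 0 (NVar 0) \<psi>))
           (ExistsS (iso_fm 0 4 3 NZero 2 1 (NVar 0)))))))"

end

theory Submission
  imports Defs "HOL-Library.Countable_Set" "HOL-Number_Theory.Cong"
begin

text \<open>
  The sentence says that the structure carries a discrete order with least element \<open>c\<close> and
  successor \<open>f\<close>, on whose initial segments every linear preorder has a maximum, and an unbounded
  binary tree without a branch. It holds of the numbers since \<open>WKL\<close> fails. Conversely, let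
  \<open>(A, f, c)\<close> satisfy it. Applying the maximum clause to the order that \<open>A\<close> inherits as a set of
  numbers, initial segments of \<open>A\<close> are bounded, so every element of \<open>A\<close> is some \<open>f^n c\<close>. The \<open>n\<close> for
  which \<open>f^n c\<close> exists form a cut \<open>J\<close>. If \<open>J\<close> is all of the numbers, then \<open>n \<mapsto> f^n c\<close> is the
  isomorphism. If \<open>J\<close> is a proper cut, then \<open>\<Sigma>\<^sub>1\<close> collection yields a binary sequence beyond \<open>J\<close> whose
  initial segments in \<open>J\<close> are nodes of the tree, and they form a branch, which is excluded.

  Derivability is reduced to truth in models by a Henkin completeness theorem, so the argument takes
  place inside an arbitrary, possibly nonstandard, model of the base theory.
\<close>

section \<open>Substitution\<close>

text \<open>The obstacle is the lack of Sigma-1 induction: the values f^n c may exist only for n in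
  a proper cut J, and a set enumerated along such a cut can pass every test of induction by sets.
  What tells J apart from the numbers is weak Koenig's lemma: collection gives binary trees along a
  proper cut a branch, while the numbers carry a tree without one. The sentence must bring this tree
  along, although f and c provide no addition. It therefore also supplies the graph D of x -> 2 x +
  1 through recursion equations, so that the children of a node x are D x and f (D x). Finiteness of
  initial segments is stated by maxima of linear preorders because the preorder may come from
  outside: taking the order that A inherits from the numbers ties the abstract order
  \<open>Le\<close> to actual size, which closure under f alone would not do. Order, D and tree are
  guessed, preorders and branches are tested; this is the Sigma-1-2 prefix.\<close>

abbreviation up :: "(nat \<Rightarrow> tm) \<Rightarrow> nat \<Rightarrow> tm" where
  "up \<sigma> \<equiv> case_nat (NVar 0) (\<lambda>n. lift (\<sigma> n))"

abbreviation upS :: "(nat \<Rightarrow> nat) \<Rightarrow> nat \<Rightarrow> nat" where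
  "upS \<rho> \<equiv> case_nat 0 (\<lambda>n. Suc (\<rho> n))"

lemma tsub_tsub [simp]: "tsub \<sigma> (tsub \<tau> t) = tsub (\<lambda>n. tsub \<sigma> (\<tau> n)) t"
  by (induction t) auto

lemma tsub_NVar [simp]: "tsub NVar t = t"
  by (induction t) auto

lemma up_comp: "(\<lambda>n. tsub (up \<sigma>) (up \<tau> n)) = up (\<lambda>n. tsub \<sigma> (\<tau> n))"
  by (rule ext) (auto split: nat.splits)

lemma upS_comp: "(\<lambda>n. upS \<rho> (upS \<pi> n)) = upS (\<lambda>n. \<rho> (\<pi> n))"
  by (rule ext) (auto split: nat.splits)

lemma up_NVar [simp]: "case_nat (NVar 0) (\<lambda>n. NVar (Suc n)) = NVar"
  by (rule ext) (auto split: nat.splits)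

lemma upS_id [simp]: "upS (\<lambda>X. X) = (\<lambda>X. X)"
  by (rule ext) (auto split: nat.splits)

lemma fsub_fsub:
  "fsub \<sigma> \<rho> (fsub \<tau> \<pi> \<phi>) = fsub (\<lambda>n. tsub \<sigma> (\<tau> n)) (\<lambda>X. \<rho> (\<pi> X)) \<phi>"
proof (induction \<phi> arbitrary: \<sigma> \<rho> \<tau> \<pi>)
  case (Forall \<phi>)
  show ?case using Forall[of "up \<sigma>" \<rho> "up \<tau>" \<pi>] unfolding up_comp by simp
next
  case (ForallS \<phi>)
  show ?case using ForallS[of \<sigma> "upS \<rho>" \<tau> "upS \<pi>"] unfolding upS_comp by simp
qed auto

lemma fsub_NVar [simp]: "fsub NVar (\<lambda>X. X) \<phi> = \<phi>"
  by (induction \<phi>) auto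

lemma inst_fsub_up [simp]: "inst t (fsub (up \<sigma>) \<rho> \<phi>) = fsub (case_nat t \<sigma>) \<rho> \<phi>"
  unfolding inst_def fsub_fsub
  by (rule arg_cong[where f = "\<lambda>\<sigma>. fsub \<sigma> \<rho> \<phi>"], rule ext) (auto split: nat.splits)

lemma instS_fsub_upS [simp]: "instS Y (fsub \<sigma> (upS \<rho>) \<phi>) = fsub \<sigma> (case_nat Y \<rho>) \<phi>"
  unfolding instS_def fsub_fsub
  by (simp, rule arg_cong[where f = "\<lambda>\<rho>. fsub \<sigma> \<rho> \<phi>"], rule ext) (auto split: nat.splits)

lemma fsub_inst: "fsub \<sigma> \<rho> (inst t \<phi>) = inst (tsub \<sigma> t) (fsub (up \<sigma>) \<rho> \<phi>)"
  unfolding inst_fsub_up unfolding inst_def fsub_fsub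
  by (rule arg_cong[where f = "\<lambda>\<sigma>. fsub \<sigma> \<rho> \<phi>"], rule ext) (auto split: nat.splits)

lemma fsub_instS: "fsub \<sigma> \<rho> (instS Y \<phi>) = instS (\<rho> Y) (fsub \<sigma> (upS \<rho>) \<phi>)"
  unfolding instS_fsub_upS unfolding instS_def fsub_fsub
  by (simp, rule arg_cong[where f = "\<lambda>\<rho>. fsub \<sigma> \<rho> \<phi>"], rule ext) (auto split: nat.splits)

lemma fsub_liftF: "fsub (up \<sigma>) \<rho> (liftF \<phi>) = liftF (fsub \<sigma> \<rho> \<phi>)"
  unfolding liftF_def fsub_fsub by simp

lemma fsub_liftFS: "fsub \<sigma> (upS \<rho>) (liftFS \<phi>) = liftFS (fsub \<sigma> \<rho> \<phi>)"
  unfolding liftFS_def fsub_fsub by simp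

text \<open>A semantic way to say that all free variables are below \<open>n\<close>; it spares a
  function collecting the free variables.\<close>

definition tsupports :: "nat \<Rightarrow> tm \<Rightarrow> bool" where
  "tsupports n t \<longleftrightarrow> (\<forall>\<sigma> \<sigma>'. (\<forall>i<n. \<sigma> i = \<sigma>' i) \<longrightarrow> tsub \<sigma> t = tsub \<sigma>' t)"

lemma tsupports_mono: "tsupports m t \<Longrightarrow> m \<le> n \<Longrightarrow> tsupports n t"
  unfolding tsupports_def by (meson less_le_trans)

lemma ex_tsupports: "\<exists>n. tsupports n t"
proof (induction t)
  case (Plus s t)
  then obtain m n where "tsupports m s" "tsupports n t" by blast
  then have "tsupports (max m n) s" "tsupports (max m n) t" by (auto elim: tsupports_mono)
  then have "tsupports (max m n) (Plus s t)" unfolding tsupports_def tsub.simps by metis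
  then show ?case by blast
next
  case (Times s t)
  then obtain m n where "tsupports m s" "tsupports n t" by blast
  then have "tsupports (max m n) s" "tsupports (max m n) t" by (auto elim: tsupports_mono)
  then have "tsupports (max m n) (Times s t)" unfolding tsupports_def tsub.simps by metis
  then show ?case by blast
qed (auto simp: tsupports_def)

lemma ex_tsupports2: "\<exists>n. tsupports n s \<and> tsupports n t"
  using ex_tsupports tsupports_mono by (meson nle_le)

text \<open>One bound serves both sorts of variables. It need not be sharp: it is only used to find
  fresh indices and to ignore substitutions beyond it.\<close>

definition supports :: "nat \<Rightarrow> fm \<Rightarrow> bool" where
  "supports n \<phi> \<longleftrightarrow> (\<forall>\<sigma> \<sigma>' \<rho> \<rho>'. (\<forall>i<n. \<sigma> i = \<sigma>' i) \<longrightarrow> (\<forall>i<n. \<rho> i = \<rho>' i) \<longrightarrow>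
     fsub \<sigma> \<rho> \<phi> = fsub \<sigma>' \<rho>' \<phi>)"

lemma supportsD:
  "supports n \<phi> \<Longrightarrow> (\<And>i. i < n \<Longrightarrow> \<sigma> i = \<sigma>' i) \<Longrightarrow> (\<And>i. i < n \<Longrightarrow> \<rho> i = \<rho>' i) \<Longrightarrow>
     fsub \<sigma> \<rho> \<phi> = fsub \<sigma>' \<rho>' \<phi>"
  unfolding supports_def by blast

lemma supports_mono: "supports m \<phi> \<Longrightarrow> m \<le> n \<Longrightarrow> supports n \<phi>"
  unfolding supports_def by (meson less_le_trans)

lemma ex_supports: "\<exists>n. supports n \<phi>"
proof (induction \<phi>)
  case (Eq s t)
  obtain n where "tsupports n s" "tsupports n t" using ex_tsupports2 by blast
  then have "supports n (Eq s t)" unfolding supports_def tsupports_def fsub.simps by metis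
  then show ?case by blast
next
  case (Less s t)
  obtain n where "tsupports n s" "tsupports n t" using ex_tsupports2 by blast
  then have "supports n (Less s t)" unfolding supports_def tsupports_def fsub.simps by metis
  then show ?case by blast
next
  case (Mem t X)
  obtain m where "tsupports m t" using ex_tsupports by blast
  then have "tsupports (max m (Suc X)) t" by (rule tsupports_mono) simp
  then have "supports (max m (Suc X)) (Mem t X)"
    unfolding supports_def tsupports_def fsub.simps by (metis lessI less_max_iff_disj)
  then show ?case by blast
next
  case (Imp \<phi> \<psi>)
  then obtain m n where "supports m \<phi>" "supports n \<psi>" by blast
  then have "supports (max m n) \<phi>" "supports (max m n) \<psi>"
    by (auto elim: supports_mono)
  then have "supports (max m n) (Imp \<phi> \<psi>)" unfolding supports_def fsub.simps by metis
  then show ?case by blast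
next
  case (Forall \<phi>)
  then obtain n where n: "supports n \<phi>" by blast
  have "supports n (Forall \<phi>)" unfolding supports_def
    by (auto intro!: supportsD[OF n] split: nat.splits)
  then show ?case by blast
next
  case (ForallS \<phi>)
  then obtain n where n: "supports n \<phi>" by blast
  have "supports n (ForallS \<phi>)" unfolding supports_def
    by (auto intro!: supportsD[OF n] split: nat.splits)
  then show ?case by blast
qed (auto simp: supports_def)

lemma ex_supports_list: "\<exists>n. \<forall>\<phi>\<in>set \<Gamma>. supports n \<phi>"
proof (induction \<Gamma>)
  case (Cons \<phi> \<Gamma>)
  then obtain m n where "supports m \<phi>" "\<forall>\<phi>\<in>set \<Gamma>. supports n \<phi>" using ex_supports by blast
  then have "\<forall>\<psi>\<in>set (\<phi> # \<Gamma>). supports (max m n) \<psi>"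
    by (auto intro: supports_mono max.cobounded1 max.cobounded2)
  then show ?case by blast
qed simp


section \<open>Derivations and substitution\<close>

lemma weakening: "derives T \<Gamma> \<phi> \<Longrightarrow> set \<Gamma> \<subseteq> set \<Delta> \<Longrightarrow> derives T \<Delta> \<phi>"
proof (induction arbitrary: \<Delta> rule: derives.induct)
  case (Hyp \<phi> \<Gamma>) then show ?case by (auto intro: derives.Hyp)
next
  case (ImpI \<phi> \<Gamma> \<psi>)
  then have "derives T (\<phi> # \<Delta>) \<psi>" by (intro ImpI.IH) auto
  then show ?case by (rule derives.ImpI)
next
  case (Contr \<phi> \<Gamma>)
  then have "derives T (Neg \<phi> # \<Delta>) Falsum" by (intro Contr.IH) auto
  then show ?case by (rule derives.Contr)
next
  case (AllI \<Gamma> \<phi>)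
  then have "derives T (map liftF \<Delta>) \<phi>" by (intro AllI.IH) auto
  then show ?case by (rule derives.AllI)
next
  case (AllSI \<Gamma> \<phi>)
  then have "derives T (map liftFS \<Delta>) \<phi>" by (intro AllSI.IH) auto
  then show ?case by (rule derives.AllSI)
qed (blast intro: derives.intros)+

text \<open>Describes the instantiation of the outermost of \<open>m + 1\<close> stacked quantifiers
  as seen from the matrix: index \<open>m\<close> receives the term, shifted past the
  \<open>m\<close> remaining binders, and larger indices drop by one.\<close>

lemma funpow_up_inst:
  "((up ^^ m) (case_nat t NVar)) i =
    (if i < m then NVar i else if i = m then (lift ^^ m) t else NVar (i - 1))"
  by (induction m arbitrary: i) (auto split: nat.splits)

lemma tsub_up_lift: "tsub (up \<sigma>) (lift t) = lift (tsub \<sigma> t)"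
  by simp

lemma tsub_funpow_up_lift:
  "tsub ((up ^^ m) (case_nat t NVar)) ((lift ^^ Suc m) u) = (lift ^^ m) u"
proof (induction m)
  case (Suc m)
  have "tsub ((up ^^ Suc m) (case_nat t NVar)) ((lift ^^ Suc (Suc m)) u) =
     tsub (up ((up ^^ m) (case_nat t NVar))) (lift ((lift ^^ Suc m) u))"
    by simp
  also have "\<dots> = lift ((lift ^^ m) u)" unfolding tsub_up_lift Suc ..
  finally show ?case by simp
qed simp

lemma fsub_funpow_Forall:
  "fsub \<sigma> \<rho> ((Forall ^^ m) \<phi>) = (Forall ^^ m) (fsub ((up ^^ m) \<sigma>) \<rho> \<phi>)"
  by (induction m arbitrary: \<sigma>) (simp_all add: funpow_swap1[of up])

lemma fsub_funpow_ForallS: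
  "fsub \<sigma> \<rho> ((ForallS ^^ m) \<phi>) = (ForallS ^^ m) (fsub \<sigma> ((upS ^^ m) \<rho>) \<phi>)"
  by (induction m arbitrary: \<rho>) (simp_all add: funpow_swap1[of upS])

lemma funpow_upS_inst:
  "((upS ^^ m) (case_nat Y (\<lambda>X. X))) i = (if i < m then i else if i = m then Y + m else i - 1)"
  by (induction m arbitrary: i) (auto split: nat.splits)

lemma derives_funpow_Forall: "derives T [] \<phi> \<Longrightarrow> derives T [] ((Forall ^^ m) \<phi>)"
  by (induction m) (auto intro: derives.AllI)

lemma derives_funpow_ForallS: "derives T [] \<phi> \<Longrightarrow> derives T [] ((ForallS ^^ m) \<phi>)"
  by (induction m) (auto intro: derives.AllSI)

text \<open>The free variables are generalized all at once and then instantiated one by one, from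
  the outermost quantifier inwards.\<close>

lemma derives_fsub:
  assumes "derives T [] \<phi>"
  shows "derives T [] (fsub \<sigma> \<rho> \<phi>)"
proof -
  have num: "derives T [] (fsub \<sigma> (\<lambda>X. X) \<phi>)" if \<phi>: "derives T [] \<phi>" for \<phi>
  proof -
    obtain n where n: "supports n \<phi>" using ex_supports by blast
    \<comment> \<open>Below \<open>m\<close> a variable is still bound by one of the
      \<open>m\<close> quantifiers left; from \<open>m\<close> on it already carries its final
      value, shifted past them. At \<open>n\<close> this is the identity on the support, at 0 it is
      \<open>\<sigma>\<close>.\<close>
    define \<tau> where "\<tau> m i = (if i < m then NVar i else (lift ^^ m) (\<sigma> i))" for m i
    have "derives T [] ((Forall ^^ 0) (fsub (\<tau> 0) (\<lambda>X. X) \<phi>))"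
    proof (rule inc_induct[of 0 n])
      have "fsub (\<tau> n) (\<lambda>X. X) \<phi> = fsub NVar (\<lambda>X. X) \<phi>"
        by (rule supportsD[OF n]) (auto simp: \<tau>_def)
      then show "derives T [] ((Forall ^^ n) (fsub (\<tau> n) (\<lambda>X. X) \<phi>))"
        using \<phi> by (simp add: derives_funpow_Forall)
    next
      fix m
      assume "derives T [] ((Forall ^^ Suc m) (fsub (\<tau> (Suc m)) (\<lambda>X. X) \<phi>))"
      then have "derives T [] (inst (\<sigma> m) ((Forall ^^ m) (fsub (\<tau> (Suc m)) (\<lambda>X. X) \<phi>)))"
        by (auto intro: derives.AllE)
      moreover have "tsub ((up ^^ m) (case_nat (\<sigma> m) NVar)) (\<tau> (Suc m) i) = \<tau> m i" for i
        using tsub_funpow_up_lift[of m "\<sigma> m" "\<sigma> i"]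
        by (auto simp: \<tau>_def funpow_up_inst less_Suc_eq simp del: funpow.simps)
      ultimately show "derives T [] ((Forall ^^ m) (fsub (\<tau> m) (\<lambda>X. X) \<phi>))"
        unfolding inst_def fsub_funpow_Forall fsub_fsub by simp
    qed simp
    moreover have "\<tau> 0 = \<sigma>" by (auto simp: \<tau>_def)
    ultimately show ?thesis by simp
  qed
  have set: "derives T [] (fsub NVar \<rho> \<phi>)" if \<phi>: "derives T [] \<phi>" for \<phi>
  proof -
    obtain n where n: "supports n \<phi>" using ex_supports by blast
    define \<tau> where "\<tau> m i = (if i < m then i else \<rho> i + m)" for m i
    have "derives T [] ((ForallS ^^ 0) (fsub NVar (\<tau> 0) \<phi>))"
    proof (rule inc_induct[of 0 n])
      have "fsub NVar (\<tau> n) \<phi> = fsub NVar (\<lambda>X. X) \<phi>"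
        by (rule supportsD[OF n]) (auto simp: \<tau>_def)
      then show "derives T [] ((ForallS ^^ n) (fsub NVar (\<tau> n) \<phi>))"
        using \<phi> by (simp add: derives_funpow_ForallS)
    next
      fix m
      assume "derives T [] ((ForallS ^^ Suc m) (fsub NVar (\<tau> (Suc m)) \<phi>))"
      then have "derives T [] (instS (\<rho> m) ((ForallS ^^ m) (fsub NVar (\<tau> (Suc m)) \<phi>)))"
        by (auto intro: derives.AllSE)
      moreover have "((upS ^^ m) (case_nat (\<rho> m) (\<lambda>X. X))) (\<tau> (Suc m) i) = \<tau> m i" for i
        by (auto simp: \<tau>_def funpow_upS_inst less_Suc_eq)
      ultimately show "derives T [] ((ForallS ^^ m) (fsub NVar (\<tau> m) \<phi>))"
        unfolding instS_def fsub_funpow_ForallS fsub_fsub by simp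
    qed simp
    moreover have "\<tau> 0 = \<rho>" by (auto simp: \<tau>_def)
    ultimately show ?thesis by simp
  qed
  show ?thesis using num[OF set[OF assms]] by (simp add: fsub_fsub)
qed

text \<open>Only the axiom rule is not structural: \<open>T\<close> need not be closed under
  substitution, so that case falls back on generalizing and instantiating in the empty
  context.\<close>

lemma derives_fsub_context:
  "derives T \<Gamma> \<phi> \<Longrightarrow> derives T (map (fsub \<sigma> \<rho>) \<Gamma>) (fsub \<sigma> \<rho> \<phi>)"
proof (induction arbitrary: \<sigma> \<rho> rule: derives.induct)
  case (Axm \<phi> \<Gamma>)
  then have "derives T [] (fsub \<sigma> \<rho> \<phi>)" by (intro derives_fsub derives.Axm)
  then show ?case by (auto intro: weakening)
next
  case (AllI \<Gamma> \<phi>)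
  have "derives T (map liftF (map (fsub \<sigma> \<rho>) \<Gamma>)) (fsub (up \<sigma>) \<rho> \<phi>)"
    using AllI.IH[of "up \<sigma>" \<rho>] by (simp add: comp_def fsub_liftF)
  then show ?case by (auto intro: derives.AllI)
next
  case (AllSI \<Gamma> \<phi>)
  have "derives T (map liftFS (map (fsub \<sigma> \<rho>) \<Gamma>)) (fsub \<sigma> (upS \<rho>) \<phi>)"
    using AllSI.IH[of \<sigma> "upS \<rho>"] by (simp add: comp_def fsub_liftFS)
  then show ?case by (auto intro: derives.AllSI)
next
  case (AllE \<Gamma> \<phi> t)
  have "derives T (map (fsub \<sigma> \<rho>) \<Gamma>) (Forall (fsub (up \<sigma>) \<rho> \<phi>))"
    using AllE.IH[of \<sigma> \<rho>] by simp
  then show ?case unfolding fsub_inst by (rule derives.AllE)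
next
  case (AllSE \<Gamma> \<phi> Y)
  have "derives T (map (fsub \<sigma> \<rho>) \<Gamma>) (ForallS (fsub \<sigma> (upS \<rho>) \<phi>))"
    using AllSE.IH[of \<sigma> \<rho>] by simp
  then show ?case unfolding fsub_instS by (rule derives.AllSE)
next
  case (EqSubst \<Gamma> s t \<phi>)
  show ?case using EqSubst.IH(1)[of \<sigma> \<rho>] EqSubst.IH(2)[of \<sigma> \<rho>]
    unfolding fsub_inst fsub.simps by (rule derives.EqSubst)
next
  case (ImpE \<Gamma> \<phi> \<psi>)
  show ?case using ImpE.IH(1)[of \<sigma> \<rho>] ImpE.IH(2)[of \<sigma> \<rho>] by (auto intro: derives.ImpE)
next
  case (Contr \<phi> \<Gamma>)
  show ?case using Contr.IH[of \<sigma> \<rho>] by (auto intro: derives.Contr)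
next
  case (ImpI \<phi> \<Gamma> \<psi>)
  show ?case using ImpI.IH[of \<sigma> \<rho>] by (auto intro: derives.ImpI)
qed (auto intro: derives.intros)

text \<open>The renaming that sends \<open>k\<close> to 0 and shifts all other variables up turns
  the named fresh variable into the eigenvariable expected by the introduction rule.\<close>

lemma derives_Forall_fresh:
  assumes "derives T \<Gamma> (inst (NVar k) \<phi>)" "\<forall>\<gamma>\<in>set \<Gamma>. supports k \<gamma>" "supports (Suc k) \<phi>"
  shows "derives T \<Gamma> (Forall \<phi>)"
proof -
  define \<sigma> where "\<sigma> i = (if i = k then NVar 0 else NVar (Suc i))" for i
  have "fsub \<sigma> (\<lambda>X. X) \<gamma> = liftF \<gamma>" if "\<gamma> \<in> set \<Gamma>" for \<gamma>
    unfolding liftF_def using assms(2) that by (intro supportsD) (auto simp: \<sigma>_def)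
  then have \<Gamma>: "map (fsub \<sigma> (\<lambda>X. X)) \<Gamma> = map liftF \<Gamma>" by simp
  have "fsub \<sigma> (\<lambda>X. X) (inst (NVar k) \<phi>) = fsub NVar (\<lambda>X. X) \<phi>"
    unfolding inst_def fsub_fsub by (rule supportsD[OF assms(3)]) (auto simp: \<sigma>_def split: nat.splits)
  then show ?thesis
    using derives_fsub_context[OF assms(1), of \<sigma> "\<lambda>X. X"] unfolding \<Gamma> by (auto intro: derives.AllI)
qed

lemma derives_ForallS_fresh:
  assumes "derives T \<Gamma> (instS k \<phi>)" "\<forall>\<gamma>\<in>set \<Gamma>. supports k \<gamma>" "supports (Suc k) \<phi>"
  shows "derives T \<Gamma> (ForallS \<phi>)"
proof -
  define \<rho> where "\<rho> i = (if i = k then 0 else Suc i)" for i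
  have "fsub NVar \<rho> \<gamma> = liftFS \<gamma>" if "\<gamma> \<in> set \<Gamma>" for \<gamma>
    unfolding liftFS_def using assms(2) that by (intro supportsD) (auto simp: \<rho>_def)
  then have \<Gamma>: "map (fsub NVar \<rho>) \<Gamma> = map liftFS \<Gamma>" by simp
  have "fsub NVar \<rho> (instS k \<phi>) = fsub NVar (\<lambda>X. X) \<phi>"
    unfolding instS_def fsub_fsub by (rule supportsD[OF assms(3)]) (auto simp: \<rho>_def split: nat.splits)
  then show ?thesis
    using derives_fsub_context[OF assms(1), of NVar \<rho>] unfolding \<Gamma> by (auto intro: derives.AllSI)
qed

section \<open>Henkin models and completeness\<close>

text \<open>Sets carry no equality in the language, so the second sort can be taken to consist of
  genuine sets of numbers.\<close>

record 'a arith =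
  zer :: 'a
  uni :: 'a
  add :: "'a \<Rightarrow> 'a \<Rightarrow> 'a"
  mul :: "'a \<Rightarrow> 'a \<Rightarrow> 'a"
  lt :: "'a \<Rightarrow> 'a \<Rightarrow> bool"
  Sets :: "'a set set"

primrec teval :: "'a arith \<Rightarrow> (nat \<Rightarrow> 'a) \<Rightarrow> tm \<Rightarrow> 'a" where
  "teval M e (NVar n) = e n"
| "teval M e NZero = zer M"
| "teval M e NOne = uni M"
| "teval M e (Plus s t) = add M (teval M e s) (teval M e t)"
| "teval M e (Times s t) = mul M (teval M e s) (teval M e t)"

primrec feval :: "'a arith \<Rightarrow> (nat \<Rightarrow> 'a) \<Rightarrow> (nat \<Rightarrow> 'a set) \<Rightarrow> fm \<Rightarrow> bool" where
  "feval M e S (Eq s t) \<longleftrightarrow> teval M e s = teval M e t"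
| "feval M e S (Less s t) \<longleftrightarrow> lt M (teval M e s) (teval M e t)"
| "feval M e S (Mem t X) \<longleftrightarrow> teval M e t \<in> S X"
| "feval M e S Falsum \<longleftrightarrow> False"
| "feval M e S (Imp \<phi> \<psi>) \<longleftrightarrow> (feval M e S \<phi> \<longrightarrow> feval M e S \<psi>)"
| "feval M e S (Forall \<phi>) \<longleftrightarrow> (\<forall>x. feval M (case_nat x e) S \<phi>)"
| "feval M e S (ForallS \<phi>) \<longleftrightarrow> (\<forall>Y\<in>Sets M. feval M e (case_nat Y S) \<phi>)"

definition valid_in :: "'a arith \<Rightarrow> fm \<Rightarrow> bool" where
  "valid_in M \<phi> \<longleftrightarrow> (\<forall>e S. (\<forall>n. S n \<in> Sets M) \<longrightarrow> feval M e S \<phi>)"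

instance tm :: countable by countable_datatype
instance fm :: countable by countable_datatype

lemma derives_cut:
  assumes "derives T \<Gamma> \<phi>" "derives T (\<phi> # \<Gamma>) \<psi>"
  shows "derives T \<Gamma> \<psi>"
  using derives.ImpE[OF derives.ImpI[OF assms(2)] assms(1)] .

lemma derives_Hyp1: "derives T (\<phi> # \<Gamma>) \<phi>"
  by (rule derives.Hyp) simp

lemma derives_Hyp2: "derives T (\<psi> # \<phi> # \<Gamma>) \<phi>"
  by (rule derives.Hyp) simp

lemma derives_ex_falso: "derives T \<Gamma> Falsum \<Longrightarrow> derives T \<Gamma> \<phi>"
  by (rule derives.Contr, erule weakening) auto

abbreviation consistent :: "fm set \<Rightarrow> fm list \<Rightarrow> bool" where
  "consistent T \<Gamma> \<equiv> \<not> derives T \<Gamma> Falsum"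

text \<open>A negative decision about a universal formula also records a counterexample, so a set
  deciding every formula is at once complete and Henkin. Variables serve as witnesses: a finite list
  leaves fresh ones, and the language needs no new constants.\<close>

definition decides :: "fm list \<Rightarrow> fm \<Rightarrow> bool" where
  "decides \<Gamma> \<phi> \<longleftrightarrow> \<phi> \<in> set \<Gamma> \<or> Neg \<phi> \<in> set \<Gamma> \<and>
     (\<forall>\<chi>. \<phi> = Forall \<chi> \<longrightarrow> (\<exists>t. Neg (inst t \<chi>) \<in> set \<Gamma>)) \<and>
     (\<forall>\<chi>. \<phi> = ForallS \<chi> \<longrightarrow> (\<exists>Y. Neg (instS Y \<chi>) \<in> set \<Gamma>))"

lemma consistent_extension:
  assumes "consistent T \<Gamma>"
  shows "\<exists>\<Delta>. consistent T \<Delta> \<and> set \<Gamma> \<subseteq> set \<Delta> \<and> decides \<Delta> \<phi>"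
proof (cases "consistent T (\<phi> # \<Gamma>)")
  case True
  then show ?thesis by (intro exI[of _ "\<phi> # \<Gamma>"]) (auto simp: decides_def)
next
  case False
  let ?\<Gamma> = "Neg \<phi> # \<Gamma>"
  from False have neg: "derives T \<Gamma> (Neg \<phi>)" by (auto intro: derives.ImpI)
  have con: "consistent T ?\<Gamma>" using assms derives_cut[OF neg] by blast
  \<comment> \<open>Since \<open>\<phi>\<close> is already refuted, the negation of anything that
    would imply \<open>\<phi>\<close> can be added; this is applied to a fresh instance of a
    universal \<open>\<phi>\<close>.\<close>
  have wit: "consistent T (Neg \<psi> # ?\<Gamma>)" if "derives T ?\<Gamma> \<psi> \<Longrightarrow> derives T ?\<Gamma> \<phi>" for \<psi>
  proof
    assume "derives T (Neg \<psi> # ?\<Gamma>) Falsum"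
    then have "derives T ?\<Gamma> \<phi>" by (rule that[OF derives.Contr])
    moreover have "derives T ?\<Gamma> (Neg \<phi>)" by (rule derives.Hyp) simp
    ultimately show False using con derives.ImpE by blast
  qed
  show ?thesis
  proof (cases \<phi>)
    case (Forall \<chi>)
    obtain k where k: "\<forall>\<gamma>\<in>set (\<chi> # ?\<Gamma>). supports k \<gamma>" using ex_supports_list by blast
    have "supports (Suc k) \<chi>" using k by (auto intro: supports_mono)
    then have "consistent T (Neg (inst (NVar k) \<chi>) # ?\<Gamma>)"
      using k by (intro wit) (auto simp: Forall intro!: derives_Forall_fresh)
    then show ?thesis by (intro exI[of _ "Neg (inst (NVar k) \<chi>) # ?\<Gamma>"]) (auto simp: decides_def Forall)
  next
    case (ForallS \<chi>)
    obtain k where k: "\<forall>\<gamma>\<in>set (\<chi> # ?\<Gamma>). supports k \<gamma>" using ex_supports_list by blast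
    have "supports (Suc k) \<chi>" using k by (auto intro: supports_mono)
    then have "consistent T (Neg (instS k \<chi>) # ?\<Gamma>)"
      using k by (intro wit) (auto simp: ForallS intro!: derives_ForallS_fresh)
    then show ?thesis by (intro exI[of _ "Neg (instS k \<chi>) # ?\<Gamma>"]) (auto simp: decides_def ForallS)
  qed (use con in \<open>intro exI[of _ ?\<Gamma>], auto simp: decides_def\<close>)+
qed

locale henkin =
  fixes T :: "fm set" and H :: "fm set"
  assumes finitely_consistent: "set \<Gamma> \<subseteq> H \<Longrightarrow> consistent T \<Gamma>"
    and decided: "\<exists>\<Gamma>. set \<Gamma> \<subseteq> H \<and> decides \<Gamma> \<phi>"
begin

lemma closed:
  assumes "derives T \<Gamma> \<phi>" "set \<Gamma> \<subseteq> H"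
  shows "\<phi> \<in> H"
proof (rule ccontr)
  assume "\<phi> \<notin> H"
  then have "Neg \<phi> \<in> H" using decided[of \<phi>] by (auto simp: decides_def)
  then have "consistent T (Neg \<phi> # \<Gamma>)" using assms by (intro finitely_consistent) auto
  moreover have "derives T (Neg \<phi> # \<Gamma>) \<phi>" using assms(1) by (rule weakening) auto
  ultimately show False by (meson derives.Hyp derives.ImpE list.set_intros(1))
qed

lemma Falsum_notin: "Falsum \<notin> H"
  using finitely_consistent[of "[Falsum]"] derives_Hyp1[of T Falsum "[]"] by auto

lemma Imp_iff: "Imp \<phi> \<psi> \<in> H \<longleftrightarrow> (\<phi> \<in> H \<longrightarrow> \<psi> \<in> H)"
proof
  assume "Imp \<phi> \<psi> \<in> H"
  then show "\<phi> \<in> H \<longrightarrow> \<psi> \<in> H"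
    using closed[OF derives.ImpE[OF derives_Hyp1 derives_Hyp2], of \<phi> \<psi> "[]"] by auto
next
  assume *: "\<phi> \<in> H \<longrightarrow> \<psi> \<in> H"
  show "Imp \<phi> \<psi> \<in> H"
  proof (cases "\<phi> \<in> H")
    case True
    have "derives T [\<psi>] (Imp \<phi> \<psi>)" by (intro derives.ImpI derives_Hyp2)
    then show ?thesis by (rule closed) (use * True in simp)
  next
    case False
    then have neg: "Neg \<phi> \<in> H" using decided[of \<phi>] by (auto simp: decides_def)
    have "derives T [\<phi>, Neg \<phi>] Falsum"
      by (rule derives.ImpE[OF derives_Hyp2 derives_Hyp1])
    then have imp: "derives T [Neg \<phi>] (Imp \<phi> \<psi>)"
      by (rule derives.ImpI[OF derives_ex_falso])
    from closed[OF imp] neg show ?thesis by simp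
  qed
qed

lemma Forall_iff: "Forall \<phi> \<in> H \<longleftrightarrow> (\<forall>t. inst t \<phi> \<in> H)"
proof
  assume "Forall \<phi> \<in> H"
  then show "\<forall>t. inst t \<phi> \<in> H"
    using closed[OF derives.AllE[OF derives_Hyp1], of \<phi> "[]"] by simp
next
  assume "\<forall>t. inst t \<phi> \<in> H"
  moreover have "\<not> (Neg \<psi> \<in> H \<and> \<psi> \<in> H)" for \<psi> using Imp_iff Falsum_notin by blast
  ultimately show "Forall \<phi> \<in> H"
    using decided[of "Forall \<phi>"] unfolding decides_def by blast
qed

lemma ForallS_iff: "ForallS \<phi> \<in> H \<longleftrightarrow> (\<forall>Y. instS Y \<phi> \<in> H)"
proof
  assume "ForallS \<phi> \<in> H"
  then show "\<forall>Y. instS Y \<phi> \<in> H"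
    using closed[OF derives.AllSE[OF derives_Hyp1], of \<phi> "[]"] by simp
next
  assume "\<forall>Y. instS Y \<phi> \<in> H"
  moreover have "\<not> (Neg \<psi> \<in> H \<and> \<psi> \<in> H)" for \<psi> using Imp_iff Falsum_notin by blast
  ultimately show "ForallS \<phi> \<in> H"
    using decided[of "ForallS \<phi>"] unfolding decides_def by blast
qed

lemma Eq_subst: "Eq s t \<in> H \<Longrightarrow> inst s \<phi> \<in> H \<Longrightarrow> inst t \<phi> \<in> H"
  using closed[OF derives.EqSubst[OF derives_Hyp1 derives_Hyp2], of s t \<phi> "[]"] by simp

lemma Eq_refl: "Eq t t \<in> H"
  using closed[of "[]"] by (auto intro: derives.EqRefl)

lemma Eq_sym: "Eq s t \<in> H \<Longrightarrow> Eq t s \<in> H"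
  using Eq_subst[of s t "Eq (NVar 0) (lift s)"] Eq_refl by (simp add: inst_def)

lemma Eq_trans: "Eq s t \<in> H \<Longrightarrow> Eq t u \<in> H \<Longrightarrow> Eq s u \<in> H"
  using Eq_subst[of t u "Eq (lift s) (NVar 0)"] by (simp add: inst_def)

lemma Eq_Plus:
  assumes "Eq s s' \<in> H" "Eq t t' \<in> H" shows "Eq (Plus s t) (Plus s' t') \<in> H"
  using Eq_subst[OF assms(1), of "Eq (lift (Plus s t)) (Plus (NVar 0) (lift t))"]
    Eq_subst[OF assms(2), of "Eq (lift (Plus s t)) (Plus (lift s') (NVar 0))"] Eq_refl
  by (simp add: inst_def)

lemma Eq_Times:
  assumes "Eq s s' \<in> H" "Eq t t' \<in> H" shows "Eq (Times s t) (Times s' t') \<in> H"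
  using Eq_subst[OF assms(1), of "Eq (lift (Times s t)) (Times (NVar 0) (lift t))"]
    Eq_subst[OF assms(2), of "Eq (lift (Times s t)) (Times (lift s') (NVar 0))"] Eq_refl
  by (simp add: inst_def)

lemma Less_cong:
  assumes "Eq s s' \<in> H" "Eq t t' \<in> H" "Less s t \<in> H" shows "Less s' t' \<in> H"
  using Eq_subst[OF assms(1), of "Less (NVar 0) (lift t)"]
    Eq_subst[OF assms(2), of "Less (lift s') (NVar 0)"] assms(3)
  by (simp add: inst_def)

lemma Mem_cong: "Eq s t \<in> H \<Longrightarrow> Mem s Y \<in> H \<Longrightarrow> Mem t Y \<in> H"
  using Eq_subst[of s t "Mem (NVar 0) Y"] by (simp add: inst_def)

text \<open>The carrier stays abstract: any surjection from terms whose fibres are the classes of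
  equality in \<open>H\<close> yields a model. A surjection onto the natural numbers is plugged in
  later.\<close>

context
  fixes g :: "tm \<Rightarrow> 'a"
  assumes g_eq: "g s = g t \<longleftrightarrow> Eq s t \<in> H" and g_surj: "\<exists>t. g t = x"
begin

definition rep :: "'a \<Rightarrow> tm" where "rep x = (SOME t. g t = x)"

lemma g_rep [simp]: "g (rep x) = x"
  unfolding rep_def using g_surj by (rule someI_ex)

lemma Eq_rep: "Eq (rep (g t)) t \<in> H" "Eq t (rep (g t)) \<in> H"
  using g_eq[of "rep (g t)" t] g_eq[of t "rep (g t)"] by simp_all

definition Ext :: "nat \<Rightarrow> 'a set" where "Ext Y = {g t | t. Mem t Y \<in> H}"

definition M :: "'a arith" where
  "M = \<lparr>zer = g NZero, uni = g NOne, add = (\<lambda>x y. g (Plus (rep x) (rep y))),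
        mul = (\<lambda>x y. g (Times (rep x) (rep y))), lt = (\<lambda>x y. Less (rep x) (rep y) \<in> H),
        Sets = range Ext\<rparr>"

lemma teval_M: "teval M (\<lambda>n. g (\<sigma> n)) t = g (tsub \<sigma> t)"
  by (induction t) (auto simp: M_def g_eq intro!: Eq_Plus Eq_Times Eq_rep)

text \<open>The truth lemma, generalized to arbitrary substitutions: every element is some
  \<open>g t\<close> and every set some \<open>Ext Y\<close>, so extending an assignment is
  extending a substitution, and the quantifier cases follow from the witnesses in
  \<open>H\<close>.\<close>

lemma feval_M: "feval M (\<lambda>n. g (\<sigma> n)) (\<lambda>X. Ext (\<rho> X)) \<phi> \<longleftrightarrow> fsub \<sigma> \<rho> \<phi> \<in> H"
proof (induction \<phi> arbitrary: \<sigma> \<rho>)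
  case (Eq s t)
  show ?case by (simp add: teval_M g_eq)
next
  case (Less s t)
  have "Less (rep (g u)) (rep (g v)) \<in> H \<longleftrightarrow> Less u v \<in> H" for u v
    using Less_cong Eq_rep by blast
  then show ?case by (simp add: teval_M) (simp add: M_def)
next
  case (Mem t Y)
  have "(\<exists>u. Eq t' u \<in> H \<and> Mem u Z \<in> H) \<longleftrightarrow> Mem t' Z \<in> H" for t' Z
    using Mem_cong Eq_sym Eq_refl by blast
  then show ?case by (simp add: teval_M Ext_def g_eq)
next
  case (Forall \<phi>)
  have "case_nat (g t) (\<lambda>n. g (\<sigma> n)) = (\<lambda>n. g (case_nat t \<sigma> n))" for t
    by (rule ext) (auto split: nat.splits)
  moreover have "(\<forall>x. P x) \<longleftrightarrow> (\<forall>t. P (g t))" for P :: "'a \<Rightarrow> bool" using g_surj by metis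
  ultimately show ?case using Forall by (simp add: Forall_iff)
next
  case (ForallS \<phi>)
  have "case_nat (Ext Y) (\<lambda>n. Ext (\<rho> n)) = (\<lambda>n. Ext (case_nat Y \<rho> n))" for Y
    by (rule ext) (auto split: nat.splits)
  moreover have "Sets M = range Ext" by (simp add: M_def)
  ultimately show ?case using ForallS by (simp add: ForallS_iff)
qed (simp_all add: Falsum_notin Imp_iff)

lemma valid_in_M:
  assumes "\<phi> \<in> T"
  shows "valid_in M \<phi>"
  unfolding valid_in_def
proof (intro allI impI)
  fix e and S :: "nat \<Rightarrow> 'a set" assume "\<forall>n. S n \<in> Sets M"
  then have "\<forall>n. \<exists>Y. S n = Ext Y" by (auto simp: M_def)
  then obtain \<rho> where S: "\<And>n. S n = Ext (\<rho> n)" by metis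
  have "derives T [] (fsub (\<lambda>n. rep (e n)) \<rho> \<phi>)" using assms by (intro derives_fsub derives.Axm)
  then have "fsub (\<lambda>n. rep (e n)) \<rho> \<phi> \<in> H" by (rule closed) simp
  then show "feval M e S \<phi>" using feval_M[of "\<lambda>n. rep (e n)" \<rho> \<phi>] S[abs_def] by simp
qed

lemma member_not_refuted:
  assumes "\<phi> \<in> H"
  shows "\<not> valid_in M (Neg \<phi>)"
proof -
  have "feval M (\<lambda>n. g (NVar n)) Ext \<phi>" using feval_M[of NVar "\<lambda>X. X" \<phi>] assms by simp
  moreover have "Ext n \<in> Sets M" for n by (simp add: M_def)
  ultimately show ?thesis unfolding valid_in_def by auto
qed

end

end

text \<open>Stage \<open>n\<close> decides the formula with code \<open>n\<close>. All stages are
  finite lists, so fresh variables never run out, and consistency of the union reduces to that of a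
  single stage.\<close>

lemma ex_henkin:
  assumes "consistent T [\<phi>]"
  shows "\<exists>H. henkin T H \<and> \<phi> \<in> H"
proof -
  define P where "P n \<Gamma> \<longleftrightarrow> consistent T \<Gamma> \<and> \<phi> \<in> set \<Gamma>" for n :: nat and \<Gamma>
  define Q where "Q n \<Gamma> \<Delta> \<longleftrightarrow> set \<Gamma> \<subseteq> set \<Delta> \<and> decides \<Delta> (from_nat n)" for n :: nat and \<Gamma> \<Delta>
  have "\<exists>G. \<forall>n. P n (G n) \<and> Q n (G n) (G (Suc n))"
  proof (rule dependent_nat_choice)
    show "\<exists>\<Gamma>. P 0 \<Gamma>" using assms by (intro exI[of _ "[\<phi>]"]) (simp add: P_def)
  next
    fix \<Gamma> n assume "P n \<Gamma>"
    then show "\<exists>\<Delta>. P (Suc n) \<Delta> \<and> Q n \<Gamma> \<Delta>"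
      using consistent_extension[of T \<Gamma> "from_nat n"] unfolding P_def Q_def by blast
  qed
  then obtain G where G: "\<And>n. P n (G n)" "\<And>n. Q n (G n) (G (Suc n))" by blast
  have mono: "set (G m) \<subseteq> set (G n)" if "m \<le> n" for m n
    using lift_Suc_mono_le[of "\<lambda>n. set (G n)"] G(2) that unfolding Q_def by blast
  define H where "H = (\<Union>n. set (G n))"
  have fin: "\<exists>n. set \<Gamma> \<subseteq> set (G n)" if "set \<Gamma> \<subseteq> H" for \<Gamma>
    using that
  proof (induction \<Gamma>)
    case (Cons \<gamma> \<Gamma>)
    then obtain m n where "\<gamma> \<in> set (G m)" "set \<Gamma> \<subseteq> set (G n)" unfolding H_def by auto
    then have "set (\<gamma> # \<Gamma>) \<subseteq> set (G (max m n))"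
      using mono[of m "max m n"] mono[of n "max m n"] by auto
    then show ?case by blast
  qed simp
  have "henkin T H"
  proof
    fix \<Gamma> assume "set \<Gamma> \<subseteq> H"
    then obtain n where "set \<Gamma> \<subseteq> set (G n)" using fin by blast
    then show "consistent T \<Gamma>" using G(1)[of n] weakening[of T \<Gamma> Falsum "G n"] by (auto simp: P_def)
  next
    fix \<psi>
    have "decides (G (Suc (to_nat \<psi>))) \<psi>" using G(2)[of "to_nat \<psi>"] by (simp add: Q_def)
    moreover have "set (G (Suc (to_nat \<psi>))) \<subseteq> H" by (auto simp: H_def)
    ultimately show "\<exists>\<Gamma>. set \<Gamma> \<subseteq> H \<and> decides \<Gamma> \<psi>" by blast
  qed
  moreover have "\<phi> \<in> H" using G(1)[of 0] by (auto simp: H_def P_def)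
  ultimately show ?thesis by blast
qed

text \<open>The basic axioms make the numerals distinct, so that the model is countably infinite and
  its numbers can be renamed to fill the type of natural numbers.\<close>

theorem completeness:
  assumes T: "basic_axioms \<subseteq> T"
    and valid: "\<And>M :: nat arith. Sets M \<noteq> {} \<Longrightarrow> (\<forall>\<psi>\<in>T. valid_in M \<psi>) \<Longrightarrow> valid_in M \<phi>"
  shows "proves T \<phi>"
proof (rule ccontr)
  assume "\<not> proves T \<phi>"
  then have "consistent T [Neg \<phi>]" unfolding proves_def by (auto intro: derives.Contr)
  then obtain H where "henkin T H" and \<phi>: "Neg \<phi> \<in> H" using ex_henkin by blast
  then interpret henkin T H by simp
  define cls where "cls t = {u. Eq t u \<in> H}" for t
  have cls_eq: "cls s = cls t \<longleftrightarrow> Eq s t \<in> H" for s t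
    unfolding cls_def using Eq_refl Eq_sym Eq_trans by blast
  define num where "num n = ((\<lambda>t. Plus t NOne) ^^ n) NZero" for n
  have num: "num 0 = NZero" "num (Suc n) = Plus (num n) NOne" for n by (simp_all add: num_def)
  have ax: "fsub \<sigma> \<rho> \<psi> \<in> H" if "\<psi> \<in> basic_axioms" for \<sigma> \<rho> \<psi>
    using T that by (intro closed[of "[]"] derives_fsub derives.Axm) auto
  have ne0: "Eq (Plus t NOne) NZero \<notin> H" for t
    using ax[of "Neg (Eq (Plus (NVar 1) NOne) NZero)" "\<lambda>n. t"]
    by (simp add: basic_axioms_def Let_def Imp_iff Falsum_notin)
  have inj: "Eq s t \<in> H" if "Eq (Plus s NOne) (Plus t NOne) \<in> H" for s t
    using that ax[of "Imp (Eq (Plus (NVar 0) NOne) (Plus (NVar 1) NOne)) (Eq (NVar 0) (NVar 1))"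
        "\<lambda>n. if n = 0 then s else t"]
    by (simp add: basic_axioms_def Let_def Imp_iff)
  have num_inj: "m = n" if "Eq (num m) (num n) \<in> H" for m n
    using that
  proof (induction m arbitrary: n)
    case 0 then show ?case using ne0 Eq_sym by (cases n) (auto simp: num)
  next
    case (Suc m) then show ?case using ne0 inj by (cases n) (auto simp: num)
  qed
  have "inj (\<lambda>n. cls (num n))" unfolding inj_def cls_eq using num_inj by blast
  then have inf: "infinite (range cls)"
    using finite_subset[of "range (\<lambda>n. cls (num n))" "range cls"] range_inj_infinite by blast
  then have bij: "bij_betw (to_nat_on (range cls)) (range cls) UNIV"
    by (intro to_nat_on_infinite) auto
  define g where "g t = to_nat_on (range cls) (cls t)" for t
  have g1: "g s = g t \<longleftrightarrow> Eq s t \<in> H" for s t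
    unfolding g_def cls_eq[symmetric] by (rule to_nat_on_inj) auto
  have g2: "\<exists>t. g t = x" for x
    using bij_betw_imp_surj_on[OF bij] unfolding g_def by (metis UNIV_I imageE)
  have "Sets (M g) \<noteq> {}" by (simp add: M_def[OF g1 g2])
  then have "valid_in (M g) \<phi>" by (intro valid) (auto intro: valid_in_M[OF g1 g2])
  moreover have "\<not> valid_in (M g) (Neg (Neg \<phi>))" using \<phi> by (rule member_not_refuted[OF g1 g2])
  ultimately show False by (simp add: valid_in_def)
qed

section \<open>Models of the base theory\<close>

text \<open>The operations are split off without axioms so that the structure \<open>std\<close> can
  be formed before the class whose axioms speak about it.\<close>

class l2 = zero + one + plus + times + ord +
  fixes sets :: "'a set set"
begin

definition std :: "'a arith" where
  "std = \<lparr>zer = 0, uni = 1, add = (+), mul = (*), lt = (<), Sets = sets\<rparr>"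

end

text \<open>The relation \<open>\<le>\<close> and the truncated subtraction are not part of the language; they make every
  model an ordered semidomain in the sense of the library.\<close>

class rca = l2 + minus +
  assumes sets_nonempty: "sets \<noteq> {}"
    and axioms_valid: "\<phi> \<in> RCA0_star \<Longrightarrow> valid_in std \<phi>"
    and le_iff: "x \<le> y \<longleftrightarrow> x < y \<or> x = y"
    and minus_eq: "x - y = (if y < x then THE d. x = y + d else 0)"

lemma std_simps [simp]:
  "zer std = 0" "uni std = 1" "add std = (+)" "mul std = (*)" "lt std = (<)" "Sets std = sets"
  by (simp_all add: std_def)

abbreviation tval :: "(nat \<Rightarrow> 'a::l2) \<Rightarrow> tm \<Rightarrow> 'a" where "tval \<equiv> teval std"
abbreviation fval :: "(nat \<Rightarrow> 'a::l2) \<Rightarrow> (nat \<Rightarrow> 'a set) \<Rightarrow> fm \<Rightarrow> bool" where "fval \<equiv> feval std"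

lemma teval_tsub [simp]: "teval M e (tsub \<sigma> t) = teval M (\<lambda>n. teval M e (\<sigma> n)) t"
  by (induction t) auto

lemma case_nat_eta [simp]: "case_nat (f 0) (\<lambda>n. f (Suc n)) = f"
  by (rule ext) (auto split: nat.splits)

lemma feval_fsub: "feval M e S (fsub \<sigma> \<rho> \<phi>) \<longleftrightarrow> feval M (\<lambda>n. teval M e (\<sigma> n)) (\<lambda>X. S (\<rho> X)) \<phi>"
proof (induction \<phi> arbitrary: e S \<sigma> \<rho>)
  case (Forall \<phi>)
  have "(\<lambda>n. teval M (case_nat x e) (up \<sigma> n)) = case_nat x (\<lambda>n. teval M e (\<sigma> n))" for x
    by (rule ext) (auto split: nat.splits)
  then show ?case using Forall by simp
next
  case (ForallS \<phi>)
  have "(\<lambda>X. case_nat Y S (upS \<rho> X)) = case_nat Y (\<lambda>X. S (\<rho> X))" for Y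
    by (rule ext) (auto split: nat.splits)
  then show ?case using ForallS by simp
qed auto


section \<open>Bounded definability\<close>

lemma Delta00_fsub: "Delta00 \<phi> \<Longrightarrow> Delta00 (fsub \<sigma> \<rho> \<phi>)"
proof (induction arbitrary: \<sigma> \<rho> rule: Delta00.induct)
  case (6 \<phi> t)
  show ?case using Delta00.intros(6)[OF "6.IH"[of "up \<sigma>" \<rho>], of "tsub \<sigma> t"] by simp
next
  case (7 \<phi> t)
  show ?case using Delta00.intros(7)[OF "7.IH"[of "up \<sigma>" \<rho>], of "tsub \<sigma> t"] by simp
qed (auto intro: Delta00.intros)

definition mix :: "(nat \<Rightarrow> 'b) \<Rightarrow> (nat \<Rightarrow> 'b) \<Rightarrow> nat \<Rightarrow> 'b" where
  "mix e p n = (if even n then e (n div 2) else p (n div 2))"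

text \<open>Number parameters are interleaved with the environment. In the introduction rules bound
  variables sit at its front, so that resolution can check definability by following the shape of
  a predicate.\<close>

definition D0 :: "((nat \<Rightarrow> 'a::rca) \<Rightarrow> bool) \<Rightarrow> bool" where
  "D0 P \<longleftrightarrow> (\<exists>\<phi> p S. Delta00 \<phi> \<and> (\<forall>n. S n \<in> sets) \<and> (\<forall>e. P e \<longleftrightarrow> fval (mix e p) S \<phi>))"

definition Tm :: "((nat \<Rightarrow> 'a::rca) \<Rightarrow> 'a) \<Rightarrow> bool" where
  "Tm f \<longleftrightarrow> (\<exists>t p. \<forall>e. f e = tval (mix e p) t)"

text \<open>Two formulas with separate parameter lists \<open>p\<close> and \<open>q\<close> are
  brought to the common list \<open>mix p q\<close>: parameter \<open>k\<close> sits at position 2 k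
  + 1 before, and then at 4 k + 1 or 4 k + 3.\<close>

definition left_param :: "nat \<Rightarrow> tm" where
  "left_param n = (if even n then NVar n else NVar (2 * n - 1))"

definition right_param :: "nat \<Rightarrow> tm" where
  "right_param n = (if even n then NVar n else NVar (2 * n + 1))"

lemma mix_left_param: "(\<lambda>n. tval (mix e (mix p q)) (left_param n)) = mix e p"
proof
  fix n
  show "tval (mix e (mix p q)) (left_param n) = mix e p n"
  proof (cases "even n")
    case False
    then obtain k where "n = 2 * k + 1" by (elim oddE)
    then show ?thesis by (simp add: left_param_def mix_def)
  qed (simp add: left_param_def mix_def)
qed

lemma mix_right_param: "(\<lambda>n. tval (mix e (mix p q)) (right_param n)) = mix e q"
proof
  fix n
  show "tval (mix e (mix p q)) (right_param n) = mix e q n"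
  proof (cases "even n")
    case False
    then obtain k where "n = 2 * k + 1" by (elim oddE)
    then show ?thesis by (simp add: right_param_def mix_def)
  qed (simp add: right_param_def mix_def)
qed

lemma Tm_Tm:
  assumes "Tm f" "Tm g"
  shows "\<exists>s t p. \<forall>e. f e = tval (mix e p) s \<and> g e = tval (mix e p) t"
proof -
  obtain s p t q where "\<forall>e. f e = tval (mix e p) s" "\<forall>e. g e = tval (mix e q) t"
    using assms unfolding Tm_def by blast
  then have "f e = tval (mix e (mix p q)) (tsub left_param s) \<and>
    g e = tval (mix e (mix p q)) (tsub right_param t)" for e
    by (simp add: mix_left_param mix_right_param)
  then show ?thesis by blast
qed

lemma Tm_D0:
  assumes "Tm f" "D0 P"
  shows "\<exists>t \<phi> p S. (\<forall>e. f e = tval (mix e p) t \<and> (P e \<longleftrightarrow> fval (mix e p) S \<phi>)) \<and>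
    Delta00 \<phi> \<and> (\<forall>n. S n \<in> sets)"
proof -
  obtain t p \<phi> q S where *: "\<forall>e. f e = tval (mix e p) t" "\<forall>e. P e \<longleftrightarrow> fval (mix e q) S \<phi>"
    "Delta00 \<phi>" "\<forall>n. S n \<in> sets"
    using assms unfolding Tm_def D0_def by blast
  then have "f e = tval (mix e (mix p q)) (tsub left_param t) \<and>
    (P e \<longleftrightarrow> fval (mix e (mix p q)) S (fsub right_param (\<lambda>X. X) \<phi>))" for e
    by (simp add: mix_left_param mix_right_param feval_fsub)
  moreover have "Delta00 (fsub right_param (\<lambda>X. X) \<phi>)" using *(3) by (rule Delta00_fsub)
  ultimately show ?thesis using *(4) by blast
qed

lemma D0_D0:
  assumes "D0 P" "D0 Q"
  shows "\<exists>\<phi> \<psi> p S. (\<forall>e. (P e \<longleftrightarrow> fval (mix e p) S \<phi>) \<and> (Q e \<longleftrightarrow> fval (mix e p) S \<psi>)) \<and>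
    Delta00 \<phi> \<and> Delta00 \<psi> \<and> (\<forall>n. S n \<in> sets)"
proof -
  obtain \<phi> p S \<psi> q U where *: "\<forall>e. P e \<longleftrightarrow> fval (mix e p) S \<phi>" "\<forall>e. Q e \<longleftrightarrow> fval (mix e q) U \<psi>"
    "Delta00 \<phi>" "Delta00 \<psi>" "\<forall>n. S n \<in> sets" "\<forall>n. U n \<in> sets"
    using assms unfolding D0_def by blast
  have "(P e \<longleftrightarrow> fval (mix e (mix p q)) (mix S U) (fsub left_param (\<lambda>X. 2 * X) \<phi>)) \<and>
    (Q e \<longleftrightarrow> fval (mix e (mix p q)) (mix S U) (fsub right_param (\<lambda>X. 2 * X + 1) \<psi>))" for e
    unfolding *(1,2)[rule_format] feval_fsub mix_left_param mix_right_param by (simp add: mix_def)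
  moreover have "\<forall>n. mix S U n \<in> sets" using * by (simp add: mix_def)
  moreover have "Delta00 (fsub left_param (\<lambda>X. 2 * X) \<phi>)" "Delta00 (fsub right_param (\<lambda>X. 2 * X + 1) \<psi>)"
    using * by (auto intro: Delta00_fsub)
  ultimately show ?thesis by blast
qed

lemma Tm_var: "Tm (\<lambda>e. e i)"
  unfolding Tm_def by (intro exI[of _ "NVar (2 * i)"]) (simp add: mix_def)

lemma Tm_const: "Tm (\<lambda>e. a)"
  unfolding Tm_def by (intro exI[of _ "NVar 1"] exI[of _ "\<lambda>_. a"]) (simp add: mix_def)

lemma Tm_plus:
  assumes "Tm f" "Tm g" shows "Tm (\<lambda>e. f e + g e)"
proof -
  obtain s t p where "\<forall>e. f e = tval (mix e p) s \<and> g e = tval (mix e p) t"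
    using Tm_Tm[OF assms] by blast
  then show ?thesis unfolding Tm_def by (intro exI[of _ "Plus s t"] exI[of _ p]) simp
qed

lemma Tm_times:
  assumes "Tm f" "Tm g" shows "Tm (\<lambda>e. f e * g e)"
proof -
  obtain s t p where "\<forall>e. f e = tval (mix e p) s \<and> g e = tval (mix e p) t"
    using Tm_Tm[OF assms] by blast
  then show ?thesis unfolding Tm_def by (intro exI[of _ "Times s t"] exI[of _ p]) simp
qed

lemma ex_set: "\<exists>Y. Y \<in> (sets :: 'a::rca set set)"
  using sets_nonempty by blast

lemma D0_eq:
  fixes f g :: "(nat \<Rightarrow> 'a::rca) \<Rightarrow> 'a"
  assumes "Tm f" "Tm g" shows "D0 (\<lambda>e. f e = g e)"
proof -
  obtain s t p where "\<forall>e. f e = tval (mix e p) s \<and> g e = tval (mix e p) t"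
    using Tm_Tm[OF assms] by blast
  moreover obtain Y :: "'a set" where "Y \<in> sets" using ex_set by blast
  ultimately show ?thesis unfolding D0_def
    by (intro exI[of _ "Eq s t"] exI[of _ p] exI[of _ "\<lambda>_. Y"]) (simp add: Delta00.intros)
qed

lemma D0_less:
  fixes f g :: "(nat \<Rightarrow> 'a::rca) \<Rightarrow> 'a"
  assumes "Tm f" "Tm g" shows "D0 (\<lambda>e. f e < g e)"
proof -
  obtain s t p where "\<forall>e. f e = tval (mix e p) s \<and> g e = tval (mix e p) t"
    using Tm_Tm[OF assms] by blast
  moreover obtain Y :: "'a set" where "Y \<in> sets" using ex_set by blast
  ultimately show ?thesis unfolding D0_def
    by (intro exI[of _ "Less s t"] exI[of _ p] exI[of _ "\<lambda>_. Y"]) (simp add: Delta00.intros)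
qed

lemma D0_mem:
  assumes "Tm f" "Y \<in> sets" shows "D0 (\<lambda>e. f e \<in> Y)"
proof -
  obtain t p where "\<And>e. f e = tval (mix e p) t"
    using assms unfolding Tm_def by blast
  then show ?thesis using assms(2) unfolding D0_def
    by (intro exI[of _ "Mem t 0"] exI[of _ p] exI[of _ "\<lambda>_. Y"]) (simp add: Delta00.intros)
qed

lemma D0_imp:
  assumes "D0 P" "D0 Q" shows "D0 (\<lambda>e. P e \<longrightarrow> Q e)"
proof -
  obtain \<phi> \<psi> p S where "\<forall>e. (P e \<longleftrightarrow> fval (mix e p) S \<phi>) \<and> (Q e \<longleftrightarrow> fval (mix e p) S \<psi>)"
    "Delta00 \<phi>" "Delta00 \<psi>" "\<forall>n. S n \<in> sets" using D0_D0[OF assms] by blast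
  then show ?thesis unfolding D0_def
    by (intro exI[of _ "Imp \<phi> \<psi>"] exI[of _ p] exI[of _ S]) (simp add: Delta00.intros)
qed

lemma D0_False: "D0 (\<lambda>e :: nat \<Rightarrow> 'a::rca. False)"
proof -
  obtain Y :: "'a set" where "Y \<in> sets" using ex_set by blast
  then show ?thesis unfolding D0_def
    by (intro exI[of _ Falsum] exI[of _ "\<lambda>_. 0"] exI[of _ "\<lambda>_. Y"]) (simp add: Delta00.intros)
qed

lemma D0_not: "D0 P \<Longrightarrow> D0 (\<lambda>e. \<not> P e)"
  using D0_imp[of P "\<lambda>_. False"] D0_False by auto

lemma D0_or: "D0 P \<Longrightarrow> D0 Q \<Longrightarrow> D0 (\<lambda>e. P e \<or> Q e)"
  using D0_imp[of "\<lambda>e. \<not> P e" Q] D0_not[of P] by (simp add: disj_imp)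

lemma D0_and: "D0 P \<Longrightarrow> D0 Q \<Longrightarrow> D0 (\<lambda>e. P e \<and> Q e)"
  using D0_not[OF D0_or[OF D0_not[of P] D0_not[of Q]]] by simp

lemma D0_iff: "D0 P \<Longrightarrow> D0 Q \<Longrightarrow> D0 (\<lambda>e. P e \<longleftrightarrow> Q e)"
  using D0_and[OF D0_imp[of P Q] D0_imp[of Q P]] by (simp add: iff_conv_conj_imp)

text \<open>A quantifier puts its variable in front of the whole interleaved list; this renaming
  makes it the front of the environment half and leaves the parameter half in place.\<close>

definition shift_param :: "nat \<Rightarrow> tm" where
  "shift_param n = (if n = 0 then NVar 0 else if even n then NVar (n - 1) else NVar (Suc n))"

lemma mix_shift_param:
  "(\<lambda>n. tval (case_nat x (mix e p)) (shift_param n)) = mix (case_nat x e) p"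
proof
  fix n
  show "tval (case_nat x (mix e p)) (shift_param n) = mix (case_nat x e) p n"
  proof (cases "even n \<and> n \<noteq> 0")
    case True
    then obtain k where "n = 2 * k" "k \<noteq> 0" by auto
    then obtain j where "n = 2 * Suc j" by (metis not0_implies_Suc)
    then show ?thesis by (simp add: shift_param_def mix_def)
  qed (auto simp: shift_param_def mix_def)
qed

lemma D0_bex:
  assumes "Tm t" "D0 (\<lambda>e. P (e 0) (\<lambda>n. e (Suc n)))"
  shows "D0 (\<lambda>e. \<exists>x<t e. P x e)"
proof -
  obtain s \<phi> p S where *: "\<forall>e. t e = tval (mix e p) s \<and> (P (e 0) (\<lambda>n. e (Suc n)) \<longleftrightarrow> fval (mix e p) S \<phi>)"
    "Delta00 \<phi>" "\<forall>n. S n \<in> sets"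
    using Tm_D0[OF assms] by blast
  have "P x e \<longleftrightarrow> fval (mix (case_nat x e) p) S \<phi>" for x e
    using *(1)[rule_format, of "case_nat x e"] by simp
  then show ?thesis unfolding D0_def using *
    by (intro exI[of _ "BExists s (fsub shift_param (\<lambda>X. X) \<phi>)"] exI[of _ p] exI[of _ S])
       (simp add: feval_fsub mix_shift_param Delta00.intros Delta00_fsub)
qed

lemma D0_ball:
  assumes "Tm t" "D0 (\<lambda>e. P (e 0) (\<lambda>n. e (Suc n)))"
  shows "D0 (\<lambda>e. \<forall>x<t e. P x e)"
  using D0_not[OF D0_bex[of t "\<lambda>x e. \<not> P x e", OF assms(1) D0_not[OF assms(2)]]] by simp


lemmas D0_intros = D0_bex D0_ball D0_eq D0_less D0_mem D0_not D0_imp D0_or D0_and D0_iff D0_False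
  Tm_var Tm_const Tm_plus Tm_times


section \<open>Comprehension and induction\<close>

lemma fval_axiom:
  fixes e :: "nat \<Rightarrow> 'a::rca"
  assumes "\<phi> \<in> RCA0_star" "\<And>n. S n \<in> sets"
  shows "fval e S \<phi>"
  using axioms_valid[OF assms(1), where 'a = 'a] assms(2) unfolding valid_in_def by simp

lemma fval_liftFS: "fval e (case_nat Y S) (liftFS \<phi>) \<longleftrightarrow> fval e S \<phi>"
  unfolding liftFS_def feval_fsub by simp

theorem delta1_comprehension:
  fixes P Q :: "'a::rca \<Rightarrow> 'a \<Rightarrow> bool"
  assumes "D0 (\<lambda>e. P (e 0) (e 1))" "D0 (\<lambda>e. Q (e 0) (e 1))"
    and "\<And>x. (\<exists>z. P z x) \<longleftrightarrow> (\<forall>z. Q z x)"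
  shows "{x. \<exists>z. P z x} \<in> sets"
proof -
  obtain \<phi> \<psi> p S where *: "\<forall>e. (P (e 0) (e 1) \<longleftrightarrow> fval (mix e p) S \<phi>) \<and> (Q (e 0) (e 1) \<longleftrightarrow> fval (mix e p) S \<psi>)"
    "Delta00 \<phi>" "Delta00 \<psi>" "\<forall>n. S n \<in> sets"
    using D0_D0[OF assms(1,2)] by blast
  \<comment> \<open>The axiom offers the witness as variable 0, the element as variable 1 and the
    parameters from 2 on. Environment entry 1 is the element; all other entries may be filled with
    the witness, because only entries 0 and 1 matter.\<close>
  define \<sigma> where "\<sigma> n = (if even n then NVar (if n = 2 then 1 else 0) else NVar (n div 2 + 2))" for n :: nat
  define env where "env z x n = (if n = (1::nat) then x else z)" for z x :: 'a and n
  have \<sigma>: "(\<lambda>n. tval (case_nat z (case_nat x p)) (\<sigma> n)) = mix (env z x) p" for z x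
    by (rule ext) (auto simp: \<sigma>_def mix_def env_def elim!: evenE oddE)
  have PQ: "P z x \<longleftrightarrow> fval (mix (env z x) p) S \<phi>" "Q z x \<longleftrightarrow> fval (mix (env z x) p) S \<psi>" for z x
    using *(1)[rule_format, of "env z x"] by (simp_all add: env_def)
  let ?\<phi> = "fsub \<sigma> (\<lambda>X. X) \<phi>" and ?\<psi> = "fsub \<sigma> (\<lambda>X. X) \<psi>"
  have "comprehension_axiom ?\<phi> ?\<psi> \<in> RCA0_star"
    unfolding RCA0_star_def by (rule UnI1, rule UnI2) (use *(2,3) Delta00_fsub in blast)
  from fval_axiom[OF this, of S p] *(4)
  have "(\<forall>x. ((\<exists>z. P z x) \<longrightarrow> (\<forall>z. Q z x)) \<and> ((\<exists>z. \<not> Q z x) \<or> (\<exists>z. P z x))) \<longrightarrow>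
      (\<exists>Y\<in>sets. \<forall>x. (x \<in> Y \<longrightarrow> (\<exists>z. P z x)) \<and> ((\<forall>z. \<not> P z x) \<or> x \<in> Y))"
    by (simp add: comprehension_axiom_def fval_liftFS feval_fsub \<sigma> flip: PQ)
  moreover have "((\<exists>z. P z x) \<longrightarrow> (\<forall>z. Q z x)) \<and> ((\<exists>z. \<not> Q z x) \<or> (\<exists>z. P z x))" for x
    using assms(3)[of x] by blast
  ultimately obtain Y where Y: "Y \<in> sets"
    "\<forall>x. (x \<in> Y \<longrightarrow> (\<exists>z. P z x)) \<and> ((\<forall>z. \<not> P z x) \<or> x \<in> Y)" by meson
  have "x \<in> Y \<longleftrightarrow> (\<exists>z. P z x)" for x using Y(2)[rule_format, of x] by blast
  then have "Y = {x. \<exists>z. P z x}" by (intro set_eqI) simp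
  with Y(1) show ?thesis by simp
qed

lemma comprehension:
  assumes "D0 (\<lambda>e. P (e 0))"
  shows "{x::'a::rca. P x} \<in> sets"
proof -
  \<comment> \<open>The element moves from entry 0 to entry 1, which leaves entry 0 to a dummy
    witness.\<close>
  have "D0 (\<lambda>e. P (e 1))"
  proof -
    obtain \<phi> p S where *: "\<And>e. P (e 0) \<longleftrightarrow> fval (mix e p) S \<phi>" "Delta00 \<phi>" "\<And>n. S n \<in> sets"
      using assms unfolding D0_def by blast
    define \<sigma> where "\<sigma> n = (if even n then NVar (n + 2) else NVar n)" for n
    have "(\<lambda>n. tval (mix e p) (\<sigma> n)) = mix (\<lambda>n. e (Suc n)) p" for e
      by (rule ext) (auto simp: \<sigma>_def mix_def)
    then have "P (e 1) \<longleftrightarrow> fval (mix e p) S (fsub \<sigma> (\<lambda>X. X) \<phi>)" for e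
      using *(1)[of "\<lambda>n. e (Suc n)"] by (simp add: feval_fsub)
    then show ?thesis unfolding D0_def using *(2,3)
      by (intro exI[of _ "fsub \<sigma> (\<lambda>X. X) \<phi>"] exI[of _ p] exI[of _ S]) (simp add: Delta00_fsub)
  qed
  then show ?thesis using delta1_comprehension[of "\<lambda>z. P" "\<lambda>z. P"] by simp
qed

text \<open>Comprehension turns the predicate into a set, so the single induction instance for
  membership suffices for all bounded predicates.\<close>

lemma arith_induct:
  assumes "D0 (\<lambda>e. P (e 0))" "P 0" "\<And>x. P x \<Longrightarrow> P (x + 1)"
  shows "P (x :: 'a::rca)"
proof -
  have "induction_axiom (Mem (NVar 0) 0) \<in> RCA0_star"
    unfolding RCA0_star_def by (rule UnI1, rule UnI1, rule UnI2) (use Delta00.intros(3) in auto)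
  from fval_axiom[OF this, of "\<lambda>_. {x. P x}" "\<lambda>_. 0"] comprehension[of P, OF assms(1)] assms(2,3)
  show ?thesis by (simp add: induction_axiom_def inst_def)
qed

section \<open>Arithmetic from the basic axioms to an ordered semidomain\<close>

lemma basic:
  fixes m n :: "'a::rca"
  shows "n + 1 \<noteq> 0" "m + 1 = n + 1 \<longleftrightarrow> m = n" "m + 0 = m" "m + (n + 1) = (m + n) + 1"
    "m * 0 = 0" "m * (n + 1) = m * n + m" "\<not> m < 0" "m < n + 1 \<longleftrightarrow> m < n \<or> m = n"
proof -
  obtain Y :: "'a set" where Y: "Y \<in> sets" using ex_set by blast
  have *: "\<forall>\<phi>\<in>basic_axioms. fval (case_nat m (\<lambda>_. n)) (\<lambda>_. Y) \<phi>"
    using Y by (auto intro!: fval_axiom simp: RCA0_star_def)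
  show "n + 1 \<noteq> 0" "m + 1 = n + 1 \<longleftrightarrow> m = n" "m + 0 = m" "m + (n + 1) = (m + n) + 1"
    "m * 0 = 0" "m * (n + 1) = m * n + m" "\<not> m < 0" "m < n + 1 \<longleftrightarrow> m < n \<or> m = n"
    using * unfolding basic_axioms_def Let_def by auto
qed

lemma rca_add_assoc: "(x + y) + z = x + (y + z :: 'a::rca)"
  by (rule arith_induct[where x = z], intro D0_intros) (auto simp: basic)

lemma rca_zero_add: "0 + x = (x :: 'a::rca)"
  by (rule arith_induct[where x = x], intro D0_intros) (auto simp: basic)

lemma rca_one_add: "(x + 1) + y = (x + y) + (1 :: 'a::rca)"
  by (rule arith_induct[where x = y], intro D0_intros) (auto simp: basic)

lemma rca_add_commute: "x + y = y + (x :: 'a::rca)"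
  by (rule arith_induct[where x = y], intro D0_intros) (auto simp: basic rca_zero_add rca_one_add)

lemma rca_add_left_cancel: "x + y = x + z \<Longrightarrow> y = (z :: 'a::rca)"
proof (induct x rule: arith_induct)
  case 1 show ?case by (intro D0_intros)
next
  case 2 then show ?case by (simp add: rca_zero_add)
next
  case (3 x) then show ?case by (auto simp: rca_one_add basic)
qed

lemma rca_add_left_commute: "x + (y + z) = y + (x + z :: 'a::rca)"
  by (metis rca_add_assoc rca_add_commute)

lemmas rca_add_ac = rca_add_assoc rca_add_commute rca_add_left_commute

lemma rca_zero_mult: "0 * x = (0 :: 'a::rca)"
  by (rule arith_induct[where x = x], intro D0_intros) (auto simp: basic)

lemma rca_distrib: "(x + y) * z = x * z + y * (z :: 'a::rca)"
  by (rule arith_induct[where x = z], intro D0_intros) (auto simp: basic rca_add_ac)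

lemma rca_one_mult: "1 * x = (x :: 'a::rca)"
  by (rule arith_induct[where x = x], intro D0_intros) (auto simp: basic)

lemma rca_mult_commute: "x * y = y * (x :: 'a::rca)"
  by (rule arith_induct[where x = y], intro D0_intros) (auto simp: basic rca_zero_mult rca_distrib rca_one_mult)

lemma rca_mult_assoc: "(x * y) * z = x * (y * z :: 'a::rca)"
  by (rule arith_induct[where x = z], intro D0_intros) (auto simp: basic, metis rca_distrib rca_mult_commute)

lemma rca_less_succ: "x < x + (1 :: 'a::rca)"
  by (simp add: basic)

lemma rca_less_trans:
  fixes z :: "'a::rca"
  assumes "x < y" "y < z"
  shows "x < z"
proof -
  have "y < z \<longrightarrow> x < z" using assms(1)
    by (induct z rule: arith_induct, intro D0_intros) (auto simp: basic)
  with assms show ?thesis by blast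
qed

lemma rca_irrefl: "\<not> x < (x :: 'a::rca)"
proof (induct x rule: arith_induct)
  case 1 show ?case by (intro D0_intros)
next
  case (3 x) then show ?case by (metis basic(8) rca_less_trans)
qed (auto simp: basic)

lemma rca_zero_less_succ: "0 < x + (1 :: 'a::rca)"
  by (rule arith_induct[where x = x], intro D0_intros) (auto simp: basic)

lemma rca_succ_mono: "x < y \<Longrightarrow> x + 1 < y + (1 :: 'a::rca)"
proof (induct y rule: arith_induct)
  case 1 show ?case by (intro D0_intros)
next
  case (3 y) then show ?case by (metis basic(8))
qed (auto simp: basic)

lemma rca_succ_le: "x < y \<Longrightarrow> x + 1 < y \<or> x + 1 = (y :: 'a::rca)"
proof (induct y rule: arith_induct)
  case 1 show ?case by (intro D0_intros)
next
  case (3 y) then show ?case by (metis basic(8))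
qed (auto simp: basic)

lemma rca_linear: "x < y \<or> x = y \<or> y < (x :: 'a::rca)"
proof (induct y rule: arith_induct)
  case 1 show ?case by (intro D0_intros)
next
  case 2 show ?case by (rule arith_induct[where x = x], intro D0_intros) (auto simp: basic)
next
  case (3 y) then show ?case by (metis basic(8) rca_succ_le)
qed

lemma rca_less_add: "x < x + (d + (1 :: 'a::rca))"
proof (rule arith_induct[where x = d], intro D0_intros)
  fix d assume "x < x + (d + 1)"
  then show "x < x + (d + 1 + 1)" unfolding basic(4)[of x "d + 1"] by (simp add: basic(8))
qed (simp add: rca_zero_add rca_less_succ)

text \<open>The bound \<open>d < y\<close> is there to keep the induction predicate bounded.\<close>

lemma rca_less_imp_add: "x < y \<Longrightarrow> \<exists>d<y. y = x + (d + (1 :: 'a::rca))"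
proof (induct y rule: arith_induct)
  case 1 show ?case by (intro D0_intros)
next
  case (3 y)
  show ?case
  proof (cases "x = y")
    case True
    then show ?thesis
      using rca_zero_less_succ[of y] by (intro exI[of _ 0]) (simp add: rca_zero_add)
  next
    case False
    then have "x < y" using 3(2) by (simp add: basic)
    then obtain d where "d < y" "y = x + (d + 1)" using 3(1) by blast
    then have "d + 1 < y + 1" "y + 1 = x + ((d + 1) + 1)"
      using rca_succ_mono basic(4)[of x "d + 1"] by simp_all
    then show ?thesis by blast
  qed
qed (auto simp: basic)

lemma rca_less_iff: "x < y \<longleftrightarrow> (\<exists>d. y = x + (d + (1 :: 'a::rca)))"
  using rca_less_imp_add rca_less_add by blast

lemma rca_succ_cases: "x = 0 \<or> (\<exists>y. x = y + (1 :: 'a::rca))"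
  using rca_linear[of x 0] rca_less_iff[of 0 x] basic(7)[of x] by (auto simp: rca_zero_add)

lemma rca_minus_add: "(y + d) - y = (d :: 'a::rca)"
proof (cases "d = 0")
  case True
  then show ?thesis by (simp add: minus_eq basic rca_irrefl)
next
  case False
  then obtain c where "d = c + 1" using rca_succ_cases by blast
  then have "y < y + d" using rca_less_add by blast
  then show ?thesis unfolding minus_eq by (auto dest: rca_add_left_cancel)
qed

lemma rca_minus_zero: "\<not> y < x \<Longrightarrow> x - y = (0 :: 'a::rca)"
  by (simp add: minus_eq)

lemma rca_le_iff_add: "x \<le> y \<longleftrightarrow> (\<exists>d. y = x + (d :: 'a::rca))"
proof
  assume "x \<le> y"
  then show "\<exists>d. y = x + d" unfolding le_iff rca_less_iff using basic(3)[of x] by metis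
next
  assume "\<exists>d. y = x + d"
  then obtain d where "y = x + d" by blast
  then show "x \<le> y"
    using rca_succ_cases[of d] rca_less_add[of x] by (auto simp: le_iff basic(3))
qed

lemma rca_less_asym: "x < y \<Longrightarrow> \<not> y < (x :: 'a::rca)"
  using rca_less_trans[of x y x] rca_irrefl[of x] by blast

lemma rca_le_antisym: "x \<le> y \<Longrightarrow> y \<le> x \<Longrightarrow> x = (y :: 'a::rca)"
  unfolding le_iff using rca_less_asym[of x y] by blast

lemma rca_add_mono: "a \<le> b \<Longrightarrow> c + a \<le> c + (b :: 'a::rca)"
  unfolding rca_le_iff_add by (auto simp: rca_add_assoc)

lemma rca_minus_cases:
  obtains d where "x = y + (d :: 'a::rca)" "x - y = d" | "x < y" "x - y = 0"
  using rca_linear[of x y] rca_le_iff_add[of y x] rca_minus_add rca_minus_zero[of y x]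
    rca_less_asym[of x y] le_iff[of y x] by metis

lemma rca_le_add: "x \<le> x + (y :: 'a::rca)"
  unfolding rca_le_iff_add by blast

lemma rca_minus_eq_zero: "x \<le> y \<Longrightarrow> x - y = (0 :: 'a::rca)"
  unfolding le_iff using rca_minus_zero[of y x] rca_less_asym[of x y] rca_irrefl[of x] by blast

lemma rca_distrib_left: "z * (x + y) = z * x + z * (y :: 'a::rca)"
  unfolding rca_mult_commute[of z] rca_distrib ..

lemma rca_mult_mono: "a \<le> b \<Longrightarrow> c * a \<le> c * (b :: 'a::rca)"
  unfolding rca_le_iff_add by (auto simp: rca_distrib_left)

lemma rca_mult_pos: "0 < x \<Longrightarrow> 0 < y \<Longrightarrow> 0 < x * (y :: 'a::rca)"
  unfolding rca_less_iff by (auto simp: basic rca_zero_add)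

lemma rca_mult_strict_mono:
  assumes "a < b" "0 < c" shows "c * a < c * (b :: 'a::rca)"
proof -
  obtain d where "b = a + (d + 1)" using assms(1) rca_less_iff by blast
  moreover have "0 < c * (d + 1)" using assms(2) rca_zero_less_succ by (rule rca_mult_pos)
  then obtain k where "c * (d + 1) = k + 1" unfolding rca_less_iff by (auto simp: rca_zero_add)
  ultimately show ?thesis using rca_less_add[of "c * a" k] by (simp only: rca_distrib_left[of c a])
qed

text \<open>From here on the library's lemmas on ordered semirings apply in every model, nonstandard
  ones included.\<close>

instance rca \<subseteq> linordered_semidom
proof
  fix a b c :: 'a
  show "a + b + c = a + (b + c)" by (rule rca_add_assoc)
  show "a + b = b + a" by (rule rca_add_commute)
  show "0 + a = a" by (rule rca_zero_add)
  show "a + b - a = b" by (rule rca_minus_add)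
  show "a * b * c = a * (b * c)" by (rule rca_mult_assoc)
  show "a * b = b * a" by (rule rca_mult_commute)
  show "1 * a = a" by (rule rca_one_mult)
  show "(a + b) * c = a * c + b * c" by (rule rca_distrib)
  show "a * 0 = 0" by (rule basic(5))
  show "a * (b + c) = a * b + a * c" by (rule rca_distrib_left)
  show "0 * a = 0" by (rule rca_zero_mult)
  show "(0 :: 'a) \<noteq> 1" using basic(1)[of "0 :: 'a"] by (simp add: rca_zero_add)
  show "(a < b) = (a \<le> b \<and> \<not> b \<le> a)" unfolding le_iff using rca_less_asym[of a b] rca_irrefl[of a] by blast
  show "a \<le> a" by (simp add: le_iff)
  show "a \<le> b \<Longrightarrow> b \<le> c \<Longrightarrow> a \<le> c" unfolding le_iff using rca_less_trans[of a b c] by blast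
  show "a \<le> b \<Longrightarrow> b \<le> a \<Longrightarrow> a = b" by (rule rca_le_antisym)
  show "a \<le> b \<or> b \<le> a" unfolding le_iff using rca_linear[of a b] by blast
  show "a \<le> b \<Longrightarrow> c + a \<le> c + b" by (rule rca_add_mono)
  show "(0 :: 'a) < 1" using rca_zero_less_succ[of "0 :: 'a"] by (simp add: rca_zero_add)
  show "b \<le> a \<Longrightarrow> a - b + b = a"
    unfolding rca_le_iff_add using rca_minus_add[of b] rca_add_commute[of b] by auto
  show "a - b - c = a - (b + c)"
  proof (cases a b rule: rca_minus_cases)
    case (1 d)
    show ?thesis
    proof (cases d c rule: rca_minus_cases)
      case (1 e)
      with \<open>a = b + d\<close> \<open>a - b = d\<close> show ?thesis
        using rca_minus_add[of "b + c" e] by (simp add: rca_add_assoc)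
    next
      case 2
      then have "a \<le> b + c" unfolding \<open>a = b + d\<close> by (intro rca_add_mono) (simp add: le_iff)
      with 2 \<open>a - b = d\<close> show ?thesis by (simp add: rca_minus_eq_zero)
    qed
  next
    case 2
    then have "a \<le> b + c" using rca_le_add[of b c] rca_less_trans[of a b "b + c"] by (auto simp: le_iff)
    with 2 show ?thesis by (simp add: rca_minus_eq_zero basic(7) rca_minus_zero)
  qed
  show "a * (b - c) = a * b - a * c"
  proof (cases b c rule: rca_minus_cases)
    case (1 d)
    then show ?thesis by (simp add: rca_distrib_left rca_minus_add)
  next
    case 2
    then show ?thesis
      using rca_minus_eq_zero[OF rca_mult_mono[of b c a]] by (simp add: le_iff basic)
  qed
  show "a < b \<Longrightarrow> 0 < c \<Longrightarrow> c * a < c * b" by (rule rca_mult_strict_mono)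
  show "a \<noteq> 0 \<Longrightarrow> b \<noteq> 0 \<Longrightarrow> a * b \<noteq> 0"
    using rca_mult_pos[of a b] rca_linear[of 0 a] rca_linear[of 0 b] basic(7) rca_irrefl by metis
qed

lemma rca_zero_le [simp]: "0 \<le> (x :: 'a::rca)"
  using rca_le_add[of 0 x] by simp

lemma rca_not_less_zero [simp]: "\<not> x < (0 :: 'a::rca)"
  by (rule basic(7))

lemma rca_le_zero [simp]: "x \<le> 0 \<longleftrightarrow> x = (0 :: 'a::rca)"
  by (simp add: le_iff)

lemma less_succ_iff: "x < y + 1 \<longleftrightarrow> x \<le> (y :: 'a::rca)"
  by (simp add: basic(8) le_iff)

lemma succ_le_iff: "x + 1 \<le> y \<longleftrightarrow> x < (y :: 'a::rca)"
  using less_succ_iff[of y x] by (simp add: not_less[symmetric])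

lemma less_one_iff: "x < 1 \<longleftrightarrow> x = (0 :: 'a::rca)"
  using less_succ_iff[of x 0] by simp

lemma pos_iff: "0 < x \<longleftrightarrow> x \<noteq> (0 :: 'a::rca)"
  using rca_zero_le[of x] by (auto simp: le_iff)

lemma succ_cases: obtains "x = 0" | y where "x = y + (1 :: 'a::rca)"
  using rca_succ_cases by blast

lemma less_imp_ex_add: "x < y \<Longrightarrow> \<exists>d. y = x + d + (1 :: 'a::rca)"
  using rca_less_iff by (metis add.assoc)

lemma le_imp_ex_add: "x \<le> y \<Longrightarrow> \<exists>d. y = x + (d :: 'a::rca)"
  using rca_le_iff_add by blast

lemma D0_le:
  fixes f g :: "(nat \<Rightarrow> 'a::rca) \<Rightarrow> 'a"
  assumes "Tm f" "Tm g" shows "D0 (\<lambda>e. f e \<le> g e)"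
  unfolding le_iff using assms by (intro D0_intros)

lemma D0_bex_le:
  fixes t :: "(nat \<Rightarrow> 'a::rca) \<Rightarrow> 'a"
  assumes "Tm t" "D0 (\<lambda>e. P (e 0) (\<lambda>n. e (Suc n)))"
  shows "D0 (\<lambda>e. \<exists>x\<le>t e. P x e)"
  unfolding less_succ_iff[symmetric] using assms by (intro D0_bex Tm_plus Tm_const)

lemma D0_ball_le:
  fixes t :: "(nat \<Rightarrow> 'a::rca) \<Rightarrow> 'a"
  assumes "Tm t" "D0 (\<lambda>e. P (e 0) (\<lambda>n. e (Suc n)))"
  shows "D0 (\<lambda>e. \<forall>x\<le>t e. P x e)"
  unfolding less_succ_iff[symmetric] using assms by (intro D0_ball Tm_plus Tm_const)

lemmas D0_rules = D0_bex_le D0_ball_le D0_le D0_intros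

section \<open>Least and greatest elements of sets\<close>

lemma least_element:
  assumes "Y \<in> sets" "a \<in> Y"
  shows "\<exists>m\<in>Y. \<forall>y\<in>Y. m \<le> (y :: 'a::rca)"
proof (rule ccontr)
  assume "\<not> ?thesis"
  then have no: "\<And>m. m \<in> Y \<Longrightarrow> \<exists>y\<in>Y. y < m" by (auto simp: not_le)
  have "\<forall>y<a + 1. y \<notin> Y"
  proof (induct a rule: arith_induct)
    case 1 show ?case by (intro D0_rules assms(1))
  next
    case 2 then show ?case using no[of 0] by (auto simp: less_one_iff)
  next
    case (3 x)
    then show ?case using no[of "x + 1"] by (auto simp: less_succ_iff le_iff[of _ "x + 1"])
  qed
  then show False using assms(2) by (auto simp: less_succ_iff)
qed

lemma greatest_element:
  assumes Y: "Y \<in> sets" "a \<in> Y" and b: "\<And>y. y \<in> Y \<Longrightarrow> y \<le> b"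
  shows "\<exists>m\<in>Y. \<forall>y\<in>Y. y \<le> (m :: 'a::rca)"
proof -
  \<comment> \<open>The upper bounds of \<open>Y\<close>; restricting the quantifier to
    \<open>y \<le> b\<close> loses nothing and makes this set boundedly definable. Its least element
    is the maximum sought.\<close>
  let ?U = "{u. \<forall>y\<le>b. y \<in> Y \<longrightarrow> y \<le> u}"
  have "?U \<in> sets" by (rule comprehension, intro D0_rules Y(1))
  from least_element[OF this, of b] obtain m where m: "m \<in> ?U" "\<And>u. u \<in> ?U \<Longrightarrow> m \<le> u" by auto
  have ub: "y \<le> m" if "y \<in> Y" for y using m(1) b[OF that] that by simp
  have "m \<in> Y"
  proof (cases m rule: succ_cases)
    case 1
    then show ?thesis using ub[OF Y(2)] Y(2) by simp
  next
    case (2 k)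
    have "k \<notin> ?U" using m(2)[of k] 2 succ_le_iff[of k k] by auto
    then obtain y where "y \<in> Y" "k < y" by (auto simp: not_le)
    then show ?thesis using ub[of y] 2 by (simp add: succ_le_iff[symmetric])
  qed
  then show ?thesis using ub by blast
qed

text \<open>Under binders a given term reads its variables at shifted positions; the instances in
  \<open>Tm_shift\<close> let definability of the term be reused there.\<close>

lemma Tm_rename:
  assumes "Tm f"
  shows "Tm (\<lambda>e. f (\<lambda>n. e (k n)))"
proof -
  obtain t p where t: "\<forall>e. f e = tval (mix e p) t" using assms unfolding Tm_def by blast
  define \<sigma> where "\<sigma> n = NVar (if even n then 2 * k (n div 2) else n)" for n
  have "(\<lambda>n. tval (mix e p) (\<sigma> n)) = mix (\<lambda>n. e (k n)) p" for e
    by (rule ext) (simp add: \<sigma>_def mix_def)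
  then have "f (\<lambda>n. e (k n)) = tval (mix e p) (tsub \<sigma> t)" for e
    using t by simp
  then show ?thesis unfolding Tm_def by blast
qed

lemmas Tm_shift = Tm_rename[where k = Suc] Tm_rename[where k = "\<lambda>n. Suc (Suc n)"]
  Tm_rename[where k = "\<lambda>n. Suc (Suc (Suc n))"] Tm_rename[where k = "\<lambda>n. Suc (Suc (Suc (Suc n)))"]

section \<open>Pairs\<close>

definition pr :: "'a::rca \<Rightarrow> 'a \<Rightarrow> 'a" where
  "pr x y = (x + y) * (x + y) + x"

lemma tval_pair [simp]: "tval e (pair s t) = pr (tval e s) (tval e t)"
  by (simp add: pair_def pr_def)

lemma Tm_pr: "Tm f \<Longrightarrow> Tm g \<Longrightarrow> Tm (\<lambda>e. pr (f e) (g e))"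
  unfolding pr_def by (intro D0_rules)

lemma mult_self_ge: "x \<le> x * (x :: 'a::rca)"
proof (cases "x = 0")
  case False
  then have "1 \<le> x" by (simp add: succ_le_iff[of 0, simplified] pos_iff)
  then show ?thesis using mult_left_mono[of 1 x x] by simp
qed simp

lemma pr_ge1: "x \<le> pr x y" and pr_ge2: "y \<le> pr x (y :: 'a::rca)"
proof -
  have "x + y \<le> pr x y" unfolding pr_def using mult_self_ge[of "x + y"] by (metis add_increasing2 rca_zero_le)
  then show "x \<le> pr x y" "y \<le> pr x y"
    by (meson order_trans le_add_same_cancel1 le_add_same_cancel2 rca_zero_le)+
qed

lemma pr_mono: "x \<le> x' \<Longrightarrow> y \<le> y' \<Longrightarrow> pr x y \<le> pr x' (y' :: 'a::rca)"
  unfolding pr_def by (intro add_mono mult_mono) simp_all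

text \<open>With s = x + y the code s^2 + x lies below (s + 1)^2, since x is at most s; so codes
  with different sums occupy disjoint intervals.\<close>

lemma pr_less_of_sum:
  assumes "x + y < x' + (y' :: 'a::rca)" shows "pr x y < pr x' y'"
proof -
  define s where "s = x + y"
  have "x \<le> s + s" unfolding s_def by (simp add: add.assoc)
  then have "s * s + x < s * s + (s + s) + 1" by (simp add: less_succ_iff)
  also have "s * s + (s + s) + 1 = (s + 1) * (s + 1)" by (simp add: algebra_simps)
  finally have "pr x y < (x + y + 1) * (x + y + 1)" by (simp only: pr_def s_def)
  also have "\<dots> \<le> (x' + y') * (x' + y')"
    using assms by (intro mult_mono) (simp_all add: succ_le_iff)
  also have "\<dots> \<le> pr x' y'" by (simp add: pr_def)
  finally show ?thesis .
qed

lemma pr_inject [simp]: "pr x y = pr x' y' \<longleftrightarrow> x = x' \<and> y = (y' :: 'a::rca)"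
proof
  assume *: "pr x y = pr x' y'"
  then have "x + y = x' + y'"
    using pr_less_of_sum[of x y x' y'] pr_less_of_sum[of x' y' x y]
    by (cases "x + y" "x' + y'" rule: linorder_cases) simp_all
  with * show "x = x' \<and> y = y'" by (auto simp: pr_def)
qed simp

text \<open>Components do not exceed the code of a pair, so a code can be decoded inside a bounded
  formula. On numbers that are not pairs both the Sigma and the Pi form become false, hence they
  still agree.\<close>

lemma delta1_relation:
  fixes P Q :: "'a::rca \<Rightarrow> 'a \<Rightarrow> 'a \<Rightarrow> bool"
  assumes "D0 (\<lambda>e. P (e 2) (e 1) (e 0))" "D0 (\<lambda>e. Q (e 2) (e 1) (e 0))"
    and eq: "\<And>x y. (\<exists>z. P z x y) \<longleftrightarrow> (\<forall>z. Q z x y)"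
  shows "\<exists>Y\<in>sets. \<forall>x y. pr x y \<in> Y \<longleftrightarrow> (\<exists>z. P z x y)"
proof -
  define P' where "P' z p \<longleftrightarrow> (\<exists>x\<le>p. \<exists>y\<le>p. p = pr x y \<and> P z x y)" for z p
  define Q' where "Q' z p \<longleftrightarrow> (\<exists>x\<le>p. \<exists>y\<le>p. p = pr x y \<and> Q z x y)" for z p
  have "D0 (\<lambda>e. P' (e 0) (e 1))" unfolding P'_def
    using assms(1) by (intro D0_rules Tm_pr) (simp add: numeral_2_eq_2)
  moreover have "D0 (\<lambda>e. Q' (e 0) (e 1))" unfolding Q'_def
    using assms(2) by (intro D0_rules Tm_pr) (simp add: numeral_2_eq_2)
  moreover have "(\<exists>z. P' z p) \<longleftrightarrow> (\<forall>z. Q' z p)" for p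
  proof (cases "\<exists>x y. p = pr x y")
    case True
    then obtain x y where "p = pr x y" by blast
    then have "P' z p \<longleftrightarrow> P z x y" "Q' z p \<longleftrightarrow> Q z x y" for z
      unfolding P'_def Q'_def using pr_ge1 pr_ge2 by auto
    then show ?thesis using eq by simp
  qed (auto simp: P'_def Q'_def)
  ultimately have "{p. \<exists>z. P' z p} \<in> sets" by (rule delta1_comprehension)
  moreover have "pr x y \<in> {p. \<exists>z. P' z p} \<longleftrightarrow> (\<exists>z. P z x y)" for x y
    unfolding P'_def using pr_ge1 pr_ge2 by auto
  ultimately show ?thesis by blast
qed

lemma bounded_relation:
  assumes "D0 (\<lambda>e. P (e 1) (e 0))"
  shows "\<exists>Y\<in>sets. \<forall>x y. pr x y \<in> Y \<longleftrightarrow> P x (y :: 'a::rca)"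
  using delta1_relation[of "\<lambda>z. P" "\<lambda>z. P"] assms by simp


section \<open>Powers of two\<close>

definition beta :: "'a::rca \<Rightarrow> 'a \<Rightarrow> 'a \<Rightarrow> 'a \<Rightarrow> bool" where
  "beta u v i z \<longleftrightarrow> z < 1 + (i + 1) * v \<and> (\<exists>q<u + 1. u = q * (1 + (i + 1) * v) + z)"

lemma fval_beta [simp]:
  "fval e S (beta_fm u v i z) \<longleftrightarrow> beta (tval e u) (tval e v) (tval e i) (tval e z)"
  by (simp add: beta_fm_def beta_def Let_def)

lemma D0_beta: "Tm f \<Longrightarrow> Tm g \<Longrightarrow> Tm h \<Longrightarrow> Tm k \<Longrightarrow> D0 (\<lambda>e. beta (f e) (g e) (h e) (k e))"
  unfolding beta_def by (intro D0_intros) (assumption | rule Tm_shift, assumption)+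

lemma div_unique:
  assumes "q * p + r = q' * p + r'" "r < p" "r' < (p :: 'a::rca)"
  shows "q = q'" "r = r'"
proof -
  have no: False if lt: "q < q'" and "q * p + r = q' * p + r'" "r < p" for q q' r r'
  proof -
    obtain d where "q' = q + d + 1" using less_imp_ex_add[OF lt] by blast
    then have "q * p + r = q * p + (p + (d * p + r'))" using that(2) by (simp add: algebra_simps)
    then have "r = p + (d * p + r')" unfolding add_left_cancel .
    then show False using that(3) by (simp add: not_less[symmetric])
  qed
  have "\<not> q < q'" "\<not> q' < q" using no[OF _ assms(1,2)] no[OF _ assms(1)[symmetric] assms(3)] by auto
  then show "q = q'" by simp
  then show "r = r'" using assms(1) by simp
qed

lemma beta_unique: "beta u v i z \<Longrightarrow> beta u v i z' \<Longrightarrow> z = z'"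
  unfolding beta_def using div_unique(2) by metis

definition power_code :: "'a::rca \<Rightarrow> 'a \<Rightarrow> 'a \<Rightarrow> bool" where
  "power_code u v n \<longleftrightarrow> beta u v 0 1 \<and>
     (\<forall>i<n. \<exists>z<u + 1. beta u v i z \<and> beta u v (i + 1) (z * 2))"

lemma D0_power_code: "Tm f \<Longrightarrow> Tm g \<Longrightarrow> Tm h \<Longrightarrow> D0 (\<lambda>e. power_code (f e) (g e) (h e))"
  unfolding power_code_def by (intro D0_intros D0_beta) (assumption | rule Tm_shift, assumption)+

lemma ex_power_code: "\<exists>u v y. power_code u v n \<and> beta u v n (y :: 'a::rca)"
proof -
  obtain Y :: "'a set" where Y: "Y \<in> sets" using ex_set by blast
  have "exp_axiom \<in> RCA0_star" by (simp add: RCA0_star_def)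
  from fval_axiom[OF this, of "\<lambda>_. Y" "\<lambda>_. 0"] Y
  have "\<forall>b n. \<exists>y u v. beta u v 0 1 \<and>
     (\<forall>i<n. \<exists>z. beta u v i z \<and> z < u + 1 \<and> beta u v (i + 1) (z * b)) \<and> beta u v n (y :: 'a)"
    by (simp add: exp_axiom_def exp_fm_def numeral_2_eq_2 eval_nat_numeral)
  then obtain y u v where "beta u v 0 1" "beta u v n y"
    "\<forall>i<n. \<exists>z. beta u v i z \<and> z < u + 1 \<and> beta u v (i + 1) (z * 2)" by meson
  then show ?thesis unfolding power_code_def by blast
qed

text \<open>Two codes obeying the same recursion agree stage by stage. A value of the beta function
  is a remainder, hence at most \<open>u\<close>, and this bounds the quantifiers of the induction
  predicate.\<close>

lemma power_code_agree:
  assumes "power_code u v m" "power_code u' v' n"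
  shows "i \<le> m \<Longrightarrow> i \<le> n \<Longrightarrow> beta u v i z \<Longrightarrow> beta u' v' i z' \<Longrightarrow> z = z'"
proof -
  have "i \<le> m \<longrightarrow> i \<le> n \<longrightarrow> (\<forall>z\<le>u. \<forall>z'\<le>u'. beta u v i z \<longrightarrow> beta u' v' i z' \<longrightarrow> z = z')"
  proof (induct i rule: arith_induct)
    case 1 show ?case by (intro D0_rules D0_beta)
  next
    case 2
    have "beta u v 0 1" "beta u' v' 0 1" using assms by (simp_all add: power_code_def)
    then show ?case using beta_unique by blast
  next
    case (3 i)
    show ?case
    proof (intro impI allI)
      fix z z' assume *: "i + 1 \<le> m" "i + 1 \<le> n" "beta u v (i + 1) z" "beta u' v' (i + 1) z'"
      then have "i < m" "i < n" by (simp_all add: succ_le_iff)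
      then obtain w w' where w: "w \<le> u" "beta u v i w" "beta u v (i + 1) (w * 2)"
        "w' \<le> u'" "beta u' v' i w'" "beta u' v' (i + 1) (w' * 2)"
        using assms unfolding power_code_def less_succ_iff by meson
      then have "w = w'" using 3 * by (auto simp: succ_le_iff)
      then show "z = z'" using w * beta_unique by blast
    qed
  qed
  moreover have "beta u v i z \<Longrightarrow> z \<le> u" for u v z :: 'a
    unfolding beta_def by (auto simp: add_increasing)
  ultimately show "i \<le> m \<Longrightarrow> i \<le> n \<Longrightarrow> beta u v i z \<Longrightarrow> beta u' v' i z' \<Longrightarrow> z = z'" by blast
qed

definition pw :: "'a::rca \<Rightarrow> 'a" where
  "pw n = (THE y. \<exists>u v. power_code u v n \<and> beta u v n y)"

lemma pw_eqI: "power_code u v n \<Longrightarrow> beta u v n y \<Longrightarrow> pw n = y"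
  unfolding pw_def using power_code_agree by (intro the_equality) blast+

lemma pw_code: obtains u v where "power_code u v n" "beta u v n (pw n)"
  using ex_power_code[of n] pw_eqI by metis

lemma pw_0 [simp]: "pw 0 = 1"
proof -
  obtain u v :: 'a where "power_code u v 0" by (rule pw_code)
  then show ?thesis by (intro pw_eqI[of u v]) (simp_all add: power_code_def)
qed

lemma pw_succ [simp]: "pw (n + 1) = pw n * 2"
proof -
  obtain u v where u: "power_code u v (n + 1)" by (rule pw_code)
  then obtain z where z: "beta u v n z" "beta u v (n + 1) (z * 2)"
    unfolding power_code_def by (auto simp: less_succ_iff)
  have "power_code u v n" using u unfolding power_code_def by (auto simp: less_succ_iff)
  then have "pw n = z" using z(1) by (rule pw_eqI)
  then show ?thesis using pw_eqI[OF u z(2)] by simp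
qed

text \<open>The graph of exponentiation as a relation constant of its own, so that no rule for terms
  is tempted to match it.\<close>

definition is_pw :: "'a::rca \<Rightarrow> 'a \<Rightarrow> bool" where
  "is_pw n y \<longleftrightarrow> y = pw n"

text \<open>The graph is Delta-1: some code yields \<open>y\<close>, or equivalently every code
  yields \<open>y\<close>; totality of exponentiation makes the second form correct. As a set, the
  graph may then occur as a parameter of bounded formulas.\<close>

lemma ex_pw_graph: "\<exists>Y\<in>sets. \<forall>n y. pr n y \<in> Y \<longleftrightarrow> is_pw n (y :: 'a::rca)"
proof -
  define P where "P z n y \<longleftrightarrow> (\<exists>u\<le>z. \<exists>v\<le>z. power_code u v n \<and> beta u v n y)" for z n y :: 'a
  define Q where "Q z n y \<longleftrightarrow> (\<forall>u\<le>z. \<forall>v\<le>z. \<forall>x\<le>z. power_code u v n \<longrightarrow> beta u v n x \<longrightarrow> x = y)"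
    for z n y :: 'a
  have P: "(\<exists>z. P z n y) \<longleftrightarrow> is_pw n y" for n y
  proof
    assume "is_pw n y"
    then obtain u v where "power_code u v n" "beta u v n y" unfolding is_pw_def using pw_code[of n] by blast
    then show "\<exists>z. P z n y" unfolding P_def using pr_ge1[of u v] pr_ge2[of v u] by blast
  qed (auto simp: P_def is_pw_def dest: pw_eqI)
  have Q: "(\<forall>z. Q z n y) \<longleftrightarrow> is_pw n y" for n y
  proof
    assume *: "\<forall>z. Q z n y"
    obtain u v where "power_code u v n" "beta u v n (pw n)" by (rule pw_code)
    moreover have "u \<le> pr u (pr v (pw n))" "v \<le> pr u (pr v (pw n))" "pw n \<le> pr u (pr v (pw n))"
      using pr_ge1 pr_ge2 order_trans by metis+
    ultimately show "is_pw n y" using * unfolding Q_def is_pw_def by metis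
  qed (auto simp: Q_def is_pw_def dest: pw_eqI)
  have "\<exists>Y\<in>sets. \<forall>n y. pr n y \<in> Y \<longleftrightarrow> (\<exists>z. P z n y)"
    unfolding P_def by (rule delta1_relation[of _ Q])
      (unfold Q_def, (intro D0_rules D0_beta D0_power_code)+, unfold P_def[symmetric] Q_def[symmetric] P Q, simp)
  then show ?thesis unfolding P .
qed

lemma D0_is_pw: "Tm f \<Longrightarrow> Tm g \<Longrightarrow> D0 (\<lambda>e. is_pw (f e) (g e :: 'a::rca))"
proof -
  assume *: "Tm f" "Tm g"
  obtain Y where "Y \<in> sets" "\<forall>n y. pr n y \<in> Y \<longleftrightarrow> is_pw n (y :: 'a)" using ex_pw_graph by blast
  then show ?thesis using D0_mem[OF Tm_pr[OF *], of Y] by simp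
qed

text \<open>No term bounds \<open>pw n\<close>, so a predicate of \<open>n\<close> and
  \<open>pw n\<close> is not bounded as it stands. It is Delta-1, through the graph of
  exponentiation, and induction is applied to the resulting set.\<close>

lemma pw_induct:
  assumes "D0 (\<lambda>e. P (e 1) (e 0))" "P 0 1" "\<And>n. P n (pw n) \<Longrightarrow> P (n + 1) (pw n * 2)"
  shows "P n (pw n :: 'a::rca)"
proof -
  define Q where "Q y n \<longleftrightarrow> is_pw n y \<and> P n y" for y n
  define R where "R y n \<longleftrightarrow> (is_pw n y \<longrightarrow> P n y)" for y n
  have "D0 (\<lambda>e. Q (e 0) (e 1))" "D0 (\<lambda>e. R (e 0) (e 1))"
    unfolding Q_def R_def by (intro D0_rules D0_is_pw assms(1))+
  then have "{n. \<exists>y. Q y n} \<in> sets"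
    by (rule delta1_comprehension) (simp add: Q_def R_def is_pw_def)
  moreover have "{n. \<exists>y. Q y n} = {n. P n (pw n)}" by (simp add: Q_def is_pw_def)
  ultimately have Y: "{n. P n (pw n)} \<in> sets" by simp
  have "n \<in> {n. P n (pw n)}"
    by (rule arith_induct[where x = n], intro D0_rules Y) (simp_all add: assms)
  then show ?thesis by simp
qed

lemma pw_pos [simp]: "0 < pw (n :: 'a::rca)"
  by (rule pw_induct[of "\<lambda>n y. 0 < y"], intro D0_rules) simp_all

lemma less_pw: "n < pw (n :: 'a::rca)"
proof (rule pw_induct[of "\<lambda>n y. n < y"], intro D0_rules)
  fix n :: 'a assume "n < pw n"
  then have "n + 1 \<le> pw n" "1 \<le> pw n" using succ_le_iff[of 0 "pw n"] by (simp_all add: succ_le_iff)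
  then have "n + 1 + 1 \<le> pw n + pw n" by (rule add_mono)
  then show "n + 1 < pw n * 2" by (simp add: succ_le_iff mult_2_right)
qed simp

lemma pw_add: "pw (m + n) = pw m * pw (n :: 'a::rca)"
proof -
  have "is_pw (m + n) (pw m * pw n)"
  proof (rule pw_induct[of "\<lambda>n y. is_pw (m + n) (pw m * y)"], intro D0_rules D0_is_pw)
    fix n assume "is_pw (m + n) (pw m * pw n)"
    then show "is_pw (m + (n + 1)) (pw m * (pw n * 2))"
      by (simp only: is_pw_def mult.assoc[symmetric] add.assoc[symmetric] pw_succ)
  qed (simp add: is_pw_def)
  then show ?thesis by (simp add: is_pw_def)
qed

lemma one_le_pw: "1 \<le> pw (n :: 'a::rca)"
  using pw_pos[of n] succ_le_iff[of 0 "pw n"] by simp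

lemma pw_mono: "m \<le> n \<Longrightarrow> pw m \<le> pw (n :: 'a::rca)"
  using le_imp_ex_add[of m n] mult_left_mono[OF one_le_pw, of "pw m"] by (auto simp: pw_add)

lemma pw_less_factor:
  assumes "m < n" shows "\<exists>d. pw n = 2 * pw d * pw (m :: 'a::rca)"
proof -
  obtain d where "n = m + d + 1" using less_imp_ex_add[OF assms] by blast
  then have "pw n = pw (m + d) * 2" by simp
  then show ?thesis by (intro exI[of _ d]) (simp add: pw_add algebra_simps)
qed


section \<open>Binary coding of bounded sets\<close>

lemma division:
  assumes "0 < (p :: 'a::rca)"
  obtains q r where "a = q * p + r" "r < p"
proof -
  have "\<exists>q\<le>a. \<exists>r<p. a = q * p + r"
  proof (rule arith_induct[where x = a], intro D0_rules)
    show "\<exists>q\<le>0. \<exists>r<p. 0 = q * p + r" using assms by auto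
  next
    fix a assume "\<exists>q\<le>a. \<exists>r<p. a = q * p + r"
    then obtain q r where qr: "q \<le> a" "r < p" "a = q * p + r" by blast
    show "\<exists>q\<le>a + 1. \<exists>r<p. a + 1 = q * p + r"
    proof (cases "r + 1 = p")
      case True
      then have "a + 1 = (q + 1) * p + 0" using qr by (simp add: distrib_right add.assoc)
      then show ?thesis using qr assms by (metis add_right_mono)
    next
      case False
      then have "r + 1 < p" using qr(2) succ_le_iff[of r p] by (simp add: le_iff)
      moreover have "a + 1 = q * p + (r + 1)" using qr by (simp add: add.assoc)
      moreover have "q \<le> a + 1" using qr(1) by (simp add: le_iff less_succ_iff)
      ultimately show ?thesis by blast
    qed
  qed
  then show ?thesis using that by blast
qed

definition is_odd :: "'a::rca \<Rightarrow> bool" where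
  "is_odd s \<longleftrightarrow> (\<exists>q. s = 2 * q + 1)"

lemma one_less_two: "1 < (2 :: 'a::rca)"
  using less_succ_iff[of 1 "1::'a"] by simp

lemma not_odd_iff: "\<not> is_odd s \<longleftrightarrow> (\<exists>q. s = 2 * (q :: 'a::rca))"
proof
  assume *: "\<not> is_odd s"
  have "0 < (2 :: 'a)" by simp
  then obtain q r where "s = q * 2 + r" "r < 2" by (rule division)
  moreover have "r < 2 \<longleftrightarrow> r = 0 \<or> r = 1" using basic(8)[of r 1] less_one_iff[of r] by simp
  ultimately show "\<exists>q. s = 2 * q" using * by (auto simp: is_odd_def mult.commute)
next
  assume "\<exists>q. s = 2 * q"
  then obtain q where q: "s = 2 * q" by blast
  show "\<not> is_odd s"
  proof
    assume "is_odd s"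
    then obtain r where "s = 2 * r + 1" by (auto simp: is_odd_def)
    then have "q * 2 + 0 = r * 2 + 1" using q by (simp add: mult.commute)
    then show False using div_unique(2)[of q 2 0 r 1] one_less_two by simp
  qed
qed

lemma is_odd_add_even: "is_odd (2 * c + s) \<longleftrightarrow> is_odd (s :: 'a::rca)"
proof (cases "is_odd s")
  case True
  then obtain q where "s = 2 * q + 1" by (auto simp: is_odd_def)
  then have "2 * c + s = 2 * (c + q) + 1" by (simp add: algebra_simps)
  then show ?thesis using True unfolding is_odd_def by blast
next
  case False
  then obtain q where "s = 2 * q" by (auto simp: not_odd_iff)
  then have "2 * c + s = 2 * (c + q)" by (simp add: algebra_simps)
  then show ?thesis using False not_odd_iff by blast
qed

text \<open>Binary digit \<open>i\<close> of \<open>t\<close> is 1: division by 2^i leaves the odd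
  quotient 2 q + 1 and the remainder \<open>r\<close>.\<close>

definition digit :: "'a::rca \<Rightarrow> 'a \<Rightarrow> bool" where
  "digit i t \<longleftrightarrow> (\<exists>q r. r < pw i \<and> t = (2 * q + 1) * pw i + r)"

lemma digit_iff_odd:
  assumes "t = s * pw i + r" "r < pw (i :: 'a::rca)"
  shows "digit i t \<longleftrightarrow> is_odd s"
proof
  assume "digit i t"
  then obtain q r' where "r' < pw i" "t = (2 * q + 1) * pw i + r'" by (auto simp: digit_def)
  then have "s = 2 * q + 1" using assms div_unique(1)[of s "pw i" r "2 * q + 1" r'] by simp
  then show "is_odd s" by (auto simp: is_odd_def)
qed (use assms in \<open>auto simp: digit_def is_odd_def\<close>)

lemma digit_less: "digit i t \<Longrightarrow> i < (t :: 'a::rca)"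
proof -
  assume "digit i t"
  then obtain q r where "t = pw i + (2 * q * pw i + r)" by (auto simp: digit_def algebra_simps)
  then have "pw i \<le> t" by (simp only: rca_le_add)
  then show ?thesis using less_pw[of i] by simp
qed

text \<open>All witnesses are at most \<open>t\<close>, which makes the definition bounded over the
  graph of exponentiation.\<close>

lemma digit_bounded:
  "digit i t \<longleftrightarrow> (\<exists>p\<le>t. \<exists>q\<le>t. \<exists>r\<le>t. is_pw i p \<and> r < p \<and> t = (2 * q + 1) * p + (r :: 'a::rca))"
proof
  assume "digit i t"
  then obtain q r where qr: "r < pw i" "t = (2 * q + 1) * pw i + r" by (auto simp: digit_def)
  have "t = pw i + (2 * q * pw i + r)" using qr(2) by (simp add: algebra_simps)
  then have p: "pw i \<le> t" by (simp only: rca_le_add)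
  have "q \<le> q * pw i" using mult_left_mono[OF one_le_pw, of q] by simp
  then have "q \<le> q * pw i + (q * pw i + pw i + r)" by (rule order_trans) (rule rca_le_add)
  moreover have "t = q * pw i + (q * pw i + pw i + r)" using qr(2) by (simp add: algebra_simps mult_2_right)
  ultimately have "q \<le> t" by simp
  moreover have "r \<le> t" using rca_le_add[of r "(2 * q + 1) * pw i"] qr(2) by (simp only: add.commute)
  ultimately show "\<exists>p\<le>t. \<exists>q\<le>t. \<exists>r\<le>t. is_pw i p \<and> r < p \<and> t = (2 * q + 1) * p + r"
    using qr p unfolding is_pw_def by blast
qed (auto simp: digit_def is_pw_def)

lemma D0_digit:
  assumes "Tm f" "Tm g" shows "D0 (\<lambda>e. digit (f e) (g e :: 'a::rca))"
  unfolding digit_bounded using assms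
  by (intro D0_rules D0_is_pw) (assumption | rule Tm_shift, assumption)+

lemma not_digit_ge: "t < pw i \<Longrightarrow> \<not> digit i (t :: 'a::rca)"
  using digit_iff_odd[of t 0 i t] not_odd_iff[of "0 :: 'a"] by auto

text \<open>Both 2^n and the part of \<open>t\<close> above position \<open>i\<close> are even
  multiples of 2^i. So \<open>t\<close> stays below the next even multiple, which is at most 2^n,
  with room for one more 2^i.\<close>

lemma add_pw_less:
  assumes "\<not> digit i t" "i < n" "t < pw n"
  shows "t + pw i < pw (n :: 'a::rca)"
proof -
  obtain d where d: "pw n = 2 * pw d * pw i" using pw_less_factor[OF assms(2)] by blast
  obtain s r where s: "t = s * pw i + r" "r < pw i" using division[OF pw_pos] by blast
  then obtain q where q: "s = 2 * q" using assms(1) digit_iff_odd[OF s] not_odd_iff by blast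
  have "q < pw d"
  proof (rule ccontr)
    assume "\<not> q < pw d"
    then have "2 * pw d * pw i \<le> 2 * q * pw i" by (intro mult_right_mono mult_left_mono) (simp_all add: not_less)
    then have "2 * pw d * pw i \<le> t" unfolding s(1) q by (rule order_trans) (rule rca_le_add)
    then show False using assms(3) d by simp
  qed
  then have "2 * (q + 1) * pw i \<le> pw n" unfolding d
    by (intro mult_right_mono mult_left_mono) (simp_all add: succ_le_iff)
  moreover have "t + pw i = (2 * q * pw i + pw i) + r" by (simp add: s(1) q algebra_simps)
  moreover have "2 * (q + 1) * pw i = (2 * q * pw i + pw i) + pw i"
    by (simp add: algebra_simps mult_2_right)
  ultimately show ?thesis using s(2) by (metis add_strict_left_mono order_less_le_trans)
qed

text \<open>There is no carry. Below \<open>i\<close> the quotient changes by an even number; above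
  \<open>i\<close> the remainder of \<open>t\<close> modulo 2^j also lacks digit \<open>i\<close>,
  so adding 2^i does not push it to 2^j.\<close>

lemma digit_add_pw:
  assumes "\<not> digit i t"
  shows "digit j (t + pw i) \<longleftrightarrow> digit j t \<or> j = (i :: 'a::rca)"
proof (cases j i rule: linorder_cases)
  case less
  then obtain d where d: "pw i = 2 * pw d * pw j" using pw_less_factor by blast
  obtain s r where s: "t = s * pw j + r" "r < pw j" using division[OF pw_pos] by blast
  have "t + pw i = (2 * pw d + s) * pw j + r" unfolding d s by (simp add: algebra_simps)
  then have "digit j (t + pw i) \<longleftrightarrow> digit j t"
    using digit_iff_odd[OF s] digit_iff_odd[of "t + pw i" "2 * pw d + s" j r] s(2) is_odd_add_even by metis
  then show ?thesis using less by auto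
next
  case equal
  obtain s r where s: "t = s * pw i + r" "r < pw i" using division[OF pw_pos] by blast
  then obtain q where q: "s = 2 * q" using assms(1) digit_iff_odd[OF s] not_odd_iff by blast
  have "t + pw i = (2 * q + 1) * pw i + r" unfolding s q by (simp add: algebra_simps)
  then show ?thesis using s(2) equal unfolding digit_def by blast
next
  case greater
  obtain d where d: "pw j = 2 * pw d * pw i" using pw_less_factor[OF greater] by blast
  obtain s r where s: "t = s * pw j + r" "r < pw j" using division[OF pw_pos] by blast
  obtain s' r' where s': "r = s' * pw i + r'" "r' < pw i" using division[OF pw_pos] by blast
  have "t = (2 * (s * pw d) + s') * pw i + r'" unfolding s(1) d s'(1) by (simp add: algebra_simps)
  then have "digit i t \<longleftrightarrow> digit i r"
    using digit_iff_odd[OF s'] digit_iff_odd[of t "2 * (s * pw d) + s'" i r'] s'(2) is_odd_add_even by metis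
  then have "r + pw i < pw j" using assms add_pw_less[OF _ greater s(2)] by simp
  moreover have "t + pw i = s * pw j + (r + pw i)" using s(1) by (simp add: add.assoc)
  ultimately have "digit j (t + pw i) \<longleftrightarrow> digit j t"
    using digit_iff_odd[OF s] digit_iff_odd[of "t + pw i" s j "r + pw i"] by simp
  then show ?thesis using greater by auto
qed

text \<open>The code is built digit by digit. Its bound doubles at each stage, which is why the
  induction is \<open>pw_induct\<close>.\<close>

lemma ex_code:
  assumes "Y \<in> sets"
  shows "\<exists>t<pw n. \<forall>i. digit i t \<longleftrightarrow> i \<in> Y \<and> i < (n :: 'a::rca)"
proof -
  have "\<exists>t<pw n. \<forall>i<n. digit i t \<longleftrightarrow> i \<in> Y"
  proof (rule pw_induct[of "\<lambda>n y. \<exists>t<y. \<forall>i<n. digit i t \<longleftrightarrow> i \<in> Y"], intro D0_rules D0_digit assms)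
    fix n assume "\<exists>t<pw n. \<forall>i<n. digit i t \<longleftrightarrow> i \<in> Y"
    then obtain t where t: "t < pw n" "\<forall>i<n. digit i t \<longleftrightarrow> i \<in> Y" by blast
    then have nb: "\<not> digit n t" by (intro not_digit_ge)
    show "\<exists>t<pw n * 2. \<forall>i<n + 1. digit i t \<longleftrightarrow> i \<in> Y"
    proof (cases "n \<in> Y")
      case True
      have "t + pw n < pw n * 2" using t(1) by (simp add: mult_2_right)
      moreover have "\<forall>i<n + 1. digit i (t + pw n) \<longleftrightarrow> i \<in> Y"
        using True t(2) by (auto simp: digit_add_pw[OF nb] basic(8))
      ultimately show ?thesis by blast
    next
      case False
      have "t < pw n * 2" using t(1) by (simp add: mult_2_right add_strict_increasing2)
      then show ?thesis using False t(2) nb by (auto simp: basic(8))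
    qed
  qed (simp add: less_one_iff)
  then obtain t where t: "t < pw n" "\<forall>i<n. digit i t \<longleftrightarrow> i \<in> Y" by blast
  moreover have "\<not> digit i t" if "\<not> i < n" for i
    using t(1) pw_mono[of n i] that by (intro not_digit_ge) (simp add: not_less)
  ultimately show ?thesis by blast
qed

section \<open>Collection\<close>

text \<open>Either the old maximum dominates n + 1 or it is dominated by it. Besides collection,
  this provides the maximum clause of the sentence for the numbers themselves.\<close>

lemma finite_maximum:
  fixes L :: "'a::rca set"
  assumes L: "L \<in> sets"
    and total: "\<And>x y. pr x y \<in> L \<or> pr y x \<in> L"
    and trans: "\<And>x y z. pr x y \<in> L \<Longrightarrow> pr y z \<in> L \<Longrightarrow> pr x z \<in> L"
  shows "\<exists>m\<le>n. \<forall>x\<le>n. pr x m \<in> L"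
proof (induct n rule: arith_induct)
  case 1 show ?case by (intro D0_rules Tm_pr L)
next
  case 2 show ?case using total[of 0 0] by auto
next
  case (3 n)
  then obtain m where m: "m \<le> n" "\<forall>x\<le>n. pr x m \<in> L" by blast
  have le: "x \<le> n + 1 \<longleftrightarrow> x \<le> n \<or> x = n + 1" for x
    using less_succ_iff[of x n] by (simp add: le_iff)
  show ?case
  proof (cases "pr (n + 1) m \<in> L")
    case True
    then show ?thesis using m by (intro exI[of _ m]) (auto simp: le)
  next
    case False
    then have "pr m (n + 1) \<in> L" using total by blast
    then have "pr x (n + 1) \<in> L" if "x \<le> n" for x using m(2) that trans by blast
    then show ?thesis using total[of "n + 1" "n + 1"] by (intro exI[of _ "n + 1"]) (auto simp: le)
  qed
qed

text \<open>Comparing the least witnesses preorders the numbers, and this preorder is a set. A number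
  below the bound with the largest least witness is then found by a bounded search.\<close>

theorem collection:
  fixes P :: "'a::rca \<Rightarrow> 'a \<Rightarrow> bool"
  assumes P: "D0 (\<lambda>e. P (e 1) (e 0))" and total: "\<And>x. x < a \<Longrightarrow> \<exists>y. P x y"
  shows "\<exists>b. \<forall>x<a. \<exists>y\<le>b. P x y"
proof -
  obtain Y where Y: "Y \<in> sets" and Y_iff: "\<And>x y. pr x y \<in> Y \<longleftrightarrow> P x y"
    using bounded_relation[OF P] by blast
  \<comment> \<open>From \<open>a\<close> on everything counts as a witness, so least witnesses
    exist for all numbers and the preorder is total, as \<open>finite_maximum\<close>
    demands.\<close>
  define W where "W x y \<longleftrightarrow> a \<le> x \<or> pr x y \<in> Y" for x y
  define least where "least x y \<longleftrightarrow> W x y \<and> (\<forall>z<y. \<not> W x z)" for x y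
  have ex: "\<exists>y. least x y" for x
  proof -
    have "{y. W x y} \<in> sets" unfolding W_def by (rule comprehension, intro D0_rules Tm_pr Y)
    moreover have "\<exists>y. y \<in> {y. W x y}" using total[of x] Y_iff by (auto simp: W_def not_less[symmetric])
    ultimately obtain y where "y \<in> {y. W x y}" "\<forall>z\<in>{y. W x y}. y \<le> z"
      using least_element by blast
    then show ?thesis unfolding least_def by (intro exI[of _ y]) (auto simp: not_le[symmetric])
  qed
  then obtain f where f: "\<And>x. least x (f x)" by metis
  have least_eq: "least x z \<longleftrightarrow> z = f x" for x z
    using f[of x] unfolding least_def by (metis linorder_neqE)
  have W_iff: "(\<exists>y\<le>z. W x y) \<longleftrightarrow> f x \<le> z" for x z
    using f[of x] unfolding least_def by (meson le_less_trans not_le)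
  \<comment> \<open>The least witness \<open>z\<close> of \<open>x'\<close> exists and is unique, so
    it may be introduced existentially or universally.\<close>
  have "\<exists>L\<in>sets. \<forall>x x'. pr x x' \<in> L \<longleftrightarrow> (\<exists>z. least x' z \<and> (\<exists>y\<le>z. W x y))"
  proof (rule delta1_relation)
    show "D0 (\<lambda>e. least (e 0) (e 2) \<and> (\<exists>y\<le>e 2. W (e 1) y))"
      "D0 (\<lambda>e. least (e 0) (e 2) \<longrightarrow> (\<exists>y\<le>e 2. W (e 1) y))"
      unfolding least_def W_def by (intro D0_rules Tm_pr Y)+
  qed (simp add: least_eq)
  then obtain L where "L \<in> sets" and L: "\<And>x x'. pr x x' \<in> L \<longleftrightarrow> f x \<le> f x'"
    unfolding least_eq W_iff by auto
  then obtain m where "\<forall>x\<le>a. f x \<le> f m" using finite_maximum[of L a] unfolding L by fastforce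
  moreover have "P x (f x)" if "x < a" for x
    using f[of x] that Y_iff unfolding least_def W_def by auto
  ultimately show ?thesis by (intro exI[of _ "f m"]) (auto simp: le_iff)
qed


section \<open>Initial segments of binary sequences\<close>

text \<open>The code of a sequence is one less than the number whose binary digits are 1 followed by
  the sequence; an initial segment results from dropping the last \<open>k\<close> digits.\<close>

definition pre :: "'a::rca \<Rightarrow> 'a \<Rightarrow> bool" where
  "pre n t \<longleftrightarrow> (\<exists>k. (n + 1) * pw k \<le> t + 1 \<and> t + 1 < (n + 1 + 1) * pw k)"

lemma preI: "(n + 1) * pw k \<le> t + 1 \<Longrightarrow> t + 1 < (n + 1 + 1) * pw k \<Longrightarrow> pre n t"
  unfolding pre_def by blast

lemma pre_le: "pre n t \<Longrightarrow> n \<le> t"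
proof -
  assume "pre n t"
  then obtain k where k: "(n + 1) * pw k \<le> t + 1" by (auto simp: pre_def)
  have "(n + 1) * 1 \<le> (n + 1) * pw k" by (intro mult_left_mono one_le_pw) simp
  from order_trans[OF this k] have "n + 1 \<le> t + 1" by simp
  then show "n \<le> t" by simp
qed

lemma pre_bounded:
  "pre n t \<longleftrightarrow> (\<exists>k\<le>t. \<exists>p\<le>t + 1. is_pw k p \<and> (n + 1) * p \<le> t + 1 \<and> t + 1 < (n + 1 + 1) * p)"
proof
  assume "pre n t"
  then obtain k where k: "(n + 1) * pw k \<le> t + 1" "t + 1 < (n + 1 + 1) * pw k"
    by (auto simp: pre_def)
  have "pw k \<le> (n + 1) * pw k" using mult_right_mono[of 1 "n + 1" "pw k"] by simp
  with k(1) have p: "pw k \<le> t + 1" by simp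
  then have "k \<le> t" using less_le_trans[OF less_pw] less_succ_iff by blast
  with k p show "\<exists>k\<le>t. \<exists>p\<le>t + 1. is_pw k p \<and> (n + 1) * p \<le> t + 1 \<and> t + 1 < (n + 1 + 1) * p"
    unfolding is_pw_def by blast
qed (auto simp: pre_def is_pw_def)

lemma D0_pre:
  assumes "Tm f" "Tm g" shows "D0 (\<lambda>e. pre (f e) (g e :: 'a::rca))"
  unfolding pre_bounded using assms
  by (intro D0_rules D0_is_pw) (assumption | rule Tm_shift, assumption)+

text \<open>A node \<open>n\<close> is represented by n + 1, its children by 2 (n + 1) and 2 (n + 1)
  + 1. Hence the interval of \<open>n\<close> with one more digit dropped is the union of the
  intervals of its children.\<close>

lemma double_mult:
  "(n + 1) * (p * 2) = (n + n + 1 + 1) * (p :: 'a::rca)"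
  "(n + 1 + 1) * (p * 2) = (n + n + 1 + 1 + 1 + 1) * p"
  by (simp_all only: mult_2_right distrib_left distrib_right mult_1_left add_ac)

text \<open>All digits after the leading 1 are dropped: \<open>k\<close> is the largest exponent
  with 2^k at most t + 1.\<close>

lemma pre_0: "pre 0 (t :: 'a::rca)"
proof -
  let ?Y = "{k. \<exists>p\<le>t + 1. is_pw k p}"
  have Y: "?Y \<in> sets" by (rule comprehension, intro D0_rules D0_is_pw)
  have "0 \<in> ?Y" by (auto simp: is_pw_def intro!: exI[of _ 1])
  from greatest_element[OF Y this, of "t + 1"]
  obtain k where k: "k \<in> ?Y" "\<forall>j\<in>?Y. j \<le> k"
    using less_le_trans[OF less_pw, of _ "t + 1"] unfolding is_pw_def by (auto dest: less_imp_le)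
  then have "k + 1 \<notin> ?Y" using less_succ_iff[of k k] by (metis not_le order_refl)
  then have "t + 1 < pw k * 2" unfolding is_pw_def by (auto simp: not_le)
  moreover have "pw k \<le> t + 1" using k(1) by (auto simp: is_pw_def)
  ultimately show ?thesis by (intro preI[of _ k]) (simp_all add: mult.commute)
qed

lemma pre_snoc:
  assumes "pre (n + n + 1) t \<or> pre (n + n + 1 + 1) (t :: 'a::rca)" shows "pre n t"
proof -
  obtain k where k: "(n + n + 1 + 1) * pw k \<le> t + 1" "t + 1 < (n + n + 1 + 1 + 1 + 1) * pw k"
    using assms
  proof
    assume "pre (n + n + 1) t"
    then obtain k where k: "(n + n + 1 + 1) * pw k \<le> t + 1" "t + 1 < (n + n + 1 + 1 + 1) * pw k"
      unfolding pre_def by blast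
    have "(n + n + 1 + 1 + 1) * pw k \<le> (n + n + 1 + 1 + 1 + 1) * pw k"
      by (intro mult_right_mono) simp_all
    then show ?thesis using that k by (meson order_less_le_trans)
  next
    assume "pre (n + n + 1 + 1) t"
    then obtain k where k: "(n + n + 1 + 1 + 1) * pw k \<le> t + 1" "t + 1 < (n + n + 1 + 1 + 1 + 1) * pw k"
      unfolding pre_def by blast
    have "(n + n + 1 + 1) * pw k \<le> (n + n + 1 + 1 + 1) * pw k"
      by (intro mult_right_mono) simp_all
    then show ?thesis using that k by (meson order_trans)
  qed
  have "(n + 1) * pw (k + 1) = (n + n + 1 + 1) * pw k" "(n + 1 + 1) * pw (k + 1) = (n + n + 1 + 1 + 1 + 1) * pw k"
    unfolding pw_succ by (rule double_mult)+
  then show ?thesis using k by (intro preI[of n "k + 1"]) simp_all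
qed

text \<open>For n < t at least one digit was dropped, and putting back the first of them selects a
  child. Exclusiveness has to cover the possibility that the two children arise by dropping
  different numbers of digits.\<close>

lemma pre_split:
  assumes "pre n t" "n < (t :: 'a::rca)"
  shows "pre (n + n + 1) t \<longleftrightarrow> \<not> pre (n + n + 1 + 1) t"
proof -
  obtain k where k: "(n + 1) * pw k \<le> t + 1" "t + 1 < (n + 1 + 1) * pw k"
    using assms(1) unfolding pre_def by blast
  have "k \<noteq> 0"
  proof
    assume "k = 0"
    then have "t \<le> n" using k(2) by (simp add: less_succ_iff)
    then show False using assms(2) by simp
  qed
  then obtain j where "k = j + 1" by (cases k rule: succ_cases) auto
  moreover have "(n + 1) * pw (j + 1) = (n + n + 1 + 1) * pw j" "(n + 1 + 1) * pw (j + 1) = (n + n + 1 + 1 + 1 + 1) * pw j"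
    unfolding pw_succ by (rule double_mult)+
  ultimately have "pre (n + n + 1) t \<or> pre (n + n + 1 + 1) t"
    using k preI[of "n + n + 1" j t] preI[of "n + n + 1 + 1" j t] by (metis not_le)
  moreover have False if both: "pre (n + n + 1) t" "pre (n + n + 1 + 1) t"
  proof -
    obtain i where i: "(n + n + 1 + 1) * pw i \<le> t + 1" "t + 1 < (n + n + 1 + 1 + 1) * pw i"
      using both(1) unfolding pre_def by blast
    obtain j where j: "(n + n + 1 + 1 + 1) * pw j \<le> t + 1" "t + 1 < (n + n + 1 + 1 + 1 + 1) * pw j"
      using both(2) unfolding pre_def by blast
    show False
    proof (cases "i \<le> j")
      case True
      then have "(n + n + 1 + 1 + 1) * pw i \<le> (n + n + 1 + 1 + 1) * pw j"
        by (intro mult_left_mono pw_mono) simp_all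
      then show False using i(2) j(1) by simp
    next
      case False
      then have "j + 1 \<le> i" by (simp add: succ_le_iff)
      then have "pw (j + 1) \<le> pw i" by (rule pw_mono)
      then have "(n + n + 1 + 1) * (pw j * 2) \<le> (n + n + 1 + 1) * pw i"
        by (intro mult_left_mono) simp_all
      moreover have "(n + n + 1 + 1) * (pw j * 2) = (n + n + 1 + 1 + 1 + 1) * pw j + (n + n) * pw j"
        by (simp only: mult_2_right distrib_left distrib_right mult_1_left add_ac)
      ultimately have "(n + n + 1 + 1 + 1 + 1) * pw j + (n + n) * pw j \<le> (n + n + 1 + 1) * pw i"
        by simp
      then have "(n + n + 1 + 1 + 1 + 1) * pw j \<le> (n + n + 1 + 1) * pw i"
        by (rule order_trans[OF rca_le_add])
      then show False using i(1) j(2) by simp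
    qed
  qed
  ultimately show ?thesis by blast
qed

text \<open>The sequence is padded with zeros: t + 1 = (n + 1) 2^k with the least \<open>k\<close>
  that reaches d + 1. Leastness keeps \<open>t\<close> within the fixed range from d to 2 d + 1,
  over which collection can later run.\<close>

lemma ex_extension:
  assumes "n \<le> (d :: 'a::rca)"
  shows "\<exists>t. d \<le> t \<and> t \<le> d + d + 1 \<and> pre n t"
proof -
  let ?Y = "{k. \<exists>p\<le>pw (d + 1). is_pw k p \<and> d + 1 \<le> (n + 1) * p}"
  have Y: "?Y \<in> sets" by (rule comprehension, intro D0_rules D0_is_pw)
  have "d + 1 \<le> (n + 1) * pw (d + 1)"
    using less_pw[of "d + 1"] mult_right_mono[of 1 "n + 1" "pw (d + 1)"]
    by (simp add: less_imp_le del: pw_succ)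
  then have "d + 1 \<in> ?Y" by (auto simp: is_pw_def simp del: pw_succ)
  from least_element[OF Y this] obtain k where k: "k \<in> ?Y" "\<forall>j\<in>?Y. k \<le> j" by blast
  then have ge: "d + 1 \<le> (n + 1) * pw k" and k_le: "pw k \<le> pw (d + 1)" by (auto simp: is_pw_def)
  have "0 < (n + 1) * pw k" by (simp add: add_nonneg_pos)
  then obtain t where t: "(n + 1) * pw k = t + 1" by (cases "(n + 1) * pw k" rule: succ_cases) auto
  have "d \<le> t" using ge t by simp
  moreover have "t \<le> d + d + 1"
  proof (cases k rule: succ_cases)
    case 1
    then have "t = n" using t by simp
    then show ?thesis using assms by (simp add: add_increasing2 add.assoc)
  next
    case (2 j)
    then have "j \<notin> ?Y" using k(2) succ_le_iff[of j j] by auto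
    moreover have "pw j \<le> pw (d + 1)" using k_le pw_mono[of j k] 2 rca_le_add[of j 1] by (metis order_trans)
    ultimately have "(n + 1) * pw j < d + 1" by (auto simp: is_pw_def not_le simp del: pw_succ)
    then have "(n + 1) * pw j \<le> d" by (simp add: less_succ_iff)
    then have "(n + 1) * pw j + (n + 1) * pw j \<le> d + d" by (intro add_mono)
    moreover have "t + 1 = (n + 1) * pw j + (n + 1) * pw j" unfolding t[symmetric] 2 pw_succ
      by (simp only: mult_2_right distrib_left)
    ultimately have "t + 1 \<le> d + d" by simp
    then show ?thesis by (meson add_increasing2 order_trans rca_le_add zero_le_one)
  qed
  moreover have "pre n t"
    by (rule preI[of _ k]) (simp_all add: t[symmetric] distrib_right)
  ultimately show ?thesis by blast
qed

text \<open>If \<open>i\<close> and \<open>j\<close> digits are dropped from \<open>t\<close>, then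
  \<open>m\<close> arises from \<open>n\<close> by dropping i - j. The case i < j would make
  \<open>n\<close> a shorter sequence than \<open>m\<close> and hence a smaller number.\<close>

lemma pre_pre:
  assumes "pre m t" "pre n t" "m \<le> (n :: 'a::rca)"
  shows "pre m n"
proof -
  obtain i where i: "(m + 1) * pw i \<le> t + 1" "t + 1 < (m + 1 + 1) * pw i"
    using assms(1) unfolding pre_def by blast
  obtain j where j: "(n + 1) * pw j \<le> t + 1" "t + 1 < (n + 1 + 1) * pw j"
    using assms(2) unfolding pre_def by blast
  show ?thesis
  proof (cases "j \<le> i")
    case True
    then obtain k where k: "i = j + k" using le_imp_ex_add[OF True] by blast
    have "((m + 1) * pw k) * pw j < (n + 1 + 1) * pw j" using i(1) j(2) unfolding k pw_add
      by (simp add: mult.assoc mult.commute[of "pw j"])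
    then have 1: "(m + 1) * pw k < n + 1 + 1" by (rule mult_right_less_imp_less) (simp add: less_imp_le)
    have "(n + 1) * pw j < ((m + 1 + 1) * pw k) * pw j" using i(2) j(1) unfolding k pw_add
      by (simp add: mult.assoc mult.commute[of "pw j"])
    then have 2: "n + 1 < (m + 1 + 1) * pw k" by (rule mult_right_less_imp_less) (simp add: less_imp_le)
    show ?thesis using 1 2 by (intro preI[of m k]) (simp_all only: less_succ_iff)
  next
    case False
    then have "i + 1 \<le> j" by (simp add: succ_le_iff)
    have "(m + 1 + 1) * pw i \<le> (m + 1) * (pw i * 2)"
      using rca_le_add[of "(m + 1 + 1) * pw i" "m * pw i"] by (simp add: algebra_simps mult_2_right)
    also have "\<dots> \<le> (n + 1) * pw j"
      using pw_mono[OF \<open>i + 1 \<le> j\<close>] assms(3) by (intro mult_mono) simp_all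
    finally show ?thesis using i(2) j(1) by simp
  qed
qed

section \<open>Structures satisfying the characterization\<close>

lemma ex_insert: "\<exists>u. \<forall>p. digit p u \<longleftrightarrow> digit p t \<or> p = (q :: 'a::rca)"
proof -
  have Y: "{p. digit p t \<or> p = q} \<in> sets" by (rule comprehension, intro D0_rules D0_digit)
  obtain u where u: "\<forall>p. digit p u \<longleftrightarrow> p \<in> {p. digit p t \<or> p = q} \<and> p < t + q + 1"
    using ex_code[OF Y, of "t + q + 1"] by blast
  have "p < t + q + 1" if "digit p t" for p
    using less_le_trans[OF digit_less[OF that] rca_le_add[of t "q + 1"]] by (simp add: add.assoc)
  moreover have "q < t + q + 1" by (simp add: less_succ_iff)
  ultimately show ?thesis using u by (intro exI[of _ u]) auto
qed

text \<open>The sentence as read inside a model. \<open>Db\<close> is the graph of x -> 2 x + 1 only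
  in intention: \<open>Db_c\<close> and \<open>Db_f\<close> are its recursion equations, and
  \<open>Db_mono\<close> gives single values and bounds them.\<close>

locale candidate =
  fixes A F Le Db T :: "'a::rca set" and c :: 'a and f :: "'a \<Rightarrow> 'a"
  assumes sets: "A \<in> sets" "F \<in> sets" "Le \<in> sets" "Db \<in> sets" "T \<in> sets"
    and c_in: "c \<in> A" and f_in: "x \<in> A \<Longrightarrow> f x \<in> A"
    and F_iff: "pr x y \<in> F \<longleftrightarrow> x \<in> A \<and> y = f x"
    and le_refl: "x \<in> A \<Longrightarrow> pr x x \<in> Le"
    and le_trans: "x \<in> A \<Longrightarrow> y \<in> A \<Longrightarrow> z \<in> A \<Longrightarrow> pr x y \<in> Le \<Longrightarrow> pr y z \<in> Le \<Longrightarrow> pr x z \<in> Le"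
    and le_antisym: "x \<in> A \<Longrightarrow> y \<in> A \<Longrightarrow> pr x y \<in> Le \<Longrightarrow> pr y x \<in> Le \<Longrightarrow> x = y"
    and c_le: "x \<in> A \<Longrightarrow> pr c x \<in> Le"
    and le_f: "x \<in> A \<Longrightarrow> pr x (f x) \<in> Le"
    and not_f_le: "x \<in> A \<Longrightarrow> pr (f x) x \<notin> Le"
    and discrete: "x \<in> A \<Longrightarrow> y \<in> A \<Longrightarrow> pr x y \<in> Le \<or> pr (f y) x \<in> Le"
    and maximum: "L \<in> sets \<Longrightarrow> (\<And>p. p \<in> L \<Longrightarrow> \<exists>x\<in>A. \<exists>y\<in>A. p = pr x y) \<Longrightarrow>
      (\<And>x y. x \<in> A \<Longrightarrow> y \<in> A \<Longrightarrow> pr x y \<in> L \<or> pr y x \<in> L) \<Longrightarrow>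
      (\<And>x y z. x \<in> A \<Longrightarrow> y \<in> A \<Longrightarrow> z \<in> A \<Longrightarrow> pr x y \<in> L \<Longrightarrow> pr y z \<in> L \<Longrightarrow> pr x z \<in> L) \<Longrightarrow>
      y \<in> A \<Longrightarrow> \<exists>m\<in>A. pr m y \<in> Le \<and> (\<forall>x\<in>A. pr x y \<in> Le \<longrightarrow> pr x m \<in> L)"
    and Db_total: "x \<in> A \<Longrightarrow> \<exists>y\<in>A. pr x y \<in> Db"
    and Db_mono: "x \<in> A \<Longrightarrow> y \<in> A \<Longrightarrow> x' \<in> A \<Longrightarrow> y' \<in> A \<Longrightarrow> pr x y \<in> Db \<Longrightarrow> pr x' y' \<in> Db \<Longrightarrow>
      pr x x' \<in> Le \<Longrightarrow> pr y y' \<in> Le"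
    and Db_c: "pr c (f c) \<in> Db"
    and Db_f: "x \<in> A \<Longrightarrow> y \<in> A \<Longrightarrow> pr x y \<in> Db \<Longrightarrow> pr (f x) (f (f y)) \<in> Db"
    and tree: "x \<in> A \<Longrightarrow> y \<in> A \<Longrightarrow> pr x y \<in> Db \<Longrightarrow> y \<in> T \<or> f y \<in> T \<Longrightarrow> x \<in> T"
    and unbounded: "x \<in> A \<Longrightarrow> \<exists>y\<in>A. pr (f x) y \<in> Le \<and> y \<in> T"
    and no_branch: "B \<in> sets \<Longrightarrow> B \<subseteq> A \<Longrightarrow> B \<subseteq> T \<Longrightarrow> c \<in> B \<Longrightarrow>
      (\<And>x y. x \<in> A \<Longrightarrow> y \<in> A \<Longrightarrow> pr x y \<in> Db \<Longrightarrow> y \<in> B \<or> f y \<in> B \<Longrightarrow> x \<in> B) \<Longrightarrow>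
      (\<And>x y. x \<in> B \<Longrightarrow> y \<in> A \<Longrightarrow> pr x y \<in> Db \<Longrightarrow> y \<in> B \<longleftrightarrow> f y \<notin> B) \<Longrightarrow> False"
begin

text \<open>The order of the surrounding model, restricted to \<open>A\<close>, is one of the orders that have
  maxima on initial segments of \<open>Le\<close>.\<close>

lemma segment_bounded:
  assumes "y \<in> A"
  shows "\<exists>b. \<forall>x\<in>A. pr x y \<in> Le \<longrightarrow> x \<le> b"
proof -
  let ?L = "{p. \<exists>x\<le>p. \<exists>y\<le>p. p = pr x y \<and> x \<in> A \<and> y \<in> A \<and> x \<le> y}"
  have "?L \<in> sets" by (rule comprehension, intro D0_rules Tm_pr sets)
  have L: "pr x y \<in> ?L \<longleftrightarrow> x \<in> A \<and> y \<in> A \<and> x \<le> y" for x y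
    using pr_ge1[of x y] pr_ge2[of y x] by auto
  have "\<exists>m\<in>A. pr m y \<in> Le \<and> (\<forall>x\<in>A. pr x y \<in> Le \<longrightarrow> pr x m \<in> ?L)"
  proof (rule maximum[OF \<open>?L \<in> sets\<close> _ _ _ assms], unfold L)
    fix p assume "p \<in> ?L"
    then show "\<exists>x\<in>A. \<exists>y\<in>A. p = pr x y" by blast
  qed auto
  then show ?thesis unfolding L by blast
qed


text \<open>A code of a set of pairs \<open>(i, a)\<close> closed under predecessors: all its pairs satisfy
  \<open>a = f^i c\<close>.\<close>

definition trace :: "'a \<Rightarrow> bool" where
  "trace t \<longleftrightarrow> (\<forall>i\<le>t. \<forall>a\<le>t. digit (pr i a) t \<longrightarrow>
     i = 0 \<and> a = c \<or> (\<exists>j\<le>t. \<exists>b\<le>t. i = j + 1 \<and> digit (pr j b) t \<and> pr b a \<in> F))"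

lemma D0_trace: "Tm g \<Longrightarrow> D0 (\<lambda>e. trace (g e))"
  unfolding trace_def
  by (intro D0_rules D0_digit Tm_pr sets) (assumption | rule Tm_shift, assumption)+

lemma digit_pr_le:
  assumes "digit (pr i a) t" shows "i \<le> t" "a \<le> (t :: 'a)"
  using digit_less[OF assms] pr_ge1[of i a] pr_ge2[of a i] by simp_all

text \<open>The bounds in the definition only serve definability, because the components of a coded
  pair are below the code.\<close>

lemma trace_iff:
  "trace t \<longleftrightarrow> (\<forall>i a. digit (pr i a) t \<longrightarrow>
     i = 0 \<and> a = c \<or> (\<exists>j b. i = j + 1 \<and> digit (pr j b) t \<and> b \<in> A \<and> a = f b))"
  unfolding trace_def F_iff using digit_pr_le by blast

lemma traceE:
  assumes "trace t" "digit (pr i a) t"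
  obtains "i = 0" "a = c" | j b where "i = j + 1" "digit (pr j b) t" "b \<in> A" "a = f b"
  using assms unfolding trace_iff by blast

lemma trace_0:
  assumes "trace t" "digit (pr 0 a) t" shows "a = c"
  using assms(1,2) by (rule traceE) (use basic(1) in auto)

lemma trace_succ:
  assumes "trace t" "digit (pr (i + 1) a) t"
  obtains b where "digit (pr i b) t" "b \<in> A" "a = f b"
  using assms(1,2) by (rule traceE) (use basic(1)[of i] that in auto)

lemma trace_in: "trace t \<Longrightarrow> digit (pr i a) t \<Longrightarrow> a \<in> A"
  by (erule (1) traceE) (auto simp: c_in f_in)

lemma trace_unique:
  assumes "trace t" "trace u" "digit (pr i a) t" "digit (pr i b) u"
  shows "a = b"
proof -
  have "\<forall>a\<le>t. \<forall>b\<le>u. digit (pr i a) t \<longrightarrow> digit (pr i b) u \<longrightarrow> a = b"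
  proof (induct i rule: arith_induct)
    case 1 show ?case by (intro D0_rules D0_digit Tm_pr)
  next
    case 2 show ?case using trace_0 assms by blast
  next
    case (3 i)
    show ?case
    proof (intro allI impI)
      fix a b assume "digit (pr (i + 1) a) t" "digit (pr (i + 1) b) u"
      then obtain a' b' where *: "digit (pr i a') t" "a = f a'" "digit (pr i b') u" "b = f b'"
        using trace_succ assms by metis
      then have "a' = b'" using 3 digit_pr_le by blast
      then show "a = b" using * by simp
    qed
  qed
  then show ?thesis using assms(3,4) digit_pr_le by blast
qed

text \<open>Downward induction from \<open>i\<close>, run upwards on the distance
  \<open>k\<close>.\<close>

lemma trace_down:
  assumes "trace t" "digit (pr i a) t" "j \<le> i"
  shows "\<exists>b. digit (pr j b) t"
proof -
  obtain k where k: "i = j + k" using le_imp_ex_add[OF assms(3)] by blast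
  have "\<forall>j\<le>i. j + k = i \<longrightarrow> (\<exists>b\<le>t. digit (pr j b) t)"
  proof (induct k rule: arith_induct)
    case 1 show ?case by (intro D0_rules D0_digit Tm_pr)
  next
    case 2 show ?case using assms(2) digit_pr_le(2)[OF assms(2)] by auto
  next
    case (3 k)
    show ?case
    proof (intro allI impI)
      fix j assume "j + (k + 1) = i"
      then have "(j + 1) + k = i" by (simp add: add_ac)
      moreover from this have "j + 1 \<le> i" using rca_le_add by blast
      ultimately obtain b where "digit (pr (j + 1) b) t" using 3 by blast
      then obtain b' where "digit (pr j b') t" using trace_succ[OF assms(1)] by blast
      then show "\<exists>b\<le>t. digit (pr j b) t" using digit_pr_le by blast
    qed
  qed
  then show ?thesis using k assms(3) by blast
qed

text \<open>The relation a = f^i c in Sigma-1 form. Its totality in \<open>i\<close> cannot be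
  proved by induction in the base theory, and this is the source of the cut.\<close>

definition reach :: "'a \<Rightarrow> 'a \<Rightarrow> bool" where
  "reach i a \<longleftrightarrow> (\<exists>t. trace t \<and> digit (pr i a) t)"

lemma reach_in: "reach i a \<Longrightarrow> a \<in> A"
  unfolding reach_def using trace_in by blast

lemma reach_unique: "reach i a \<Longrightarrow> reach i b \<Longrightarrow> a = b"
  unfolding reach_def using trace_unique by blast

lemma reach_down: "reach i a \<Longrightarrow> j \<le> i \<Longrightarrow> \<exists>b. reach j b"
  unfolding reach_def using trace_down by blast

lemma not_digit_0: "\<not> digit p (0 :: 'a)"
  using digit_less[of p 0] by auto

lemma reach_0: "reach 0 c"
proof -
  obtain u where u: "\<forall>p. digit p u \<longleftrightarrow> digit p 0 \<or> p = pr 0 c" using ex_insert by blast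
  then have "trace u" unfolding trace_iff by (simp add: not_digit_0)
  then show ?thesis using u unfolding reach_def by blast
qed

lemma reach_succ:
  assumes "reach i a" shows "reach (i + 1) (f a)"
proof -
  obtain t where t: "trace t" "digit (pr i a) t" using assms by (auto simp: reach_def)
  obtain u where u: "\<forall>p. digit p u \<longleftrightarrow> digit p t \<or> p = pr (i + 1) (f a)" using ex_insert by blast
  have "trace u" unfolding trace_iff
  proof (intro allI impI)
    fix j b assume "digit (pr j b) u"
    then consider "digit (pr j b) t" | "j = i + 1" "b = f a" using u by auto
    then show "j = 0 \<and> b = c \<or> (\<exists>k d. j = k + 1 \<and> digit (pr k d) u \<and> d \<in> A \<and> b = f d)"
    proof cases
      case 1
      with t(1) show ?thesis by (rule traceE) (use u in auto)
    next
      case 2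
      then show ?thesis using t(2) u reach_in[OF assms] by blast
    qed
  qed
  then show ?thesis using u unfolding reach_def by blast
qed

text \<open>The induction runs inside one trace that reaches stage \<open>j\<close>: its code bounds
  all values involved, so the predicate is bounded although \<open>reach\<close> is not.\<close>

lemma reach_le:
  assumes "reach i a" "reach j b" "i \<le> j"
  shows "pr a b \<in> Le"
proof -
  obtain k where k: "j = i + k" using le_imp_ex_add[OF assms(3)] by blast
  obtain t where t: "trace t" "digit (pr j b) t" using assms(2) by (auto simp: reach_def)
  have a: "x = a" if "digit (pr i x) t" for x
    using t(1) that assms(1) reach_unique[of i x a] by (auto simp: reach_def)
  have "\<forall>x\<le>t. digit (pr (i + k) x) t \<longrightarrow> pr a x \<in> Le"
  proof (induct k rule: arith_induct)
    case 1 show ?case by (intro D0_rules D0_digit Tm_pr sets)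
  next
    case 2 show ?case using a le_refl[OF reach_in[OF assms(1)]] by auto
  next
    case (3 k)
    show ?case
    proof (intro allI impI)
      fix x assume "digit (pr (i + (k + 1)) x) t"
      then have "digit (pr ((i + k) + 1) x) t" by (simp add: add.assoc)
      with t(1) obtain y where y: "digit (pr (i + k) y) t" "y \<in> A" "x = f y" by (rule trace_succ)
      then have "pr a y \<in> Le" using 3 digit_pr_le by blast
      then show "pr a x \<in> Le"
        unfolding y(3) using le_trans[OF reach_in[OF assms(1)] y(2) f_in[OF y(2)]] le_f[OF y(2)] by blast
    qed
  qed
  then show ?thesis using t(2) k digit_pr_le by blast
qed

lemma reach_not_le:
  assumes "reach i a" "reach j b" "i < j"
  shows "pr b a \<notin> Le"
proof
  assume "pr b a \<in> Le"
  moreover have "pr (f a) b \<in> Le"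
    using reach_succ[OF assms(1)] assms(2,3) by (intro reach_le) (auto simp: succ_le_iff)
  ultimately have "pr (f a) a \<in> Le"
    using le_trans[OF f_in[OF reach_in[OF assms(1)]] reach_in[OF assms(2)] reach_in[OF assms(1)]] by blast
  then show False using not_f_le reach_in[OF assms(1)] by blast
qed

lemma reach_le_iff: "reach i a \<Longrightarrow> reach j b \<Longrightarrow> pr a b \<in> Le \<longleftrightarrow> i \<le> j"
  using reach_le reach_not_le[of j b i a] by (auto simp: not_less[symmetric])

lemma reach_inj:
  assumes "reach i a" "reach j a" shows "i = j"
  using reach_le_iff[OF assms] reach_le_iff[OF assms(2,1)] le_refl[OF reach_in[OF assms(1)]] by auto

text \<open>If every stage has a value, then a is the value at n as soon as no trace shows another
  one; this is the Pi form required for Delta-1 comprehension.\<close>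

lemma reach_set:
  assumes "\<And>n. \<exists>a. reach n a"
  shows "\<exists>H\<in>sets. \<forall>n a. pr n a \<in> H \<longleftrightarrow> reach n a"
proof -
  have "\<exists>H\<in>sets. \<forall>n a. pr n a \<in> H \<longleftrightarrow> (\<exists>t. trace t \<and> digit (pr n a) t)"
  proof (rule delta1_relation)
    show "D0 (\<lambda>e. trace (e 2) \<and> digit (pr (e 1) (e 0)) (e 2))"
      by (intro D0_rules D0_digit D0_trace Tm_pr)
    show "D0 (\<lambda>e. trace (e 2) \<longrightarrow> (\<forall>b\<le>e 2. digit (pr (e 1) b) (e 2) \<longrightarrow> b = e 0))"
      by (intro D0_rules D0_digit D0_trace Tm_pr)
    fix n a
    obtain a' where a': "reach n a'" using assms by blast
    show "(\<exists>t. trace t \<and> digit (pr n a) t) \<longleftrightarrow>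
      (\<forall>t. trace t \<longrightarrow> (\<forall>b\<le>t. digit (pr n b) t \<longrightarrow> b = a))"
    proof
      show "\<exists>t. trace t \<and> digit (pr n a) t \<Longrightarrow>
        \<forall>t. trace t \<longrightarrow> (\<forall>b\<le>t. digit (pr n b) t \<longrightarrow> b = a)"
        using trace_unique by blast
      assume *: "\<forall>t. trace t \<longrightarrow> (\<forall>b\<le>t. digit (pr n b) t \<longrightarrow> b = a)"
      then have "a' = a" using a' digit_pr_le unfolding reach_def by blast
      then show "\<exists>t. trace t \<and> digit (pr n a) t" using a' unfolding reach_def by blast
    qed
  qed
  then show ?thesis unfolding reach_def .
qed

text \<open>If the values \<open>f^n c\<close> were bounded by \<open>b\<close>, they would exist for all \<open>n\<close>, and the codes of
  \<open>{c, f c, \<dots>, f^n c}\<close> would form a strictly increasing sequence below \<open>2^(b + 1)\<close>.\<close>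

lemma not_reach_bounded: "\<exists>i a. reach i a \<and> \<not> a \<le> b"
proof (rule ccontr)
  assume "\<not> ?thesis"
  then have b: "\<And>i a. reach i a \<Longrightarrow> a \<le> b" by blast
  have total: "\<exists>a. reach N a" for N
  proof -
    \<comment> \<open>Every pair of a stage up to \<open>N\<close> and a value up to
      \<open>b\<close> has a code below \<open>K\<close>.\<close>
    define K where "K = pr N b + 1"
    have small: "\<exists>u<pw K. trace u \<and> digit (pr n a) u" if n: "reach n a" "n \<le> N" for n a
    proof -
      obtain t where t: "trace t" "digit (pr n a) t" using n(1) by (auto simp: reach_def)
      \<comment> \<open>Cutting a trace down to these pairs leaves a trace, now with a code below
        2^K. With this fixed bound, totality up to \<open>N\<close> becomes a bounded
        induction.\<close>
      let ?Y = "{p. \<exists>i\<le>N. \<exists>x\<le>b. p = pr i x \<and> digit p t}"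
      have "?Y \<in> sets" by (rule comprehension, intro D0_rules D0_digit Tm_pr)
      then obtain u where u: "u < pw K" "\<forall>p. digit p u \<longleftrightarrow> p \<in> ?Y \<and> p < K"
        using ex_code by blast
      have "pr i x < K" if "i \<le> N" "x \<le> b" for i x
        using pr_mono[OF that] by (simp add: K_def less_succ_iff)
      then have u_iff: "digit (pr i x) u \<longleftrightarrow> i \<le> N \<and> x \<le> b \<and> digit (pr i x) t" for i x
        using u(2) by auto
      have "trace u" unfolding trace_iff
      proof (intro allI impI)
        fix i x assume x: "digit (pr i x) u"
        then have "digit (pr i x) t" using u_iff by blast
        with t(1) show "i = 0 \<and> x = c \<or> (\<exists>j y. i = j + 1 \<and> digit (pr j y) u \<and> y \<in> A \<and> x = f y)"
        proof (rule traceE)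
          fix j y assume *: "i = j + 1" "digit (pr j y) t" "y \<in> A" "x = f y"
          have "y \<le> b" using b *(2) t(1) unfolding reach_def by blast
          moreover have "j \<le> N" using x u_iff *(1) order_trans[OF rca_le_add[of j 1]] by blast
          ultimately show ?thesis using * u_iff by blast
        qed simp
      qed
      moreover have "digit (pr n a) u" using u_iff n(2) t(2) b[OF n(1)] by blast
      ultimately show ?thesis using u(1) by blast
    qed
    have "N \<le> N \<longrightarrow> (\<exists>u<pw K. trace u \<and> (\<exists>a\<le>u. digit (pr N a) u))"
    proof (rule arith_induct[where x = N and P = "\<lambda>n. n \<le> N \<longrightarrow> (\<exists>u<pw K. trace u \<and> (\<exists>a\<le>u. digit (pr n a) u))"],
        intro D0_rules D0_trace D0_digit Tm_pr)
      show "0 \<le> N \<longrightarrow> (\<exists>u<pw K. trace u \<and> (\<exists>a\<le>u. digit (pr 0 a) u))"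
        using small[OF reach_0] digit_pr_le by blast
    next
      fix n assume IH: "n \<le> N \<longrightarrow> (\<exists>u<pw K. trace u \<and> (\<exists>a\<le>u. digit (pr n a) u))"
      show "n + 1 \<le> N \<longrightarrow> (\<exists>u<pw K. trace u \<and> (\<exists>a\<le>u. digit (pr (n + 1) a) u))"
      proof
        assume n: "n + 1 \<le> N"
        then have "n \<le> N" using order_trans[OF rca_le_add[of n 1]] by blast
        then obtain a where "reach n a" using IH unfolding reach_def by blast
        from small[OF reach_succ[OF this] n]
        show "\<exists>u<pw K. trace u \<and> (\<exists>a\<le>u. digit (pr (n + 1) a) u)"
          using digit_pr_le(2) by meson
      qed
    qed
    then show ?thesis unfolding reach_def by auto
  qed
  then obtain H where H: "H \<in> sets" "\<And>n a. pr n a \<in> H \<longleftrightarrow> reach n a" using reach_set by blast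
  \<comment> \<open>The code \<open>t\<close> gains the digit of a new value at each stage, hence
    grows by at least 1; its digits below b + 1 are exactly the values seen so far.\<close>
  have "\<exists>t<pw (b + 1). n \<le> t \<and> (\<forall>x\<le>b. digit x t \<longleftrightarrow> (\<exists>i\<le>n. pr i x \<in> H))" for n
  proof (induct n rule: arith_induct)
    case 1 show ?case by (intro D0_rules D0_digit Tm_pr H(1))
  next
    case 2
    have "pw c < pw (b + 1)"
      using add_pw_less[of c 0 "b + 1"] b[OF reach_0] by (simp add: not_digit_0 less_succ_iff)
    moreover have "digit x (pw c) \<longleftrightarrow> (\<exists>i\<le>0. pr i x \<in> H)" for x
      using digit_add_pw[OF not_digit_0, of x c] reach_0 reach_unique[of 0 c x]
      by (auto simp: not_digit_0 H(2))
    ultimately show ?case by (intro exI[of _ "pw c"]) simp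
  next
    case (3 n)
    then obtain t where t: "t < pw (b + 1)" "n \<le> t" "\<forall>x\<le>b. digit x t \<longleftrightarrow> (\<exists>i\<le>n. pr i x \<in> H)"
      by blast
    obtain a where a: "reach (n + 1) a" using total by blast
    have nb: "\<not> digit a t"
    proof
      assume "digit a t"
      then obtain i where "i \<le> n" "reach i a" using t(3) b[OF a] H(2) by blast
      then show False using reach_inj[OF a] succ_le_iff[of n n] by blast
    qed
    have "t + pw a < pw (b + 1)"
      using add_pw_less[OF nb _ t(1)] b[OF a] by (simp add: less_succ_iff)
    moreover have "n + 1 \<le> t + pw a" using t(2) one_le_pw by (rule add_mono)
    moreover have "digit x (t + pw a) \<longleftrightarrow> (\<exists>i\<le>n + 1. pr i x \<in> H)" if "x \<le> b" for x
    proof -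
      have "i \<le> n + 1 \<longleftrightarrow> i \<le> n \<or> i = n + 1" for i
        using less_succ_iff[of i n] by (simp add: le_iff)
      moreover have "pr (n + 1) x \<in> H \<longleftrightarrow> x = a" using H(2) a reach_unique by blast
      ultimately show ?thesis using t(3) that digit_add_pw[OF nb] by auto
    qed
    ultimately show ?case by blast
  qed
  \<comment> \<open>At stage 2^(b + 1) the code is at least its own strict upper bound.\<close>
  from this[of "pw (b + 1)"] show False by (auto simp: not_less[symmetric])
qed

text \<open>By discreteness, an element never reached lies above every f^i c, so all these values
  fall in one initial segment of \<open>Le\<close>. That segment is bounded as a set of numbers, the
  values are not.\<close>

lemma reach_surj:
  assumes y: "y \<in> A"
  shows "\<exists>i. reach i y"
proof (rule ccontr)
  assume not: "\<nexists>i. reach i y"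
  have above: "pr a y \<in> Le" if r: "reach i a" for i a
  proof -
    obtain t where t: "trace t" "digit (pr i a) t" using r by (auto simp: reach_def)
    have "\<forall>a\<le>t. digit (pr i a) t \<longrightarrow> pr a y \<in> Le"
    proof (induct i rule: arith_induct)
      case 1 show ?case by (intro D0_rules D0_digit Tm_pr sets)
    next
      case 2 show ?case using trace_0[OF t(1)] c_le[OF y] by blast
    next
      case (3 i)
      show ?case
      proof (intro allI impI)
        fix a assume "digit (pr (i + 1) a) t"
        with t(1) obtain b where b: "digit (pr i b) t" "b \<in> A" "a = f b" by (rule trace_succ)
        then have "pr b y \<in> Le" using 3 digit_pr_le by blast
        moreover have "b \<noteq> y" using not b(1) t(1) by (auto simp: reach_def)
        ultimately show "pr a y \<in> Le" using discrete[OF y b(2)] le_antisym[OF y b(2)] b(3) by blast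
      qed
    qed
    then show ?thesis using t(2) digit_pr_le by blast
  qed
  obtain b where "\<forall>x\<in>A. pr x y \<in> Le \<longrightarrow> x \<le> b" using segment_bounded[OF y] by blast
  then show False using not_reach_bounded[of b] above reach_in by blast
qed

section \<open>The cut of stages at which the iteration has a value\<close>

definition J :: "'a \<Rightarrow> bool" where "J n \<longleftrightarrow> (\<exists>a. reach n a)"

definition s :: "'a \<Rightarrow> 'a" where "s n = (THE a. reach n a)"

lemma reach_iff: "reach n a \<longleftrightarrow> J n \<and> a = s n"
  unfolding J_def s_def using reach_unique by (metis the_equality)

lemma s_in: "J n \<Longrightarrow> s n \<in> A"
  using reach_iff reach_in by blast

lemma J_0: "J 0" and s_0: "s 0 = c"
  using reach_0 reach_iff by auto

lemma J_succ: "J n \<Longrightarrow> J (n + 1)" and s_succ: "J n \<Longrightarrow> s (n + 1) = f (s n)"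
  using reach_succ reach_iff by auto

lemma J_down: "J n \<Longrightarrow> m \<le> n \<Longrightarrow> J m"
  unfolding J_def using reach_down by blast

lemma s_le_iff: "J m \<Longrightarrow> J n \<Longrightarrow> pr (s m) (s n) \<in> Le \<longleftrightarrow> m \<le> n"
  using reach_le_iff reach_iff by blast

lemma s_eq_iff: "J m \<Longrightarrow> J n \<Longrightarrow> s m = s n \<longleftrightarrow> m = n"
  using reach_inj reach_iff by auto

lemma s_surj: "a \<in> A \<Longrightarrow> \<exists>n. J n \<and> a = s n"
  using reach_surj reach_iff by blast

lemma trace_code:
  assumes "J n"
  shows "\<exists>t. trace t \<and> (\<forall>i\<le>n. \<forall>a. digit (pr i a) t \<longleftrightarrow> a = s i)"
proof -
  obtain t where t: "trace t" "digit (pr n (s n)) t" using assms reach_iff unfolding reach_def by blast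
  have "digit (pr i a) t \<longleftrightarrow> a = s i" if "i \<le> n" for i a
  proof -
    have *: "b = s i" if "digit (pr i b) t" for b using t(1) that reach_iff unfolding reach_def by blast
    obtain b where "digit (pr i b) t" using trace_down[OF t \<open>i \<le> n\<close>] by blast
    then show ?thesis using * by blast
  qed
  then show ?thesis using t(1) by blast
qed

text \<open>The \<open>Db\<close>-image of s n is some s m with \<open>m\<close> in the cut.
  Monotonicity keeps 2 i + 1 below \<open>m\<close> for all \<open>i\<close> up to \<open>n\<close>,
  so the recursion for \<open>Db\<close> can be followed inside a single trace.\<close>

lemma J_double: "J (n + n + 1)" and Db_s: "pr (s n) (s (n + n + 1)) \<in> Db" if n: "J n"
proof -
  obtain y where "y \<in> A" "pr (s n) y \<in> Db" using Db_total s_in[OF n] by blast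
  then obtain m where m: "J m" "pr (s n) (s m) \<in> Db" using s_surj by blast
  \<comment> \<open>The step from \<open>i\<close> meets stage 2 i + 3 before that is known to be at
    most \<open>m\<close>; from 2 i + 1 at most \<open>m\<close> it is at most m + 2.\<close>
  define k where "k = max n (m + 1 + 1)"
  have k: "J k" unfolding k_def max_def using n m(1) by (simp add: J_succ)
  have le: "n \<le> k" "m + 1 + 1 \<le> k" by (simp_all add: k_def)
  obtain t where t: "trace t" "\<And>i a. i \<le> k \<Longrightarrow> digit (pr i a) t \<longleftrightarrow> a = s i"
    using trace_code[OF k] by blast
  have step: "i + i + 1 \<le> m" if "i \<le> n" "J (i + i + 1)" "pr (s i) (s (i + i + 1)) \<in> Db" for i
  proof -
    have i: "J i" using n that(1) by (rule J_down)
    have "pr (s i) (s n) \<in> Le" using s_le_iff[OF i n] that(1) by blast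
    then have "pr (s (i + i + 1)) (s m) \<in> Le"
      using Db_mono[OF s_in[OF i] s_in[OF that(2)] s_in[OF n] s_in[OF m(1)] that(3) m(2)] by blast
    then show ?thesis using s_le_iff that(2) m(1) by blast
  qed
  have "n \<le> n \<longrightarrow> n + n + 1 \<le> m \<and>
    (\<exists>x\<le>t. \<exists>y\<le>t. digit (pr n x) t \<and> digit (pr (n + n + 1) y) t \<and> pr x y \<in> Db)"
  proof (rule arith_induct[where x = n and P = "\<lambda>i. i \<le> n \<longrightarrow> i + i + 1 \<le> m \<and>
      (\<exists>x\<le>t. \<exists>y\<le>t. digit (pr i x) t \<and> digit (pr (i + i + 1) y) t \<and> pr x y \<in> Db)"],
      intro D0_rules D0_digit Tm_pr sets)
    have Db: "pr (s 0) (s (0 + 0 + 1)) \<in> Db" using Db_c s_succ[OF J_0] s_0 by simp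
    have "0 + 0 + 1 \<le> m" using step[of 0] J_succ[OF J_0] Db by simp
    moreover from this have "0 + 0 + 1 \<le> k"
      using le(2) rca_le_add[of m "1 + 1"] by (metis add.assoc order_trans)
    then have "digit (pr 0 (s 0)) t" "digit (pr (0 + 0 + 1) (s (0 + 0 + 1))) t"
      using t(2)[of 0] t(2)[of "0 + 0 + 1"] by auto
    ultimately show "0 \<le> n \<longrightarrow> 0 + 0 + 1 \<le> m \<and>
      (\<exists>x\<le>t. \<exists>y\<le>t. digit (pr 0 x) t \<and> digit (pr (0 + 0 + 1) y) t \<and> pr x y \<in> Db)"
      using Db digit_pr_le(2) by blast
  next
    fix i assume IH: "i \<le> n \<longrightarrow> i + i + 1 \<le> m \<and>
      (\<exists>x\<le>t. \<exists>y\<le>t. digit (pr i x) t \<and> digit (pr (i + i + 1) y) t \<and> pr x y \<in> Db)"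
    show "i + 1 \<le> n \<longrightarrow> (i + 1) + (i + 1) + 1 \<le> m \<and>
      (\<exists>x\<le>t. \<exists>y\<le>t. digit (pr (i + 1) x) t \<and> digit (pr ((i + 1) + (i + 1) + 1) y) t \<and> pr x y \<in> Db)"
    proof
      assume i: "i + 1 \<le> n"
      then have i': "i \<le> n" by (rule order_trans[OF rca_le_add])
      then obtain x y where *: "i + i + 1 \<le> m" "digit (pr i x) t" "digit (pr (i + i + 1) y) t" "pr x y \<in> Db"
        using IH by blast
      have eq: "(i + 1) + (i + 1) + 1 = (i + i + 1) + 1 + 1" by (simp add: add_ac)
      have le_k: "(i + 1) + (i + 1) + 1 \<le> k" "i + i + 1 \<le> k" "i \<le> k" "i + 1 \<le> k"
      proof -
        have "(i + i + 1) + 1 + 1 \<le> m + 1 + 1" using *(1) by (intro add_right_mono)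
        then show "(i + 1) + (i + 1) + 1 \<le> k" unfolding eq using le(2) by (rule order_trans)
        moreover have "i + i + 1 \<le> (i + i + 1) + 1 + 1"
          by (simp only: add.assoc[of "i + i + 1"] rca_le_add)
        ultimately show "i + i + 1 \<le> k" unfolding eq by (metis order_trans)
        show "i \<le> k" using i' le(1) by (rule order_trans)
        show "i + 1 \<le> k" using i le(1) by (rule order_trans)
      qed
      have J: "J i" "J (i + i + 1)" "J (i + 1)" "J ((i + 1) + (i + 1) + 1)"
        using J_down[OF k] le_k by blast+
      have "x = s i" "y = s (i + i + 1)" using t(2) le_k * by blast+
      then have "pr (f (s i)) (f (f (s (i + i + 1)))) \<in> Db"
        using Db_f[OF s_in[OF J(1)] s_in[OF J(2)]] *(4) by blast
      then have Db: "pr (s (i + 1)) (s ((i + 1) + (i + 1) + 1)) \<in> Db"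
        unfolding eq using s_succ[OF J(1)] s_succ[OF J(2)] s_succ[OF J_succ[OF J(2)]] by simp
      have "(i + 1) + (i + 1) + 1 \<le> m" using step[OF i J(4) Db] .
      moreover have "digit (pr (i + 1) (s (i + 1))) t"
        "digit (pr ((i + 1) + (i + 1) + 1) (s ((i + 1) + (i + 1) + 1))) t"
        using t(2) le_k by blast+
      ultimately show "(i + 1) + (i + 1) + 1 \<le> m \<and>
        (\<exists>x\<le>t. \<exists>y\<le>t. digit (pr (i + 1) x) t \<and> digit (pr ((i + 1) + (i + 1) + 1) y) t \<and> pr x y \<in> Db)"
        using Db digit_pr_le(2) by blast
    qed
  qed
  then obtain x y where *: "n + n + 1 \<le> m" "digit (pr n x) t" "digit (pr (n + n + 1) y) t" "pr x y \<in> Db"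
    by blast
  show J: "J (n + n + 1)" using J_down[OF m(1) *(1)] .
  have "n + n + 1 \<le> k" using *(1) le(2) rca_le_add[of m "1 + 1"] by (metis add.assoc order_trans)
  then have "x = s n" "y = s (n + n + 1)" using t(2) le(1) * by blast+
  then show "pr (s n) (s (n + n + 1)) \<in> Db" using *(4) by simp
qed

text \<open>Monotonicity, used in both directions at the same argument, together with antisymmetry
  makes \<open>Db\<close> single-valued.\<close>

lemma Db_s_iff:
  assumes "J n" "y \<in> A"
  shows "pr (s n) y \<in> Db \<longleftrightarrow> y = s (n + n + 1)"
proof
  note n = s_in[OF assms(1)] and d = s_in[OF J_double[OF assms(1)]]
  assume "pr (s n) y \<in> Db"
  then show "y = s (n + n + 1)"
    using Db_mono[OF n assms(2) n d _ Db_s[OF assms(1)] le_refl[OF n]]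
      Db_mono[OF n d n assms(2) Db_s[OF assms(1)] _ le_refl[OF n]] le_antisym[OF assms(2) d] by blast
qed (use Db_s[OF assms(1)] in simp)

lemma f_double: "J n \<Longrightarrow> f (s (n + n + 1)) = s (n + n + 1 + 1)"
  using s_succ[OF J_double] by simp

lemma tree_s:
  assumes "J n" "s (n + n + 1) \<in> T \<or> s (n + n + 1 + 1) \<in> T" shows "s n \<in> T"
  using tree[OF s_in[OF assms(1)] s_in[OF J_double[OF assms(1)]] Db_s[OF assms(1)]] assms(2)
    f_double[OF assms(1)] by simp

text \<open>A trace up to \<open>k\<close> makes the initial segments of \<open>k\<close> outside
  the tree a set. At the greatest of them, the child towards \<open>k\<close> is in the tree by
  maximality, and closure under predecessors gives a contradiction.\<close>

lemma pre_in_T: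
  assumes k: "J k" "s k \<in> T" and n: "pre n k"
  shows "s n \<in> T"
proof (rule ccontr)
  assume not: "s n \<notin> T"
  obtain t where t: "trace t" "\<And>i a. i \<le> k \<Longrightarrow> digit (pr i a) t \<longleftrightarrow> a = s i"
    using trace_code[OF k(1)] by blast
  let ?Y = "{n. pre n k \<and> (\<exists>x\<le>t. digit (pr n x) t \<and> x \<notin> T)}"
  have Y_set: "?Y \<in> sets" by (rule comprehension, intro D0_rules D0_pre D0_digit Tm_pr sets)
  have Y: "m \<in> ?Y \<longleftrightarrow> pre m k \<and> s m \<notin> T" for m
  proof
    assume "m \<in> ?Y"
    then show "pre m k \<and> s m \<notin> T" using t(2)[OF pre_le[of m k]] by auto
  next
    assume m: "pre m k \<and> s m \<notin> T"
    then have "digit (pr m (s m)) t" using t(2)[OF pre_le[of m k]] by blast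
    then show "m \<in> ?Y" using m digit_pr_le(2) by blast
  qed
  have "n \<in> ?Y" unfolding Y using n not by blast
  moreover have "m \<le> k" if "m \<in> ?Y" for m using that pre_le by blast
  ultimately obtain m where m: "m \<in> ?Y" "\<And>i. i \<in> ?Y \<Longrightarrow> i \<le> m"
    using greatest_element[OF Y_set] by meson
  have mk: "pre m k" "s m \<notin> T" using m(1) Y by blast+
  then have "m < k" using pre_le[of m k] k(2) by (auto simp: le_iff)
  have J: "J m" using J_down[OF k(1)] pre_le[OF mk(1)] by blast
  have "m < m + m + 1" "m < m + m + 1 + 1"
    by (simp_all add: less_succ_iff add.assoc add_nonneg_pos)
  then have "m + m + 1 \<notin> ?Y" "m + m + 1 + 1 \<notin> ?Y" using m(2) by (auto simp only: not_le[symmetric])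
  then have "s (m + m + 1) \<in> T \<or> s (m + m + 1 + 1) \<in> T"
    using pre_split[OF mk(1) \<open>m < k\<close>] unfolding Y by blast
  then show False using tree_s[OF J] mk(2) by blast
qed

text \<open>A number beyond the proper cut \<open>J\<close> all of whose initial segments in \<open>J\<close> are nodes of the
  tree. Otherwise collection bounds the stage at which all codes in \<open>{d..2 d + 1}\<close> are refuted, in
  contradiction to a node of the tree beyond that stage, padded to such a code.\<close>

lemma ex_long_node:
  assumes d: "\<not> J d"
  shows "\<exists>t\<ge>d. \<forall>n. pre n t \<longrightarrow> J n \<longrightarrow> s n \<in> T"
proof (rule ccontr)
  assume "\<not> ?thesis"
  then have bad: "\<exists>n. pre n t \<and> J n \<and> s n \<notin> T" if "d \<le> t" for t using that by blast
  have less_d: "n < d" if "J n" for n using d J_down[OF that, of d] not_less by blast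
  \<comment> \<open>The witness bounds both the node refuting d + x and a trace that evaluates this
    node in \<open>A\<close>.\<close>
  define P where "P x z \<longleftrightarrow> (\<exists>n\<le>z. \<exists>t\<le>z. \<exists>a\<le>t. pre n (d + x) \<and> trace t \<and> digit (pr n a) t \<and> a \<notin> T)"
    for x z
  \<comment> \<open>The range below d + 2 covers exactly the codes from d to 2 d + 1.\<close>
  have "\<exists>b. \<forall>x<d + 1 + 1. \<exists>y\<le>b. P x y"
  proof (rule collection)
    show "D0 (\<lambda>e. P (e 1) (e 0))"
      unfolding P_def by (intro D0_rules D0_pre D0_trace D0_digit Tm_pr sets)
    fix x
    obtain n where n: "pre n (d + x)" "J n" "s n \<notin> T" using bad[OF rca_le_add] by blast
    then obtain t where t: "trace t" "digit (pr n (s n)) t" using reach_iff unfolding reach_def by blast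
    then have "P x t" unfolding P_def using n digit_pr_le[OF t(2)] by blast
    then show "\<exists>y. P x y" by blast
  qed
  then obtain b where b: "\<And>x. x < d + 1 + 1 \<Longrightarrow> \<exists>y\<le>b. P x y" by blast
  \<comment> \<open>The stages visible in traces up to \<open>b\<close>. Unlike the cut itself they
    form a set, and being below \<open>d\<close> they have a maximum.\<close>
  let ?Y = "{n. \<exists>t\<le>b. \<exists>a\<le>t. trace t \<and> digit (pr n a) t}"
  have Y: "?Y \<in> sets" by (rule comprehension, intro D0_rules D0_trace D0_digit Tm_pr)
  have Y_J: "J n" if "n \<in> ?Y" for n using that unfolding J_def reach_def by blast
  have node: "\<exists>n\<in>?Y. pre n (d + x) \<and> s n \<notin> T" if x: "x < d + 1 + 1" for x
  proof -
    obtain y where "y \<le> b" "P x y" using b[OF x] by blast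
    then obtain n t a where n: "t \<le> y" "a \<le> t" "pre n (d + x)" "trace t" "digit (pr n a) t" "a \<notin> T"
      unfolding P_def by blast
    then have "n \<in> ?Y" using order_trans[OF n(1) \<open>y \<le> b\<close>] by blast
    moreover have "a = s n" using n reach_iff unfolding reach_def by blast
    ultimately show ?thesis using n by blast
  qed
  have "0 < d + 1 + 1" using less_d[OF J_0] by (simp add: add_pos_pos)
  then obtain n0 where "n0 \<in> ?Y" using node by blast
  moreover have "n \<le> d" if "n \<in> ?Y" for n using less_d[OF Y_J[OF that]] by simp
  ultimately obtain j where j: "j \<in> ?Y" "\<And>i. i \<in> ?Y \<Longrightarrow> i \<le> j" using greatest_element[OF Y] by meson
  obtain y where y: "y \<in> A" "pr (f (s j)) y \<in> Le" "y \<in> T" using unbounded s_in[OF Y_J[OF j(1)]] by blast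
  then obtain k where k: "J k" "y = s k" using s_surj by blast
  have "j + 1 \<le> k" using y(2) k s_le_iff[OF J_succ[OF Y_J[OF j(1)]] k(1)] s_succ[OF Y_J[OF j(1)]] by simp
  then have "j < k" by (simp add: succ_le_iff)
  \<comment> \<open>The padded code is refuted at a stage of \<open>?Y\<close>, which is below
    \<open>k\<close>. The refuting node is then an initial segment of the tree node
    \<open>k\<close>, hence in the tree.\<close>
  obtain t where t: "d \<le> t" "t \<le> d + d + 1" "pre k t" using ex_extension less_imp_le[OF less_d[OF k(1)]] by blast
  then obtain x where x: "t = d + x" using le_imp_ex_add by blast
  then have "d + x \<le> d + (d + 1)" using t(2) by (simp add: add.assoc)
  then have "x < d + 1 + 1" by (simp add: less_succ_iff)
  then obtain n where n: "n \<in> ?Y" "pre n t" "s n \<notin> T" using node x by blast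
  have "n \<le> k" using j(2)[OF n(1)] \<open>j < k\<close> by simp
  then have "pre n k" using pre_pre n(2) t(3) by blast
  then show False using pre_in_T k y(3) n(3) by blast
qed

text \<open>The initial segments of the long code \<open>t\<close> at stages of the cut never stop
  within it: the cut is closed under doubling and \<open>t\<close> lies beyond it, so each has
  exactly one child of the same kind. The remaining point is that they form a set.\<close>

lemma J_total: "J d"
proof (rule ccontr)
  assume d: "\<not> J d"
  have less_d: "n < d" if "J n" for n using d J_down[OF that, of d] not_less by blast
  obtain t where t: "d \<le> t" "\<And>n. pre n t \<Longrightarrow> J n \<Longrightarrow> s n \<in> T" using ex_long_node[OF d] by blast
  define P where "P z a \<longleftrightarrow> (\<exists>n\<le>z. pre n t \<and> trace z \<and> digit (pr n a) z)" for z a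
  \<comment> \<open>Each element of \<open>A\<close> is reached at exactly one stage, so testing all
    traces gives a Pi form of the same set.\<close>
  define Q where "Q z a \<longleftrightarrow> a \<in> A \<and> (\<forall>n\<le>z. trace z \<longrightarrow> digit (pr n a) z \<longrightarrow> pre n t)" for z a
  have P: "(\<exists>z. P z a) \<longleftrightarrow> (\<exists>n. pre n t \<and> reach n a)" for a
    unfolding P_def reach_def using digit_pr_le(1) by blast
  have Q: "(\<forall>z. Q z a) \<longleftrightarrow> a \<in> A \<and> (\<forall>n. reach n a \<longrightarrow> pre n t)" for a
    unfolding Q_def reach_def using digit_pr_le(1) by blast
  define B where "B = {a. \<exists>z. P z a}"
  have "B \<in> sets" unfolding B_def
  proof (rule delta1_comprehension)
    show "D0 (\<lambda>e. P (e 0) (e 1))" unfolding P_def by (intro D0_rules D0_pre D0_trace D0_digit Tm_pr)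
    show "D0 (\<lambda>e. Q (e 0) (e 1))" unfolding Q_def by (intro D0_rules D0_pre D0_trace D0_digit Tm_pr sets)
    show "(\<exists>z. P z a) \<longleftrightarrow> (\<forall>z. Q z a)" for a
      unfolding P Q using reach_in reach_surj reach_inj by blast
  qed
  have B: "a \<in> B \<longleftrightarrow> (\<exists>n. pre n t \<and> J n \<and> a = s n)" for a unfolding B_def mem_Collect_eq P reach_iff ..
  have B_s: "s n \<in> B \<longleftrightarrow> pre n t" if "J n" for n unfolding B using that s_eq_iff by blast
  show False
  proof (rule no_branch[OF \<open>B \<in> sets\<close>])
    show "B \<subseteq> A" using B s_in by auto
    show "B \<subseteq> T" using B t(2) by auto
    show "c \<in> B" using B_s[OF J_0] pre_0 s_0 by simp
  next
    fix x y assume *: "x \<in> A" "y \<in> A" "pr x y \<in> Db" "y \<in> B \<or> f y \<in> B"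
    obtain n where n: "J n" "x = s n" using s_surj[OF *(1)] by blast
    then have "y = s (n + n + 1)" using Db_s_iff *(2,3) by blast
    then have "pre (n + n + 1) t \<or> pre (n + n + 1 + 1) t"
      using *(4) B_s J_double[OF n(1)] J_succ f_double[OF n(1)] by simp
    then show "x \<in> B" using pre_snoc B_s n by blast
  next
    fix x y assume *: "x \<in> B" "y \<in> A" "pr x y \<in> Db"
    obtain n where n: "J n" "x = s n" "pre n t" using *(1) B by blast
    then have y: "y = s (n + n + 1)" using Db_s_iff *(2,3) by blast
    have "n < t" using less_d[OF n(1)] t(1) by simp
    from pre_split[OF n(3) this] show "y \<in> B \<longleftrightarrow> f y \<notin> B"
      unfolding y f_double[OF n(1)] B_s[OF J_double[OF n(1)]] B_s[OF J_succ[OF J_double[OF n(1)]]] .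
  qed
qed

theorem ex_isomorphism:
  "\<exists>H\<in>sets. (\<forall>n a. pr n a \<in> H \<longleftrightarrow> a = s n) \<and> bij_betw s UNIV A \<and> s 0 = c \<and> (\<forall>n. s (n + 1) = f (s n))"
proof -
  have "inj s" using s_eq_iff[OF J_total J_total] by (auto intro: injI)
  moreover have "range s = A" using s_surj s_in[OF J_total] by blast
  ultimately have "bij_betw s UNIV A" unfolding bij_betw_def by blast
  moreover have "\<exists>a. reach n a" for n using J_total[of n] unfolding J_def .
  then obtain H where "H \<in> sets" "\<forall>n a. pr n a \<in> H \<longleftrightarrow> a = s n"
    using reach_set J_total unfolding reach_iff by auto
  ultimately show ?thesis using s_0 s_succ[OF J_total] by blast
qed

end

section \<open>Semantics of the second-order language\<close>

primrec sval :: "('a \<Rightarrow> 'a) \<Rightarrow> 'a \<Rightarrow> (nat \<Rightarrow> 'a) \<Rightarrow> stm \<Rightarrow> 'a" where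
  "sval f c el (SVar i) = el i"
| "sval f c el SConst = c"
| "sval f c el (SFun t) = f (sval f c el t)"

fun tuple :: "'a::rca list \<Rightarrow> 'a" where
  "tuple [] = 0"
| "tuple [x] = x"
| "tuple (x # xs) = pr x (tuple xs)"

fun is_tuple :: "'a::rca set \<Rightarrow> nat \<Rightarrow> 'a \<Rightarrow> bool" where
  "is_tuple A 0 p \<longleftrightarrow> p = 0"
| "is_tuple A (Suc 0) p \<longleftrightarrow> p \<in> A"
| "is_tuple A (Suc (Suc k)) p \<longleftrightarrow> (\<exists>x\<in>A. \<exists>q. is_tuple A (Suc k) q \<and> p = pr x q)"

text \<open>Evaluates directly with a function \<open>f\<close> and elements instead of a graph and
  number terms, so that the sentence becomes an ordinary statement about the model.\<close>

primrec ssat :: "'a::rca set \<Rightarrow> ('a \<Rightarrow> 'a) \<Rightarrow> 'a \<Rightarrow> (nat \<Rightarrow> 'a) \<Rightarrow> (nat \<Rightarrow> 'a set) \<Rightarrow> sfm \<Rightarrow> bool" where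
  "ssat A f c el R (SEq s t) \<longleftrightarrow> sval f c el s = sval f c el t"
| "ssat A f c el R (SRel i ts) \<longleftrightarrow> tuple (map (sval f c el) ts) \<in> R i"
| "ssat A f c el R (SNeg \<phi>) \<longleftrightarrow> \<not> ssat A f c el R \<phi>"
| "ssat A f c el R (SAnd \<phi> \<psi>) \<longleftrightarrow> ssat A f c el R \<phi> \<and> ssat A f c el R \<psi>"
| "ssat A f c el R (SOr \<phi> \<psi>) \<longleftrightarrow> ssat A f c el R \<phi> \<or> ssat A f c el R \<psi>"
| "ssat A f c el R (SImp \<phi> \<psi>) \<longleftrightarrow> (ssat A f c el R \<phi> \<longrightarrow> ssat A f c el R \<psi>)"
| "ssat A f c el R (SForall \<phi>) \<longleftrightarrow> (\<forall>x\<in>A. ssat A f c (case_nat x el) R \<phi>)"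
| "ssat A f c el R (SExists \<phi>) \<longleftrightarrow> (\<exists>x\<in>A. ssat A f c (case_nat x el) R \<phi>)"
| "ssat A f c el R (SForall2 k \<phi>) \<longleftrightarrow>
     (\<forall>Y\<in>sets. (\<forall>p\<in>Y. is_tuple A k p) \<longrightarrow> ssat A f c el (case_nat Y R) \<phi>)"
| "ssat A f c el R (SExists2 k \<phi>) \<longleftrightarrow>
     (\<exists>Y\<in>sets. (\<forall>p\<in>Y. is_tuple A k p) \<and> ssat A f c el (case_nat Y R) \<phi>)"

definition is_graph :: "'a::rca set \<Rightarrow> ('a \<Rightarrow> 'a) \<Rightarrow> 'a set \<Rightarrow> bool" where
  "is_graph A f F \<longleftrightarrow> (\<forall>x\<in>A. f x \<in> A \<and> (\<forall>y. pr x y \<in> F \<longleftrightarrow> y = f x))"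

lemma sval_in:
  "stm_wf n t \<Longrightarrow> is_graph A f F \<Longrightarrow> c \<in> A \<Longrightarrow> (\<And>i. i < n \<Longrightarrow> el i \<in> A) \<Longrightarrow> sval f c el t \<in> A"
  by (induction t) (auto simp: is_graph_def)

text \<open>Well-formedness keeps all intermediate values in \<open>A\<close>; elsewhere the graph
  need not agree with \<open>f\<close>.\<close>

lemma fval_value:
  assumes "stm_wf n t" "is_graph A f (S F)" "tval E c \<in> A" "\<And>i. i < n \<Longrightarrow> tval E (e i) \<in> A"
  shows "fval E S (value_fm F c e t y) \<longleftrightarrow> tval E y = sval f (tval E c) (\<lambda>i. tval E (e i)) t"
  using assms
proof (induction t arbitrary: E c e y)
  case (SFun t)
  have "sval f (tval E c) (\<lambda>i. tval E (e i)) t \<in> A"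
    using SFun.prems by (intro sval_in) auto
  then show ?case using SFun by (auto simp: is_graph_def)
qed auto

lemma fval_values:
  assumes "\<forall>t\<in>set ts. stm_wf n t" "is_graph A f (S F)" "tval E c \<in> A" "\<And>i. i < n \<Longrightarrow> tval E (e i) \<in> A"
  shows "fval E S (values_fm F c e ts p) \<longleftrightarrow>
    tval E p = tuple (map (sval f (tval E c) (\<lambda>i. tval E (e i))) ts)"
  using assms
proof (induction F c e ts p arbitrary: E rule: values_fm.induct)
  case (2 F c e t p)
  then show ?case using fval_value[of n t A f S F E c e p] by simp
next
  case (3 F c e t t' ts p)
  let ?E = "\<lambda>y x. case_nat y (case_nat x E)"
  have "fval (?E y x) S (value_fm F (lift (lift c)) (\<lambda>n. lift (lift (e n))) t (NVar 1)) \<longleftrightarrow>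
      x = sval f (tval E c) (\<lambda>i. tval E (e i)) t" for x y
    using 3 by (subst fval_value[of n t A f]) auto
  moreover have "fval (?E y x) S (values_fm F (lift (lift c)) (\<lambda>n. lift (lift (e n))) (t' # ts) (NVar 0)) \<longleftrightarrow>
      y = tuple (map (sval f (tval E c) (\<lambda>i. tval E (e i))) (t' # ts))" for x y
    using 3 by (subst "3.IH"[OF refl refl]) auto
  ultimately show ?case by (simp add: Let_def)
qed simp

lemma fval_power: "fval E S (power_fm A k p) \<longleftrightarrow> is_tuple (S A) k (tval E p)"
  by (induction A k p arbitrary: E rule: power_fm.induct) auto

lemma fval_sat:
  assumes "sfm_wf n ks \<phi>" "is_graph (S A) f (S F)" "tval E c \<in> S A" "\<And>i. i < n \<Longrightarrow> tval E (e i) \<in> S A"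
  shows "fval E S (sat_fm A F c e r \<phi>) \<longleftrightarrow>
    ssat (S A) f (tval E c) (\<lambda>i. tval E (e i)) (\<lambda>i. S (r i)) \<phi>"
  using assms
proof (induction \<phi> arbitrary: n ks E S A F c e r)
  case (SEq s t)
  then show ?case by (simp add: fval_value[where n = n and A = "S A" and f = f])
next
  case (SRel i ts)
  then show ?case by (simp add: fval_values[where n = n and A = "S A" and f = f])
next
  case (SForall \<phi>)
  have "(\<lambda>i. tval (case_nat x E) (env_cons e i)) = case_nat x (\<lambda>i. tval E (e i))" for x
    by (rule ext) (auto split: nat.splits)
  moreover have "tval (case_nat x E) (env_cons e i) \<in> S A" if "x \<in> S A" "i < Suc n" for x i
    using SForall.prems that by (auto split: nat.splits)
  ultimately show ?case using SForall.prems
    by (simp add: SForall.IH[where n = "Suc n" and ks = ks] Ball_def)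
next
  case (SExists \<phi>)
  have "(\<lambda>i. tval (case_nat x E) (env_cons e i)) = case_nat x (\<lambda>i. tval E (e i))" for x
    by (rule ext) (auto split: nat.splits)
  moreover have "tval (case_nat x E) (env_cons e i) \<in> S A" if "x \<in> S A" "i < Suc n" for x i
    using SExists.prems that by (auto split: nat.splits)
  ultimately show ?case using SExists.prems
    by (auto simp: SExists.IH[where n = "Suc n" and ks = ks])
next
  case (SForall2 k \<phi>)
  have "(\<lambda>i. case_nat Y S (case_nat 0 (\<lambda>i. Suc (r i)) i)) = case_nat Y (\<lambda>i. S (r i))" for Y
    by (rule ext) (auto split: nat.splits)
  then show ?case using SForall2.prems
    by (simp add: SForall2.IH[where n = n and ks = "k # ks"] relation_fm_def fval_power Ball_def)
next
  case (SExists2 k \<phi>)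
  have "(\<lambda>i. case_nat Y S (case_nat 0 (\<lambda>i. Suc (r i)) i)) = case_nat Y (\<lambda>i. S (r i))" for Y
    by (rule ext) (auto split: nat.splits)
  then show ?case using SExists2.prems
    by (simp add: SExists2.IH[where n = n and ks = "k # ks"] relation_fm_def fval_power Ball_def Bex_def)
qed auto

lemma fval_models:
  assumes "sentence \<psi>" "is_graph (S A) f (S F)" "tval E c \<in> S A"
  shows "fval E S (models_fm A F c \<psi>) \<longleftrightarrow> ssat (S A) f (tval E c) E S \<psi>"
  unfolding models_fm_def using fval_sat[where n = 0 and e = NVar and r = "\<lambda>i. i"] assms
  by (simp add: sentence_def)


section \<open>The categorical sentence\<close>

text \<open>Under its quantifiers the relation variables \<open>0, \<dots>, 4\<close> are: a candidate branch, a candidate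
  linear preorder, the tree, the graph of \<open>x \<mapsto> 2 x + 1\<close>, and the order. The tree lives on
  the codes of binary sequences used in \<open>WKL\<close>, which are computed from \<open>x \<mapsto> 2 x + 1\<close> and \<open>f\<close>.\<close>

abbreviation "B_at x \<equiv> SRel 0 [x]"
abbreviation "L_at x y \<equiv> SRel 1 [x, y]"
abbreviation "T_at x \<equiv> SRel 2 [x]"
abbreviation "Db_at x y \<equiv> SRel 3 [x, y]"
abbreviation "Le_at x y \<equiv> SRel 4 [x, y]"

definition order_sfm :: sfm where
  "order_sfm =
    SAnd (SForall (Le_at (SVar 0) (SVar 0)))
   (SAnd (SForall (SForall (SForall (SImp
      (SAnd (Le_at (SVar 2) (SVar 1)) (Le_at (SVar 1) (SVar 0))) (Le_at (SVar 2) (SVar 0))))))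
   (SAnd (SForall (SForall (SImp
      (SAnd (Le_at (SVar 1) (SVar 0)) (Le_at (SVar 0) (SVar 1))) (SEq (SVar 1) (SVar 0)))))
   (SAnd (SForall (Le_at SConst (SVar 0)))
   (SAnd (SForall (Le_at (SVar 0) (SFun (SVar 0))))
   (SAnd (SForall (SNeg (Le_at (SFun (SVar 0)) (SVar 0))))
         (SForall (SForall (SOr (Le_at (SVar 1) (SVar 0)) (Le_at (SFun (SVar 0)) (SVar 1))))))))))"

definition maximum_sfm :: sfm where
  "maximum_sfm =
    SImp (SAnd (SForall (SForall (SOr (L_at (SVar 1) (SVar 0)) (L_at (SVar 0) (SVar 1)))))
      (SForall (SForall (SForall (SImp
        (SAnd (L_at (SVar 2) (SVar 1)) (L_at (SVar 1) (SVar 0))) (L_at (SVar 2) (SVar 0)))))))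
   (SForall (SExists (SAnd (Le_at (SVar 0) (SVar 1))
      (SForall (SImp (Le_at (SVar 0) (SVar 2)) (L_at (SVar 0) (SVar 1)))))))"

definition double_sfm :: sfm where
  "double_sfm =
    SAnd (SForall (SExists (Db_at (SVar 1) (SVar 0))))
   (SAnd (SForall (SForall (SForall (SForall (SImp
      (SAnd (Db_at (SVar 3) (SVar 2)) (SAnd (Db_at (SVar 1) (SVar 0)) (Le_at (SVar 3) (SVar 1))))
      (Le_at (SVar 2) (SVar 0)))))))
   (SAnd (Db_at SConst (SFun SConst))
         (SForall (SForall (SImp (Db_at (SVar 1) (SVar 0))
           (Db_at (SFun (SVar 1)) (SFun (SFun (SVar 0)))))))))"

definition tree_sfm :: sfm where
  "tree_sfm =
    SAnd (SForall (SForall (SImp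
      (SAnd (Db_at (SVar 1) (SVar 0)) (SOr (T_at (SVar 0)) (T_at (SFun (SVar 0))))) (T_at (SVar 1)))))
         (SForall (SExists (SAnd (Le_at (SFun (SVar 1)) (SVar 0)) (T_at (SVar 0)))))"

definition no_branch_sfm :: sfm where
  "no_branch_sfm = SNeg (
    SAnd (SForall (SImp (B_at (SVar 0)) (T_at (SVar 0))))
   (SAnd (B_at SConst)
   (SAnd (SForall (SForall (SImp
      (SAnd (Db_at (SVar 1) (SVar 0)) (SOr (B_at (SVar 0)) (B_at (SFun (SVar 0))))) (B_at (SVar 1)))))
         (SForall (SForall (SImp (SAnd (B_at (SVar 1)) (Db_at (SVar 1) (SVar 0)))
            (SAnd (SImp (B_at (SVar 0)) (SNeg (B_at (SFun (SVar 0)))))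
                  (SImp (SNeg (B_at (SFun (SVar 0)))) (B_at (SVar 0))))))))))"

text \<open>The lists hold arities: order, doubling graph and tree are existential, preorder and
  branch universal. The last two share one block, since each is mentioned in only one
  conjunct.\<close>

definition nat_sentence :: sfm where
  "nat_sentence = foldr SExists2 [2, 2, 1] (foldr SForall2 [2, 1]
    (SAnd order_sfm (SAnd maximum_sfm (SAnd double_sfm (SAnd tree_sfm no_branch_sfm)))))"

lemmas nat_sentence_defs =
  nat_sentence_def order_sfm_def maximum_sfm_def double_sfm_def tree_sfm_def no_branch_sfm_def

lemma sentence_nat_sentence: "sentence nat_sentence"
  by (simp add: sentence_def nat_sentence_defs eval_nat_numeral)

lemma Sigma12_nat_sentence: "Sigma12 nat_sentence"
proof -
  have "first_order (SAnd order_sfm (SAnd maximum_sfm (SAnd double_sfm (SAnd tree_sfm no_branch_sfm))))"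
    by (simp add: nat_sentence_defs)
  then show ?thesis unfolding Sigma12_def nat_sentence_def by blast
qed

lemma is_tuple_1: "is_tuple A 1 p \<longleftrightarrow> p \<in> A"
  by simp

lemma is_tuple_2: "is_tuple A 2 p \<longleftrightarrow> (\<exists>x\<in>A. \<exists>y\<in>A. p = pr x y)"
  by (auto simp: numeral_2_eq_2)

definition nat_matrix ::
  "'a::rca set \<Rightarrow> ('a \<Rightarrow> 'a) \<Rightarrow> 'a \<Rightarrow> 'a set \<Rightarrow> 'a set \<Rightarrow> 'a set \<Rightarrow> 'a set \<Rightarrow> 'a set \<Rightarrow> bool" where
  "nat_matrix A f c Le Db T L B \<longleftrightarrow>
      ((\<forall>x\<in>A. pr x x \<in> Le) \<and>
       (\<forall>x\<in>A. \<forall>y\<in>A. \<forall>z\<in>A. pr x y \<in> Le \<and> pr y z \<in> Le \<longrightarrow> pr x z \<in> Le) \<and>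
       (\<forall>x\<in>A. \<forall>y\<in>A. pr x y \<in> Le \<and> pr y x \<in> Le \<longrightarrow> x = y) \<and>
       (\<forall>x\<in>A. pr c x \<in> Le) \<and> (\<forall>x\<in>A. pr x (f x) \<in> Le) \<and> (\<forall>x\<in>A. pr (f x) x \<notin> Le) \<and>
       (\<forall>x\<in>A. \<forall>y\<in>A. pr x y \<in> Le \<or> pr (f y) x \<in> Le)) \<and>
      ((\<forall>x\<in>A. \<forall>y\<in>A. pr x y \<in> L \<or> pr y x \<in> L) \<and>
       (\<forall>x\<in>A. \<forall>y\<in>A. \<forall>z\<in>A. pr x y \<in> L \<and> pr y z \<in> L \<longrightarrow> pr x z \<in> L) \<longrightarrow>
       (\<forall>y\<in>A. \<exists>m\<in>A. pr m y \<in> Le \<and> (\<forall>x\<in>A. pr x y \<in> Le \<longrightarrow> pr x m \<in> L))) \<and>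
      ((\<forall>x\<in>A. \<exists>y\<in>A. pr x y \<in> Db) \<and>
       (\<forall>x\<in>A. \<forall>y\<in>A. \<forall>x'\<in>A. \<forall>y'\<in>A. pr x y \<in> Db \<and> pr x' y' \<in> Db \<and> pr x x' \<in> Le \<longrightarrow> pr y y' \<in> Le) \<and>
       pr c (f c) \<in> Db \<and>
       (\<forall>x\<in>A. \<forall>y\<in>A. pr x y \<in> Db \<longrightarrow> pr (f x) (f (f y)) \<in> Db)) \<and>
      ((\<forall>x\<in>A. \<forall>y\<in>A. pr x y \<in> Db \<and> (y \<in> T \<or> f y \<in> T) \<longrightarrow> x \<in> T) \<and>
       (\<forall>x\<in>A. \<exists>y\<in>A. pr (f x) y \<in> Le \<and> y \<in> T)) \<and>
      \<not> ((\<forall>x\<in>A. x \<in> B \<longrightarrow> x \<in> T) \<and> c \<in> B \<and>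
         (\<forall>x\<in>A. \<forall>y\<in>A. pr x y \<in> Db \<and> (y \<in> B \<or> f y \<in> B) \<longrightarrow> x \<in> B) \<and>
         (\<forall>x\<in>A. \<forall>y\<in>A. x \<in> B \<and> pr x y \<in> Db \<longrightarrow>
           (y \<in> B \<longrightarrow> f y \<notin> B) \<and> (f y \<notin> B \<longrightarrow> y \<in> B)))"

lemma ssat_nat_sentence:
  "ssat A f c el R nat_sentence \<longleftrightarrow>
    (\<exists>Le\<in>sets. (\<forall>p\<in>Le. \<exists>x\<in>A. \<exists>y\<in>A. p = pr x y) \<and>
    (\<exists>Db\<in>sets. (\<forall>p\<in>Db. \<exists>x\<in>A. \<exists>y\<in>A. p = pr x y) \<and>
    (\<exists>T\<in>sets. (\<forall>p\<in>T. p \<in> A) \<and>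
    (\<forall>L\<in>sets. (\<forall>p\<in>L. \<exists>x\<in>A. \<exists>y\<in>A. p = pr x y) \<longrightarrow>
    (\<forall>B\<in>sets. (\<forall>p\<in>B. p \<in> A) \<longrightarrow> nat_matrix A f c Le Db T L B)))))"
  unfolding nat_matrix_def nat_sentence_defs foldr.simps comp_apply id_apply ssat.simps is_tuple_1 is_tuple_2
  by (simp only: eval_nat_numeral One_nat_def nat.case sval.simps list.map tuple.simps BitM.simps)

definition coded_tree :: "'a::rca set \<Rightarrow> bool" where
  "coded_tree Y \<longleftrightarrow> (\<forall>x. x + x + 1 \<in> Y \<or> x + x + 1 + 1 \<in> Y \<longrightarrow> x \<in> Y)"

definition coded_branch :: "'a::rca set \<Rightarrow> 'a set \<Rightarrow> bool" where
  "coded_branch B T \<longleftrightarrow> B \<subseteq> T \<and> coded_tree B \<and> 0 \<in> B \<and>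
     (\<forall>x\<in>B. x + x + 1 \<in> B \<longleftrightarrow> x + x + 1 + 1 \<notin> B)"

lemma fval_WKL:
  fixes E :: "nat \<Rightarrow> 'a::rca"
  shows "fval E S WKL \<longleftrightarrow> (\<forall>T\<in>sets :: 'a set set.
    coded_tree T \<and> (\<forall>x. \<exists>y. x < y \<and> y \<in> T) \<longrightarrow> (\<exists>B\<in>sets. coded_branch B T))"
proof -
  have tree: "fval E S (tree_fm i) \<longleftrightarrow> coded_tree (S i)" for S :: "nat \<Rightarrow> 'a set" and i
    unfolding tree_fm_def snoc1_def snoc0_def coded_tree_def
    by (simp only: feval.simps teval.simps nat.case std_simps) blast
  have split: "fval E S (Forall (Imp (Mem (NVar 0) i)
      (Iff (Mem (snoc0 (NVar 0)) i) (Neg (Mem (snoc1 (NVar 0)) i))))) \<longleftrightarrow>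
      (\<forall>x\<in>S i. x + x + 1 \<in> S i \<longleftrightarrow> x + x + 1 + 1 \<notin> S i)"
    for S :: "nat \<Rightarrow> 'a set" and i
    unfolding snoc1_def snoc0_def
    by (simp only: feval.simps teval.simps nat.case std_simps) blast
  have subset: "fval E S (Forall (Imp (Mem (NVar 0) i) (Mem (NVar 0) j))) \<longleftrightarrow> S i \<subseteq> S j"
    for S :: "nat \<Rightarrow> 'a set" and i j by auto
  have branch: "fval E S (branch_fm i j) \<longleftrightarrow> coded_branch (S i) (S j)" for S :: "nat \<Rightarrow> 'a set" and i j
  proof -
    have "fval E S (And \<phi> \<psi>) \<longleftrightarrow> fval E S \<phi> \<and> fval E S \<psi>" for \<phi> \<psi> by simp
    moreover have "fval E S (Mem NZero i) \<longleftrightarrow> 0 \<in> S i" by simp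
    ultimately show ?thesis
      unfolding branch_fm_def coded_branch_def by (simp only: tree split subset)
  qed
  show ?thesis unfolding WKL_def by (simp add: tree branch infinite_fm_def)
qed

text \<open>The failure of \<open>WKL\<close> supplies the tree; order and doubling are the actual
  ones, and \<open>finite_maximum\<close> is the maximum clause.\<close>

lemma nat_sentence_standard:
  fixes T :: "'a::rca set"
  assumes "T \<in> sets" and tree: "coded_tree T" and T_unb: "\<forall>x. \<exists>y. x < y \<and> y \<in> T"
    and no_branch: "\<not> (\<exists>B\<in>sets. coded_branch B T)"
  shows "ssat UNIV (\<lambda>x. x + 1) (0 :: 'a) el R nat_sentence"
proof -
  have T: "T \<in> sets" "\<And>x. x + x + 1 \<in> T \<or> x + x + 1 + 1 \<in> T \<Longrightarrow> x \<in> T" "\<And>x. \<exists>y. x < y \<and> y \<in> T"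
    using \<open>T \<in> sets\<close> tree T_unb unfolding coded_tree_def by blast+
  define Le where "Le = {p. \<exists>x\<le>p. \<exists>y\<le>p. p = pr x y \<and> x \<le> (y :: 'a)}"
  define Db where "Db = {p. \<exists>x\<le>p. \<exists>y\<le>p. p = pr x y \<and> y = x + x + (1 :: 'a)}"
  have Le: "Le \<in> sets" unfolding Le_def by (rule comprehension, intro D0_rules Tm_pr)
  have Db: "Db \<in> sets" unfolding Db_def by (rule comprehension, intro D0_rules Tm_pr)
  have Le_iff: "pr x y \<in> Le \<longleftrightarrow> x \<le> y" for x y
    unfolding Le_def using pr_ge1[of x y] pr_ge2[of y x] by auto
  have Db_iff: "pr x y \<in> Db \<longleftrightarrow> y = x + x + 1" for x y
    unfolding Db_def using pr_ge1[of x y] pr_ge2[of y x] by auto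
  have pairs: "p \<in> Le \<Longrightarrow> \<exists>x y. p = pr x y" "p \<in> Db \<Longrightarrow> \<exists>x y. p = pr x y" for p
    unfolding Le_def Db_def by blast+
  have order: "x \<le> y \<or> y + 1 \<le> x" "\<not> x + 1 \<le> x" for x y :: 'a
    using succ_le_iff[of y x] succ_le_iff[of x x] by auto
  have double: "x + 1 + (x + 1) + 1 = x + x + 1 + 1 + (1 :: 'a)" for x by (simp only: add_ac)
  have mono: "x + x + 1 \<le> x' + x' + (1 :: 'a)" if "x \<le> x'" for x x'
    using that by (intro add_mono) simp_all
  have max: "\<forall>y. \<exists>m. m \<le> y \<and> (\<forall>x. x \<le> y \<longrightarrow> pr x m \<in> L)"
    if "L \<in> sets" "\<And>x y. pr x y \<in> L \<or> pr y x \<in> L"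
      "\<And>x y z. pr x y \<in> L \<Longrightarrow> pr y z \<in> L \<Longrightarrow> pr x z \<in> L" for L :: "'a set"
    by (intro allI finite_maximum) (fact that)+
  have unb: "\<exists>y. x + 1 \<le> y \<and> y \<in> T" for x using T(3) by (simp add: succ_le_iff)
  have nb: "\<not> ((\<forall>x. x \<in> B \<longrightarrow> x \<in> T) \<and> 0 \<in> B \<and>
      (\<forall>x y. y = x + x + 1 \<and> (y \<in> B \<or> y + 1 \<in> B) \<longrightarrow> x \<in> B) \<and>
      (\<forall>x y. x \<in> B \<and> y = x + x + 1 \<longrightarrow> (y \<in> B \<longrightarrow> y + 1 \<notin> B) \<and> (y + 1 \<notin> B \<longrightarrow> y \<in> B)))"
    if "B \<in> sets" for B
  proof
    assume *: "(\<forall>x. x \<in> B \<longrightarrow> x \<in> T) \<and> 0 \<in> B \<and>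
      (\<forall>x y. y = x + x + 1 \<and> (y \<in> B \<or> y + 1 \<in> B) \<longrightarrow> x \<in> B) \<and>
      (\<forall>x y. x \<in> B \<and> y = x + x + 1 \<longrightarrow> (y \<in> B \<longrightarrow> y + 1 \<notin> B) \<and> (y + 1 \<notin> B \<longrightarrow> y \<in> B))"
    have "coded_branch B T" unfolding coded_branch_def coded_tree_def using * by blast
    then show False using no_branch that by blast
  qed
  have matrix: "nat_matrix UNIV (\<lambda>x. x + 1) 0 Le Db T L B" if L: "L \<in> sets" and B: "B \<in> sets" for L B
    unfolding nat_matrix_def Le_iff Db_iff ball_UNIV bex_UNIV
  proof (intro conjI)
    show "(\<forall>x y. pr x y \<in> L \<or> pr y x \<in> L) \<and> (\<forall>x y z. pr x y \<in> L \<and> pr y z \<in> L \<longrightarrow> pr x z \<in> L) \<longrightarrow>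
       (\<forall>y. \<exists>m. m \<le> y \<and> (\<forall>x. x \<le> y \<longrightarrow> pr x m \<in> L))"
      using max[OF L] by blast
    show "\<forall>x y x' y' :: 'a. y = x + x + 1 \<and> y' = x' + x' + 1 \<and> x \<le> x' \<longrightarrow> y \<le> y'"
      by (intro allI impI, elim conjE, hypsubst) (rule mono)
    show "\<forall>x y :: 'a. y = x + x + 1 \<longrightarrow> y + 1 + 1 = x + 1 + (x + 1) + 1"
      by (intro allI impI) (simp only: double)
    show "\<forall>x y. y = x + x + 1 \<and> (y \<in> T \<or> y + 1 \<in> T) \<longrightarrow> x \<in> T" using T(2) by blast
    show "\<forall>x. \<exists>y. x + 1 \<le> y \<and> y \<in> T" using unb by blast
    show "\<forall>x y :: 'a. x \<le> y \<or> y + 1 \<le> x" "\<forall>x :: 'a. \<not> x + 1 \<le> x" using order by blast+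
    show "\<not> ((\<forall>x. x \<in> B \<longrightarrow> x \<in> T) \<and> 0 \<in> B \<and>
      (\<forall>x y. y = x + x + 1 \<and> (y \<in> B \<or> y + 1 \<in> B) \<longrightarrow> x \<in> B) \<and>
      (\<forall>x y. x \<in> B \<and> y = x + x + 1 \<longrightarrow> (y \<in> B \<longrightarrow> y + 1 \<notin> B) \<and> (y + 1 \<notin> B \<longrightarrow> y \<in> B)))"
      using nb[OF B] .
  qed auto
  then have all: "\<forall>L\<in>sets. (\<forall>p\<in>L. \<exists>x\<in>UNIV. \<exists>y\<in>UNIV. p = pr x y) \<longrightarrow>
      (\<forall>B\<in>sets. (\<forall>p\<in>B. p \<in> UNIV) \<longrightarrow> nat_matrix UNIV (\<lambda>x. x + 1) 0 Le Db T L B)" by simp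
  have p: "\<forall>p\<in>Le. \<exists>x\<in>UNIV. \<exists>y\<in>UNIV. p = pr x y" "\<forall>p\<in>Db. \<exists>x\<in>UNIV. \<exists>y\<in>UNIV. p = pr x y"
    using pairs by auto
  show ?thesis unfolding ssat_nat_sentence
    by (rule bexI[of _ Le], rule conjI, rule p(1), rule bexI[of _ Db], rule conjI, rule p(2),
        rule bexI[of _ T], rule conjI, simp) (fact all T(1) Db Le)+
qed

lemma candidate_of_ssat:
  fixes A F :: "'a::rca set"
  assumes "A \<in> sets" "F \<in> sets" "c \<in> A" "\<And>x. x \<in> A \<Longrightarrow> f x \<in> A" "\<And>x y. pr x y \<in> F \<longleftrightarrow> x \<in> A \<and> y = f x"
    and sat: "ssat A f c el R nat_sentence"
  shows "\<exists>Le Db T. candidate A F Le Db T c f"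
proof -
  have empty: "({} :: 'a set) \<in> sets" using comprehension[of "\<lambda>x :: 'a. False"] D0_False by simp
  obtain Le Db T where s: "Le \<in> sets" "Db \<in> sets" "T \<in> sets" and
    "\<forall>L\<in>sets. (\<forall>p\<in>L. \<exists>x\<in>A. \<exists>y\<in>A. p = pr x y) \<longrightarrow>
      (\<forall>B\<in>sets. (\<forall>p\<in>B. p \<in> A) \<longrightarrow> nat_matrix A f c Le Db T L B)"
    using sat unfolding ssat_nat_sentence by (elim bexE conjE) (rule that; assumption)
  then have all: "nat_matrix A f c Le Db T L B" if "L \<in> sets" "\<forall>p\<in>L. \<exists>x\<in>A. \<exists>y\<in>A. p = pr x y"
    "B \<in> sets" "\<forall>p\<in>B. p \<in> A" for L B using that by blast
  \<comment> \<open>Any instance of the universal block yields the clauses without \<open>L\<close>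
    and \<open>B\<close>; the empty relations are always available.\<close>
  have "nat_matrix A f c Le Db T {} {}" by (intro all empty) simp_all
  note fo = this[unfolded nat_matrix_def]
  have o: "\<forall>x\<in>A. pr x x \<in> Le"
    "\<forall>x\<in>A. \<forall>y\<in>A. \<forall>z\<in>A. pr x y \<in> Le \<and> pr y z \<in> Le \<longrightarrow> pr x z \<in> Le"
    "\<forall>x\<in>A. \<forall>y\<in>A. pr x y \<in> Le \<and> pr y x \<in> Le \<longrightarrow> x = y"
    "\<forall>x\<in>A. pr c x \<in> Le" "\<forall>x\<in>A. pr x (f x) \<in> Le" "\<forall>x\<in>A. pr (f x) x \<notin> Le"
    "\<forall>x\<in>A. \<forall>y\<in>A. pr x y \<in> Le \<or> pr (f y) x \<in> Le"
    using fo by - (elim conjE; assumption)+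
  have d: "\<forall>x\<in>A. \<exists>y\<in>A. pr x y \<in> Db"
    "\<forall>x\<in>A. \<forall>y\<in>A. \<forall>x'\<in>A. \<forall>y'\<in>A. pr x y \<in> Db \<and> pr x' y' \<in> Db \<and> pr x x' \<in> Le \<longrightarrow> pr y y' \<in> Le"
    "pr c (f c) \<in> Db" "\<forall>x\<in>A. \<forall>y\<in>A. pr x y \<in> Db \<longrightarrow> pr (f x) (f (f y)) \<in> Db"
    using fo by - (elim conjE; assumption)+
  have t: "\<forall>x\<in>A. \<forall>y\<in>A. pr x y \<in> Db \<and> (y \<in> T \<or> f y \<in> T) \<longrightarrow> x \<in> T"
    "\<forall>x\<in>A. \<exists>y\<in>A. pr (f x) y \<in> Le \<and> y \<in> T"
    using fo by - (elim conjE; assumption)+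
  show ?thesis
  proof (intro exI candidate.intro)
    show "A \<in> sets" "F \<in> sets" "Le \<in> sets" "Db \<in> sets" "T \<in> sets" "c \<in> A" by fact+
    fix x y
    show "pr x y \<in> F \<longleftrightarrow> x \<in> A \<and> y = f x" by fact
    assume x: "x \<in> A"
    show "f x \<in> A" using x by fact
    show "pr x x \<in> Le" "pr c x \<in> Le" "pr x (f x) \<in> Le" "pr (f x) x \<notin> Le" using x o(1,4-6) by blast+
    show "\<exists>y\<in>A. pr x y \<in> Db" using x d(1) by simp
    show "\<exists>y\<in>A. pr (f x) y \<in> Le \<and> y \<in> T" using x t(2) by simp
    assume y: "y \<in> A"
    show "pr x y \<in> Le \<or> pr (f y) x \<in> Le" using x y o(7) by simp
    show "pr x y \<in> Le \<Longrightarrow> pr y x \<in> Le \<Longrightarrow> x = y" using x y o(3) by simp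
    show "pr x y \<in> Db \<Longrightarrow> pr (f x) (f (f y)) \<in> Db" using x y d(4) by simp
    show "pr x y \<in> Db \<Longrightarrow> y \<in> T \<or> f y \<in> T \<Longrightarrow> x \<in> T" using x y t(1) by blast
  next
    fix x y z assume "x \<in> A" "y \<in> A" "z \<in> A" "pr x y \<in> Le" "pr y z \<in> Le"
    then show "pr x z \<in> Le" using o(2) by blast
  next
    fix x y x' y' assume "x \<in> A" "y \<in> A" "x' \<in> A" "y' \<in> A" "pr x y \<in> Db" "pr x' y' \<in> Db" "pr x x' \<in> Le"
    then show "pr y y' \<in> Le" using d(2) by blast
  next
    show "pr c (f c) \<in> Db" by (rule d(3))
  next
    fix L y
    assume L: "L \<in> sets" "\<And>p. p \<in> L \<Longrightarrow> \<exists>x\<in>A. \<exists>y\<in>A. p = pr x y"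
      "\<And>x y. x \<in> A \<Longrightarrow> y \<in> A \<Longrightarrow> pr x y \<in> L \<or> pr y x \<in> L"
      "\<And>x y z. x \<in> A \<Longrightarrow> y \<in> A \<Longrightarrow> z \<in> A \<Longrightarrow> pr x y \<in> L \<Longrightarrow> pr y z \<in> L \<Longrightarrow> pr x z \<in> L" and y: "y \<in> A"
    have "\<forall>p\<in>L. \<exists>x\<in>A. \<exists>y\<in>A. p = pr x y" by (rule ballI, rule L(2))
    then have "nat_matrix A f c Le Db T L {}" by (rule all[OF L(1) _ empty]) simp
    then have "(\<forall>x\<in>A. \<forall>y\<in>A. pr x y \<in> L \<or> pr y x \<in> L) \<and>
       (\<forall>x\<in>A. \<forall>y\<in>A. \<forall>z\<in>A. pr x y \<in> L \<and> pr y z \<in> L \<longrightarrow> pr x z \<in> L) \<longrightarrow>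
       (\<forall>y\<in>A. \<exists>m\<in>A. pr m y \<in> Le \<and> (\<forall>x\<in>A. pr x y \<in> Le \<longrightarrow> pr x m \<in> L))"
      unfolding nat_matrix_def by (elim conjE)
    then show "\<exists>m\<in>A. pr m y \<in> Le \<and> (\<forall>x\<in>A. pr x y \<in> Le \<longrightarrow> pr x m \<in> L)" using L(3,4) y by blast
  next
    fix B
    assume B: "B \<in> sets" "B \<subseteq> A" "B \<subseteq> T" "c \<in> B"
      "\<And>x y. x \<in> A \<Longrightarrow> y \<in> A \<Longrightarrow> pr x y \<in> Db \<Longrightarrow> y \<in> B \<or> f y \<in> B \<Longrightarrow> x \<in> B"
      "\<And>x y. x \<in> B \<Longrightarrow> y \<in> A \<Longrightarrow> pr x y \<in> Db \<Longrightarrow> y \<in> B \<longleftrightarrow> f y \<notin> B"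
    have "\<forall>p\<in>B. p \<in> A" using B(2) by blast
    then have "nat_matrix A f c Le Db T {} B" by (intro all[OF empty _ B(1)]) simp_all
    then have "\<not> ((\<forall>x\<in>A. x \<in> B \<longrightarrow> x \<in> T) \<and> c \<in> B \<and>
         (\<forall>x\<in>A. \<forall>y\<in>A. pr x y \<in> Db \<and> (y \<in> B \<or> f y \<in> B) \<longrightarrow> x \<in> B) \<and>
         (\<forall>x\<in>A. \<forall>y\<in>A. x \<in> B \<and> pr x y \<in> Db \<longrightarrow>
           (y \<in> B \<longrightarrow> f y \<notin> B) \<and> (f y \<notin> B \<longrightarrow> y \<in> B)))"
      unfolding nat_matrix_def by (elim conjE)
    moreover have "\<forall>x\<in>A. x \<in> B \<longrightarrow> x \<in> T" using B(3) by blast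
    moreover have "\<forall>x\<in>A. \<forall>y\<in>A. pr x y \<in> Db \<and> (y \<in> B \<or> f y \<in> B) \<longrightarrow> x \<in> B" using B(5) by blast
    moreover have "\<forall>x\<in>A. \<forall>y\<in>A. x \<in> B \<and> pr x y \<in> Db \<longrightarrow>
           (y \<in> B \<longrightarrow> f y \<notin> B) \<and> (f y \<notin> B \<longrightarrow> y \<in> B)" using B(6) by blast
    ultimately show False using B(4) by blast
  qed
qed

section \<open>Validity in models of the theory\<close>

lemma fval_with_standard:
  fixes E :: "nat \<Rightarrow> 'a::rca"
  shows "fval E S (with_standard_fm \<chi>) \<longleftrightarrow> (\<exists>N\<in>sets. \<exists>U\<in>sets. (\<forall>x. x \<in> N) \<and>
    (\<forall>p. p \<in> U \<longleftrightarrow> (\<exists>x. p = pr x (x + 1))) \<and> fval E (case_nat U (case_nat N S)) \<chi>)"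
proof -
  have "fval E S (all_numbers_fm i) \<longleftrightarrow> (\<forall>x. x \<in> S i)" for S :: "nat \<Rightarrow> 'a set" and i
    by (simp add: all_numbers_fm_def)
  moreover have "fval E S (successor_fm i) \<longleftrightarrow> (\<forall>p. p \<in> S i \<longleftrightarrow> (\<exists>x. p = pr x (x + 1)))"
    for S :: "nat \<Rightarrow> 'a set" and i
    unfolding successor_fm_def
    by (simp only: feval.simps teval.simps tval_pair nat.case std_simps One_nat_def) blast
  ultimately show ?thesis unfolding with_standard_fm_def by simp
qed

lemma ex_standard_sets:
  "(UNIV :: 'a::rca set) \<in> sets" "{p. \<exists>x :: 'a::rca. p = pr x (x + 1)} \<in> sets"
proof -
  have "{x :: 'a. x = x} \<in> sets" by (rule comprehension, intro D0_rules)
  then show "(UNIV :: 'a set) \<in> sets" by simp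
  have "{p :: 'a. \<exists>x\<le>p. p = pr x (x + 1)} \<in> sets" by (rule comprehension, intro D0_rules Tm_pr)
  moreover have "{p :: 'a. \<exists>x\<le>p. p = pr x (x + 1)} = {p. \<exists>x. p = pr x (x + 1)}"
    using pr_ge1 by auto
  ultimately show "{p. \<exists>x :: 'a. p = pr x (x + 1)} \<in> sets" by simp
qed

theorem standard_models_valid:
  assumes "valid_in (std :: 'a::rca arith) (Neg WKL)"
  shows "valid_in (std :: 'a arith) (standard_models_fm nat_sentence)"
  unfolding valid_in_def
proof (intro allI impI)
  fix E :: "nat \<Rightarrow> 'a" and S :: "nat \<Rightarrow> 'a set" assume "\<forall>n. S n \<in> Sets std"
  then have "\<not> fval E S WKL" using assms unfolding valid_in_def by simp
  then obtain T :: "'a set" where T: "T \<in> sets" "coded_tree T" "\<forall>x. \<exists>y. x < y \<and> y \<in> T"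
    "\<not> (\<exists>B\<in>sets. coded_branch B T)"
    unfolding fval_WKL by blast
  define U where "U = {p. \<exists>x :: 'a. p = pr x (x + 1)}"
  have "ssat UNIV (\<lambda>x :: 'a. x + 1) 0 E (case_nat U (case_nat UNIV S)) nat_sentence"
    using T by (rule nat_sentence_standard)
  moreover have "is_graph UNIV (\<lambda>x. x + 1) U" by (auto simp: is_graph_def U_def)
  ultimately have "fval E (case_nat U (case_nat UNIV S)) (models_fm 1 0 NZero nat_sentence)"
    by (subst fval_models[where f = "\<lambda>x. x + 1"]) (simp_all add: sentence_nat_sentence)
  then show "fval E S (standard_models_fm nat_sentence)"
    unfolding standard_models_fm_def fval_with_standard
    using ex_standard_sets[where 'a = 'a] by (intro bexI[of _ UNIV] bexI[of _ U]) (auto simp: U_def)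
qed

lemma fval_function:
  fixes E :: "nat \<Rightarrow> 'a::rca"
  shows "fval E S (function_fm F A B) \<longleftrightarrow> (\<forall>p\<in>S F. \<exists>x\<in>S A. \<exists>y\<in>S B. p = pr x y) \<and>
    (\<forall>x\<in>S A. \<exists>y. \<forall>z. pr x z \<in> S F \<longleftrightarrow> z = y)"
proof -
  have "fval E S (Forall (Imp (Mem (NVar 0) F) (Exists (Exists (And (Mem (NVar 1) A)
      (And (Mem (NVar 0) B) (Eq (NVar 2) (pair (NVar 1) (NVar 0))))))))) \<longleftrightarrow>
    (\<forall>p\<in>S F. \<exists>x\<in>S A. \<exists>y\<in>S B. p = pr x y)"
    by (auto simp: numeral_2_eq_2)
  moreover have "fval E S (Forall (Imp (Mem (NVar 0) A)
      (Exists (Forall (Iff (Mem (pair (NVar 2) (NVar 0)) F) (Eq (NVar 0) (NVar 1))))))) \<longleftrightarrow>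
    (\<forall>x\<in>S A. \<exists>y. \<forall>z. pr x z \<in> S F \<longleftrightarrow> z = y)"
    by (simp add: numeral_2_eq_2 iff_conv_conj_imp Ball_def)
  moreover have "fval E S (And \<phi> \<psi>) \<longleftrightarrow> fval E S \<phi> \<and> fval E S \<psi>" for \<phi> \<psi> by simp
  ultimately show ?thesis unfolding function_fm_def by (simp only:)
qed

lemma fval_iso:
  fixes E :: "nat \<Rightarrow> 'a::rca"
  shows "fval E S (iso_fm H A F c B G d) \<longleftrightarrow> fval E S (function_fm H A B) \<and>
    (\<forall>y\<in>S B. \<exists>x. \<forall>z. pr z y \<in> S H \<longleftrightarrow> z = x) \<and> pr (tval E c) (tval E d) \<in> S H \<and>
    (\<forall>x x' y y'. pr x x' \<in> S F \<and> pr x y \<in> S H \<and> pr x' y' \<in> S H \<longrightarrow> pr y y' \<in> S G)"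
proof -
  have "fval E S (Forall (Imp (Mem (NVar 0) B)
      (Exists (Forall (Iff (Mem (pair (NVar 0) (NVar 2)) H) (Eq (NVar 0) (NVar 1))))))) \<longleftrightarrow>
    (\<forall>y\<in>S B. \<exists>x. \<forall>z. pr z y \<in> S H \<longleftrightarrow> z = x)"
    by (simp add: numeral_2_eq_2 iff_conv_conj_imp Ball_def)
  moreover have "fval E S (Mem (pair c d) H) \<longleftrightarrow> pr (tval E c) (tval E d) \<in> S H" by simp
  moreover have "fval E S (Forall (Forall (Forall (Forall
      (Imp (And (Mem (pair (NVar 3) (NVar 2)) F)
           (And (Mem (pair (NVar 3) (NVar 1)) H) (Mem (pair (NVar 2) (NVar 0)) H)))
           (Mem (pair (NVar 1) (NVar 0)) G)))))) \<longleftrightarrow>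
    (\<forall>x x' y y'. pr x x' \<in> S F \<and> pr x y \<in> S H \<and> pr x' y' \<in> S H \<longrightarrow> pr y y' \<in> S G)"
    by (simp add: numeral_2_eq_2 numeral_3_eq_3)
  moreover have "fval E S (And \<phi> \<psi>) \<longleftrightarrow> fval E S \<phi> \<and> fval E S \<psi>" for \<phi> \<psi> by simp
  ultimately show ?thesis unfolding iso_fm_def by (simp only:)
qed

lemma categorical_step:
  fixes E :: "nat \<Rightarrow> 'a::rca"
  assumes S: "\<And>n. S n \<in> sets" and N: "\<And>x. x \<in> S 3" and U: "\<And>p. p \<in> S 2 \<longleftrightarrow> (\<exists>x. p = pr x (x + 1))"
    and str: "fval E S (structure_fm 1 0 (NVar 0))"
    and mod: "fval E S (models_fm 1 0 (NVar 0) nat_sentence)"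
  shows "\<exists>H\<in>sets. fval E (case_nat H S) (iso_fm 0 4 3 NZero 2 1 (NVar 0))"
proof -
  define A F c where "A = S 1" and "F = S 0" and "c = E 0"
  have fn: "\<forall>p\<in>F. \<exists>x\<in>A. \<exists>y\<in>A. p = pr x y" "\<forall>x\<in>A. \<exists>y. \<forall>z. pr x z \<in> F \<longleftrightarrow> z = y" and c: "c \<in> A"
    using str unfolding structure_fm_def feval.simps fval_function A_def F_def c_def by auto
  \<comment> \<open>Outside \<open>A\<close> the value is arbitrary, whence the guard
    \<open>x \<in> A\<close> in \<open>F_iff\<close>.\<close>
  define f where "f x = (THE y. pr x y \<in> F)" for x
  have f: "pr x y \<in> F \<longleftrightarrow> y = f x" if "x \<in> A" for x y
  proof -
    obtain y' where y': "\<forall>z. pr x z \<in> F \<longleftrightarrow> z = y'" using fn(2) \<open>x \<in> A\<close> by blast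
    then have "f x = y'" unfolding f_def by simp
    then show ?thesis using y' by simp
  qed
  have F_iff: "pr x y \<in> F \<longleftrightarrow> x \<in> A \<and> y = f x" for x y
    using f fn(1)[rule_format, of "pr x y"] by auto
  have f_in: "f x \<in> A" if "x \<in> A" for x
    using F_iff[of x "f x"] fn(1)[rule_format, of "pr x (f x)"] that by auto
  have "is_graph A f F" using F_iff f_in by (auto simp: is_graph_def)
  then have sat: "ssat A f c E S nat_sentence"
    using mod fval_models[OF sentence_nat_sentence, of S 1 f 0 E "NVar 0"] c by (simp add: A_def F_def c_def)
  have "A \<in> sets" "F \<in> sets" using S by (simp_all add: A_def F_def)
  then have "\<exists>Le Db T. candidate A F Le Db T c f"
    using c f_in F_iff sat by (rule candidate_of_ssat)
  then obtain Le Db T where "candidate A F Le Db T c f" by blast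
  from candidate.ex_isomorphism[OF this] obtain H0 s where H0: "H0 \<in> sets" "\<And>n a. pr n a \<in> H0 \<longleftrightarrow> a = s n" and
    s: "bij_betw s UNIV A" "s 0 = c" "\<And>n. s (n + 1) = f (s n)"
    by blast
  \<comment> \<open>Nothing is known about members of \<open>H0\<close> that are not pairs;
    \<open>function_fm\<close> forbids them, so they are removed.\<close>
  define H where "H = {p. \<exists>n\<le>p. \<exists>a\<le>p. p = pr n a \<and> pr n a \<in> H0}"
  have "H \<in> sets" unfolding H_def by (rule comprehension, intro D0_rules Tm_pr H0(1))
  have H: "pr n a \<in> H \<longleftrightarrow> a = s n" for n a
    unfolding H_def using pr_ge1[of n a] pr_ge2[of a n] H0(2) by auto
  have inj: "s m = s n \<longleftrightarrow> m = n" for m n using bij_betw_imp_inj_on[OF s(1)] by (auto simp: inj_on_def)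
  have range: "range s = A" using bij_betw_imp_surj_on[OF s(1)] .
  have "\<forall>p\<in>H. \<exists>x\<in>S 3. \<exists>y\<in>A. p = pr x y"
  proof
    fix p assume "p \<in> H"
    then obtain n a where "p = pr n a" "a = s n" unfolding H_def using H0(2) by blast
    then show "\<exists>x\<in>S 3. \<exists>y\<in>A. p = pr x y" using N range by blast
  qed
  moreover have "\<forall>x\<in>S 3. \<exists>y. \<forall>z. pr x z \<in> H \<longleftrightarrow> z = y" unfolding H by blast
  moreover have "\<forall>y\<in>A. \<exists>x. \<forall>z. pr z y \<in> H \<longleftrightarrow> z = x"
  proof
    fix y assume "y \<in> A"
    then obtain x where "y = s x" using range by blast
    then show "\<exists>x. \<forall>z. pr z y \<in> H \<longleftrightarrow> z = x" unfolding H using inj by auto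
  qed
  moreover have "pr 0 c \<in> H" unfolding H using s(2) by simp
  moreover have "pr y y' \<in> F" if "pr x x' \<in> S 2" "pr x y \<in> H" "pr x' y' \<in> H" for x x' y y'
  proof -
    have "x' = x + 1" using that(1) U by auto
    then show ?thesis using that(2,3) range s(3) unfolding F_iff H by auto
  qed
  ultimately have "fval E (case_nat H S) (iso_fm 0 4 3 NZero 2 1 (NVar 0))"
    unfolding fval_iso fval_function by (auto simp: A_def F_def c_def eval_nat_numeral)
  then show ?thesis using \<open>H \<in> sets\<close> by blast
qed

theorem categorical_valid: "valid_in (std :: 'a::rca arith) (categorical_fm nat_sentence)"
  unfolding valid_in_def
proof (intro allI impI)
  fix E :: "nat \<Rightarrow> 'a" and S :: "nat \<Rightarrow> 'a set" assume S: "\<forall>n. S n \<in> Sets std"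
  define U where "U = {p. \<exists>x :: 'a. p = pr x (x + 1)}"
  have sets: "(UNIV :: 'a set) \<in> sets" "U \<in> sets" unfolding U_def by (simp_all add: ex_standard_sets)
  have "\<exists>H\<in>sets. fval (case_nat c E) (case_nat H (case_nat F (case_nat A (case_nat U (case_nat UNIV S)))))
      (iso_fm 0 4 3 NZero 2 1 (NVar 0))"
    if "A \<in> sets" "F \<in> sets"
      "fval (case_nat c E) (case_nat F (case_nat A (case_nat U (case_nat UNIV S)))) (structure_fm 1 0 (NVar 0))"
      "fval (case_nat c E) (case_nat F (case_nat A (case_nat U (case_nat UNIV S)))) (models_fm 1 0 (NVar 0) nat_sentence)"
    for A F c
  proof (rule categorical_step[OF _ _ _ that(3,4)])
    show "case_nat F (case_nat A (case_nat U (case_nat UNIV S))) n \<in> sets" for n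
      using S that(1,2) sets by (auto split: nat.splits)
  qed (simp_all add: eval_nat_numeral U_def)
  then have "fval E (case_nat U (case_nat UNIV S)) (ForallS (ForallS (Forall
      (Imp (And (structure_fm 1 0 (NVar 0)) (models_fm 1 0 (NVar 0) nat_sentence))
           (ExistsS (iso_fm 0 4 3 NZero 2 1 (NVar 0)))))))"
    by simp
  then show "fval E S (categorical_fm nat_sentence)"
    unfolding categorical_fm_def fval_with_standard
    using sets by (intro bexI[of _ UNIV] bexI[of _ U]) (auto simp: U_def)
qed

section \<open>The standard model\<close>

text \<open>A type can only be an instance of \<open>rca\<close> if some model is available
  unconditionally; this is the fallback when no countermodel exists.\<close>

definition nat_arith :: "nat arith" where
  "nat_arith = \<lparr>zer = 0, uni = 1, add = (+), mul = (*), lt = (<), Sets = UNIV\<rparr>"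

lemma nat_arith_simps [simp]:
  "zer nat_arith = 0" "uni nat_arith = 1" "add nat_arith = (+)" "mul nat_arith = (*)"
  "lt nat_arith = (<)" "Sets nat_arith = UNIV"
  by (simp_all add: nat_arith_def)

text \<open>The sum in \<open>v\<close> makes each modulus exceed its entry. The factorial makes the
  moduli coprime: a common divisor of two of them divides j - i, hence n! and v, hence 1. The
  Chinese remainder theorem then gives \<open>u\<close>.\<close>

lemma beta_lemma:
  fixes a :: "nat \<Rightarrow> nat"
  shows "\<exists>u v. \<forall>i\<le>n. a i < 1 + (i + 1) * v \<and> u mod (1 + (i + 1) * v) = a i"
proof -
  define v where "v = fact n * (\<Sum>i\<le>n. a i)"
  define m where "m i = 1 + (i + 1) * v" for i
  have bound: "a i < m i" if "i \<le> n" for i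
  proof -
    have "a i \<le> (\<Sum>i\<le>n. a i)" using that by (intro member_le_sum) auto
    also have "\<dots> \<le> v" unfolding v_def by (simp add: fact_ge_1)
    also have "\<dots> \<le> (i + 1) * v" by simp
    finally show ?thesis by (simp add: m_def)
  qed
  have cop: "coprime (m i) (m j)" if "i < j" "j \<le> n" for i j
  proof (rule coprimeI)
    fix d assume d: "d dvd m i" "d dvd m j"
    have "(j + 1) * m i = (i + 1) * m j + (j - i)"
      using that by (simp add: m_def algebra_simps)
    then have "d dvd j - i" using d by (metis dvd_add_right_iff dvd_mult)
    also have "j - i dvd fact n" using that by (intro dvd_fact) auto
    finally have "d dvd (i + 1) * v" unfolding v_def by (simp add: dvd_mult dvd_mult2)
    then show "is_unit d" using d(1) dvd_add_left_iff[of d "(i + 1) * v" 1] unfolding m_def by blast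
  qed
  have "\<forall>i\<in>{..n}. \<forall>j\<in>{..n}. i \<noteq> j \<longrightarrow> coprime (m i) (m j)"
    using cop by (metis atMost_iff coprime_commute linorder_neqE_nat)
  then obtain u where "\<forall>i\<in>{..n}. [u = a i] (mod m i)"
    using chinese_remainder_nat[of "{..n}" m a] by blast
  then show ?thesis using bound by (intro exI[of _ u] exI[of _ v]) (auto simp: cong_def m_def)
qed

lemma nat_arith_exp: "feval nat_arith e S exp_axiom"
proof -
  have "feval nat_arith (case_nat n (case_nat b e)) S (Exists (exp_fm (NVar 2) (NVar 1) (NVar 0)))" for b n
  proof -
    obtain u v where uv: "\<And>i. i \<le> n \<Longrightarrow> b ^ i < 1 + (i + 1) * v \<and> u mod (1 + (i + 1) * v) = b ^ i"
      using beta_lemma[of n "\<lambda>i. b ^ i"] by blast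
    define code where "code u v i z \<longleftrightarrow> z < 1 + (i + 1) * v \<and> u mod (1 + (i + 1) * v) = z"
      for u v i z :: nat
    have beta: "feval nat_arith e S (beta_fm s t i z) \<longleftrightarrow>
      code (teval nat_arith e s) (teval nat_arith e t) (teval nat_arith e i) (teval nat_arith e z)"
      for e :: "nat \<Rightarrow> nat" and s t i z
    proof -
      have "(\<exists>q\<le>x. x = q * d + r) \<longleftrightarrow> x mod d = r" if "r < d" for x d r :: nat
      proof
        assume "x mod d = r"
        then have "x = x div d * d + r" by (metis div_mult_mod_eq)
        then show "\<exists>q\<le>x. x = q * d + r" by (intro exI[of _ "x div d"]) simp
      qed (use that in auto)
      moreover have "feval nat_arith e S (beta_fm s t i z) \<longleftrightarrow>
         teval nat_arith e z < 1 + (teval nat_arith e i + 1) * teval nat_arith e t \<and>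
         (\<exists>q\<le>teval nat_arith e s. teval nat_arith e s =
           q * (1 + (teval nat_arith e i + 1) * teval nat_arith e t) + teval nat_arith e z)"
        by (simp add: beta_fm_def Let_def less_Suc_eq_le)
      ultimately show ?thesis unfolding code_def by blast
    qed
    have code: "code u v i (b ^ i)" if "i \<le> n" for i using uv[OF that] by (simp add: code_def)
    \<comment> \<open>A remainder of \<open>u\<close> is at most \<open>u\<close>, which is the
      bound that \<open>exp_fm\<close> puts on its witness.\<close>
    have le: "b ^ i \<le> u" if "i \<le> n" for i using uv[OF that] by (metis mod_less_eq_dividend)
    have "\<exists>z. code u v i z \<and> z < u + 1 \<and> code u v (i + 1) (z * b)" if "i < n" for i
      using code[of i] code[of "i + 1"] le[of i] that
      by (intro exI[of _ "b ^ i"]) (simp add: mult.commute less_Suc_eq_le)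
    moreover have "code u v 0 1" "code u v n (b ^ n)" using code[of 0] code[of n] by simp_all
    ultimately have "\<exists>y u v. code u v 0 1 \<and>
        (\<forall>i<n. \<exists>z. code u v i z \<and> z < u + 1 \<and> code u v (i + 1) (z * b)) \<and> code u v n y" by blast
    then show ?thesis by (simp add: exp_fm_def beta eval_nat_numeral)
  qed
  then show ?thesis unfolding exp_axiom_def feval.simps(6) by blast
qed

lemma nat_arith_valid:
  assumes "\<phi> \<in> RCA0_star" shows "valid_in nat_arith \<phi>"
  unfolding valid_in_def
proof (intro allI impI)
  fix e :: "nat \<Rightarrow> nat" and S :: "nat \<Rightarrow> nat set"
  consider "\<phi> \<in> basic_axioms" | \<psi> where "\<phi> = induction_axiom \<psi>" | \<psi> \<chi> where "\<phi> = comprehension_axiom \<psi> \<chi>"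
    | "\<phi> = exp_axiom" using assms unfolding RCA0_star_def by blast
  then show "feval nat_arith e S \<phi>"
  proof cases
    case 1 then show ?thesis by (auto simp: basic_axioms_def Let_def)
  next
    case 2
    have step: "(\<lambda>n. teval nat_arith (case_nat x e) (case_nat (Plus (NVar 0) NOne) (\<lambda>n. NVar (Suc n)) n)) =
        case_nat (Suc x) e" for x by (rule ext) (auto split: nat.splits)
    have base: "(\<lambda>n. teval nat_arith e (case_nat NZero NVar n)) = case_nat 0 e"
      by (rule ext) (auto split: nat.splits)
    have "feval nat_arith (case_nat x e) S \<psi>" if "feval nat_arith (case_nat 0 e) S \<psi>"
      "\<And>x. feval nat_arith (case_nat x e) S \<psi> \<Longrightarrow> feval nat_arith (case_nat (Suc x) e) S \<psi>" for x
      using that by (induction x) auto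
    then show ?thesis unfolding 2 induction_axiom_def inst_def by (simp add: feval_fsub step base)
  next
    case 3
    have "feval nat_arith e (case_nat Y S) (liftFS \<chi>) \<longleftrightarrow> feval nat_arith e S \<chi>" for e Y \<chi>
      unfolding liftFS_def feval_fsub by simp
    then show ?thesis unfolding 3 comprehension_axiom_def
      by (auto intro!: exI[of _ "{x. \<exists>z. feval nat_arith (case_nat z (case_nat x e)) S \<psi>}"])
  qed (simp add: nat_arith_exp)
qed


section \<open>A type carrying a countermodel\<close>

text \<open>Transport along a bijection: the type \<open>nat\<close> already carries its own
  arithmetic, so a countermodel on it is copied to a fresh type.\<close>

definition image_arith :: "('a \<Rightarrow> 'b) \<Rightarrow> 'a arith \<Rightarrow> 'b arith" where
  "image_arith h M = \<lparr>zer = h (zer M), uni = h (uni M),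
     add = (\<lambda>x y. h (add M (inv h x) (inv h y))), mul = (\<lambda>x y. h (mul M (inv h x) (inv h y))),
     lt = (\<lambda>x y. lt M (inv h x) (inv h y)), Sets = (`) h ` Sets M\<rparr>"

lemma teval_image:
  assumes "bij h"
  shows "teval (image_arith h M) (\<lambda>n. h (e n)) t = h (teval M e t)"
  using bij_is_inj[OF assms] by (induction t) (simp_all add: image_arith_def inv_f_f)

lemma feval_image:
  assumes "bij h"
  shows "feval (image_arith h M) (\<lambda>n. h (e n)) (\<lambda>n. h ` S n) \<phi> \<longleftrightarrow> feval M e S \<phi>"
proof (induction \<phi> arbitrary: e S)
  case (Eq s t)
  show ?case using bij_is_inj[OF assms] by (simp add: teval_image[OF assms] inj_eq)
next
  case (Less s t)
  show ?case using bij_is_inj[OF assms]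
    by (simp add: teval_image[OF assms]) (simp add: image_arith_def inv_f_f)
next
  case (Mem t X)
  show ?case using bij_is_inj[OF assms] by (simp add: teval_image[OF assms] inj_image_mem_iff)
next
  case (Forall \<phi>)
  have "case_nat (h x) (\<lambda>n. h (e n)) = (\<lambda>n. h (case_nat x e n))" for x
    by (rule ext) (auto split: nat.splits)
  moreover have "(\<forall>y. P y) \<longleftrightarrow> (\<forall>x. P (h x))" for P using bij_is_surj[OF assms] by (metis surjD)
  ultimately show ?case using Forall by simp
next
  case (ForallS \<phi>)
  have "case_nat (h ` Y) (\<lambda>n. h ` S n) = (\<lambda>n. h ` case_nat Y S n)" for Y
    by (rule ext) (auto split: nat.splits)
  moreover have "Sets (image_arith h M) = (`) h ` Sets M" by (simp add: image_arith_def)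
  ultimately show ?case using ForallS by simp
qed simp_all

lemma valid_in_image:
  fixes h :: "'a \<Rightarrow> 'b" and M :: "'a arith"
  assumes "bij h"
  shows "valid_in (image_arith h M) \<phi> \<longleftrightarrow> valid_in M \<phi>"
proof
  assume v: "valid_in (image_arith h M) \<phi>"
  show "valid_in M \<phi>" unfolding valid_in_def
  proof (intro allI impI)
    fix e :: "nat \<Rightarrow> 'a" and S :: "nat \<Rightarrow> 'a set" assume "\<forall>n. S n \<in> Sets M"
    then have "\<forall>n. h ` S n \<in> Sets (image_arith h M)" by (simp add: image_arith_def)
    then have "feval (image_arith h M) (\<lambda>n. h (e n)) (\<lambda>n. h ` S n) \<phi>"
      using v unfolding valid_in_def by simp
    then show "feval M e S \<phi>" by (simp add: feval_image[OF assms])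
  qed
next
  assume v: "valid_in M \<phi>"
  show "valid_in (image_arith h M) \<phi>" unfolding valid_in_def
  proof (intro allI impI)
    fix e :: "nat \<Rightarrow> 'b" and S :: "nat \<Rightarrow> 'b set" assume "\<forall>n. S n \<in> Sets (image_arith h M)"
    then have "\<forall>n. \<exists>Y\<in>Sets M. S n = h ` Y" by (simp add: image_arith_def image_iff)
    then obtain S' where S': "\<And>n. S' n \<in> Sets M" "S = (\<lambda>n. h ` S' n)" by metis
    have e: "e = (\<lambda>n. h (inv h (e n)))" using bij_is_surj[OF assms] by (simp add: surj_f_inv_f)
    have "feval M (\<lambda>n. inv h (e n)) S' \<phi>" using v S'(1) unfolding valid_in_def by blast
    then show "feval (image_arith h M) e S \<phi>"
      by (subst e, subst S'(2)) (simp add: feval_image[OF assms])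
  qed
qed

definition is_model :: "'a arith \<Rightarrow> bool" where
  "is_model M \<longleftrightarrow> Sets M \<noteq> {} \<and> (\<forall>\<phi>\<in>RCA0_star. valid_in M \<phi>)"

definition refutes :: "'a arith \<Rightarrow> bool" where
  "refutes M \<longleftrightarrow> valid_in M (Neg WKL) \<and>
     \<not> (valid_in M (standard_models_fm nat_sentence) \<and> valid_in M (categorical_fm nat_sentence))"

text \<open>The operations on this type are those of a countermodel if there is one, and the standard
  ones otherwise. So the results proved for the class \<open>rca\<close> refute the existence of a countermodel.\<close>

datatype point = Point nat

text \<open>A class instance cannot depend on a local hypothesis, so the case distinction on the
  existence of a countermodel is hidden in the choice.\<close>

definition chosen :: "point arith" where
  "chosen = (SOME M. is_model M \<and> ((\<exists>M :: point arith. is_model M \<and> refutes M) \<longrightarrow> refutes M))"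

lemma bij_Point: "bij Point"
  by (metis bijI' point.exhaust point.inject)

lemma is_model_image: "is_model (image_arith Point M) \<longleftrightarrow> is_model M"
  by (simp add: is_model_def valid_in_image[OF bij_Point]) (simp add: image_arith_def)

lemma refutes_image: "refutes (image_arith Point M) \<longleftrightarrow> refutes M"
  by (simp add: refutes_def valid_in_image[OF bij_Point])

lemma chosen:
  fixes M :: "point arith"
  shows "is_model chosen" "is_model M \<Longrightarrow> refutes M \<Longrightarrow> refutes chosen"
proof -
  have "is_model (image_arith Point nat_arith)"
    unfolding is_model_image by (simp add: is_model_def nat_arith_valid)
  then have "\<exists>M :: point arith. is_model M \<and> ((\<exists>M :: point arith. is_model M \<and> refutes M) \<longrightarrow> refutes M)"
    by blast
  from someI_ex[OF this]
  have "is_model chosen \<and> ((\<exists>M :: point arith. is_model M \<and> refutes M) \<longrightarrow> refutes chosen)"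
    unfolding chosen_def .
  then show "is_model chosen" "is_model M \<Longrightarrow> refutes M \<Longrightarrow> refutes chosen" by blast+
qed

instantiation point :: l2
begin

definition "0 = zer chosen"
definition "1 = uni chosen"
definition "x + y = add chosen x y"
definition "x * y = mul chosen x y"
definition "x < y \<longleftrightarrow> lt chosen x y"
definition "x \<le> y \<longleftrightarrow> x < y \<or> x = (y :: point)"
definition "sets = Sets chosen"

instance ..

end

lemma std_point: "(std :: point arith) = chosen"
  by (simp add: std_def zero_point_def one_point_def plus_point_def[abs_def] times_point_def[abs_def]
      less_point_def[abs_def] sets_point_def)

instantiation point :: rca
begin

definition "x - y = (if y < x then THE d. x = y + d else (0 :: point))"

instance
proof
  show "(sets :: point set set) \<noteq> {}" "\<phi> \<in> RCA0_star \<Longrightarrow> valid_in (std :: point arith) \<phi>" for \<phi>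
    using chosen(1) unfolding std_point is_model_def sets_point_def by simp_all
qed (simp_all add: less_eq_point_def minus_point_def)

end

lemma not_refutes:
  fixes M :: "nat arith"
  assumes "is_model M" shows "\<not> refutes M"
proof
  assume "refutes M"
  then have "refutes (std :: point arith)"
    unfolding std_point using assms chosen(2)[of "image_arith Point M"]
    by (simp add: is_model_image refutes_image)
  then show False
    unfolding refutes_def using standard_models_valid[where 'a = point] categorical_valid[where 'a = point]
    by blast
qed

theorem theorem3:
  shows "\<exists>\<psi>. sentence \<psi> \<and> Sigma12 \<psi> \<and>
    proves (RCA0_star \<union> {Neg WKL}) (standard_models_fm \<psi>) \<and>
    proves (RCA0_star \<union> {Neg WKL}) (categorical_fm \<psi>)"
proof (intro exI conjI)
  have valid: "valid_in M (standard_models_fm nat_sentence) \<and> valid_in M (categorical_fm nat_sentence)"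
    if "Sets M \<noteq> {}" "\<forall>\<phi>\<in>RCA0_star \<union> {Neg WKL}. valid_in M \<phi>" for M :: "nat arith"
    using not_refutes[of M] that by (auto simp: is_model_def refutes_def)
  have basic: "basic_axioms \<subseteq> RCA0_star \<union> {Neg WKL}" by (auto simp: RCA0_star_def)
  show "proves (RCA0_star \<union> {Neg WKL}) (standard_models_fm nat_sentence)"
    "proves (RCA0_star \<union> {Neg WKL}) (categorical_fm nat_sentence)"
    by (rule completeness[OF basic], use valid in blast)+
qed (fact sentence_nat_sentence Sigma12_nat_sentence)+

end
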